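(* Assume that conditions (u), (f), (g), $(\partial)$ stated in the context hold. Let $(x^0,u^0)\in C_{loc}(\mathbb T,\mathbb X)\times\mathfrak U$ be an optimal pair for the problem of maximizing $J$ over $\mathfrak U$ (so $x^0=\varphi[u^0]$). Consider the system $$\dot x(t)=f\big(t,x(t),u^0(t)\big),\qquad \dot\psi(t)=-\frac{\partial\mathcal H}{\partial x}\big(x(t),t,u^0(t),\lambda,\psi(t)\big),\qquad \dot\lambda=0,$$ and suppose that every solution $(x^0,\psi^0,\lambda^0)$ of this system (with $x$-component $x^0$) has, in $G_0=\mathbb X\times\mathbb X\times[0,1]$, for the control $u^0$, a Lyapunov stable component $\psi^0$. Then for every unboundedly increasing sequence of times $(\tau_n)_{n\in\mathbb N}$ in $\mathbb T$ there exists a solution $(x^0,u^0,\lambda^\infty,\psi^\infty)\in\mathfrak Z$ of all relations of the maximum principle such that, in addition, $$\liminf_{n\to\infty}\|\psi^\infty(\tau_n)\|_{\mathbb X}=0.$$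
   Context: $\mathbb T=[0,\infty)$; $\mathbb X=\mathbb R^m$; $\mathbb U$ is a finite-dimensional Euclidean space; $E',E''$ denote finite-dimensional Euclidean spaces. $C_{loc}(\mathbb T,E)$ is the space of continuous functions with the topology of uniform convergence on compact sets. Integrals over unbounded intervals are improper: $\int_{\mathbb T}a\,dt=\lim_{T\to\infty}\int_{[0,T]}a\,dt$. $\Omega$ is the set of continuous $\omega:\mathbb T\to\mathbb T$ with $\lim_{t\to\infty}\omega(t)=0$. Condition (u): $U:\mathbb T\to\{\text{compact subsets of }\mathbb U\}$ is bounded on every compact set and its graph $\mathrm{Gr}\,U=\{(t,u):u\in U(t)\}$ is a closed Borel subset of $\mathbb T\times\mathbb U$. A function $a:\mathbb T\times E'\times\mathbb U\to E''$ is: Carathéodory if it is measurable in $t$ for all fixed $(y,u)$ and $a(t,\cdot,\cdot):E'\times U(t)\to E''$ is continuous for every $t$; locally Lipschitz if for every compact $K\subset E'\times\mathrm{Gr}\,U$ there is $L_K:\mathbb T\to\mathbb T$, integrable on compacts, with $\|a(t,x',u)-a(t,x'',u)\|\le L_K(t)\|x'-x''\|$ for all $(x',t,u),(x'',t,u)\in K$; it has a measurable majorant if for every compact $K\subset E'\times\mathrm{Gr}\,U$ there is $M_K:\mathbb T\to\mathbb T$, integrable on compacts, with $\|a(t,x,u)\|\le M_K(t)$ for all $(x,t,u)\in K$; it satisfies the extendability condition if it has sublinear growth in $x$: $\|a(t,x,u)\|\le M(t)(1+\|x\|)$ for all $x$ and $(t,u)\in\mathrm{Gr}\,U$, with $M$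 integrable on compacts. Condition (f): $f:\mathbb T\times\mathbb X\times\mathbb U\to\mathbb X$ is Carathéodory, locally Lipschitz, has a measurable majorant and satisfies the extendability condition. $\mathfrak U$ is the set of all measurable selectors of $U$ (admissible controls). For $u\in\mathfrak U$, $\varphi[u]$ is the unique solution on $\mathbb T$ of $\dot x=f(t,x,u(t))$, $x(0)=0$. Condition (g): $g:\mathbb T\times\mathbb X\times\mathbb U\to\mathbb R$ is a locally Lipschitz Carathéodory function with a measurable majorant, and there is $\omega\in\Omega$ such that $\int_{[T,\infty)}|g(t,\varphi[u](t),u(t))|\,dt\le\omega(T)$ for all $u\in\mathfrak U$, $T\in\mathbb T$. Condition $(\partial)$: the derivatives $\partial f(t,x,u)/\partial x$ and $\partial g(t,x,u)/\partial x$ exist and are, on $\mathbb T\times\mathbb X\times\mathbb U$, locally Lipschitz Carathéodory maps having an integrable majorant on every compact set. The functional is $J(u)=\int_{\mathbb T}g(t,\varphi[u](t),u(t))\,dt$, to be maximized over $\mathfrak U$. $\mathcal H(x,t,u,\lambda,\psi)=\psi f(t,x,u)+\lambda g(t,x,u)$. $\mathfrak Z$ is the set of $(x,u,\lambda,\psi)\in C_{loc}(\mathbb T,\mathbb X)\times\mathfrak U\times[0,1]\times C_{loc}(\mathbb T,\mathbb X)$ satisfying the relations of the maximum principle: for a.a. $t\in\mathbb T$, $\dot x(t)=f(t,x(t),u(t))$, $\dot\psi(t)=-\frac{\partial\mathcal H}{\partial x}(x(t),t,u(t),\lambda,\psi(t))$, $\mathcal H(x(t),t,u(t),\lambda,\psi(t))=\sup_{p\in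 U(t)}\mathcal H(x(t),t,p,\lambda,\psi(t))$, together with $x(0)=0$, $\|\psi(0)\|_{\mathbb X}+\lambda=1$. A solution $(x^0,\psi^0,\lambda^0)$ of the system in the claim, with initial value in $G_0$, has, in $G_0$, for the control $u^0$, a Lyapunov stable component $\psi^0$ if for every $\varepsilon>0$ there is $\delta>0$ such that for every solution $(x,\psi,\lambda)$ of the same system with initial value $(x(0),\psi(0),\lambda)\in G_0$ at distance less than $\delta$ from $(x^0(0),\psi^0(0),\lambda^0)$ one has $\|\psi(s)-\psi^0(s)\|<\varepsilon$ for all $s\in\mathbb T$.
   Formalization: "Carathéodory" is taken to require also that t ↦ a(t,y,v(t)) be measurable for every fixed y and every admissible control v; with measurability only for fixed (y,u) the claim fails when U(t) moves, e.g. U(t)={t}. *)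

theory Defs
  imports "HOL-Analysis.Analysis"
begin

(* The time axis is {0..}. Functions of time are total functions on the reals whose values at
   negative times are never used. *)

definition C_loc :: "(real \<Rightarrow> 'a::euclidean_space) set" where
  "C_loc = {x. continuous_on {0..} x}"

definition Omega :: "(real \<Rightarrow> real) set" where
  "Omega = {\<omega>. continuous_on {0..} \<omega> \<and> (\<forall>t\<ge>0. 0 \<le> \<omega> t) \<and> (\<omega> \<longlongrightarrow> 0) at_top}"

definition integrable_on_compacts :: "(real \<Rightarrow> real) \<Rightarrow> bool" where
  "integrable_on_compacts M \<longleftrightarrow>
     (\<forall>t\<ge>0. 0 \<le> M t) \<and> (\<forall>C. compact C \<and> C \<subseteq> {0..} \<longrightarrow> set_integrable lebesgue C M)"

definition has_improper_integral :: "real \<Rightarrow> (real \<Rightarrow> real) \<Rightarrow> real \<Rightarrow> bool" where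
  "has_improper_integral T a I \<longleftrightarrow>
     (\<forall>S\<ge>T. set_integrable lebesgue {T..S} a) \<and>
     ((\<lambda>S. set_lebesgue_integral lebesgue {T..S} a) \<longlongrightarrow> I) at_top"

definition improper_integral :: "real \<Rightarrow> (real \<Rightarrow> real) \<Rightarrow> real" where
  "improper_integral T a = (THE I. has_improper_integral T a I)"


subsection \<open>Admissible controls and regularity of maps\<close>

definition Gr :: "(real \<Rightarrow> 'u::euclidean_space set) \<Rightarrow> (real \<times> 'u) set" where
  "Gr U = {(t, u). 0 \<le> t \<and> u \<in> U t}"

definition cond_u :: "(real \<Rightarrow> 'u::euclidean_space set) \<Rightarrow> bool" where
  "cond_u U \<longleftrightarrow>
     (\<forall>t\<ge>0. compact (U t)) \<and>
     (\<forall>C. compact C \<and> C \<subseteq> {0..} \<longrightarrow> bounded (\<Union>t\<in>C. U t)) \<and>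
     closed (Gr U)"

definition controls :: "(real \<Rightarrow> 'u::euclidean_space set) \<Rightarrow> (real \<Rightarrow> 'u) set" where
  "controls U = {u. u \<in> borel_measurable (lebesgue_on {0..}) \<and> (\<forall>t\<ge>0. u t \<in> U t)}"

(* Measurability in t is required not only for constant u but also along every admissible control.
   This is automatic if a(t,.,.) is continuous on the whole space, or if U is constant. For a
   moving U(t), where continuity is only known on E' x U(t), it has to be stated: if U(t) = {t},
   constant u say nothing about the measurability of t |-> a(t,y,t). *)
definition caratheodory ::
  "(real \<Rightarrow> 'u::euclidean_space set) \<Rightarrow>
   (real \<Rightarrow> 'e::euclidean_space \<Rightarrow> 'u \<Rightarrow> 'd::euclidean_space) \<Rightarrow> bool" where
  "caratheodory U a \<longleftrightarrow>
     (\<forall>y u. (\<lambda>t. a t y u) \<in> borel_measurable (lebesgue_on {0..})) \<and>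
     (\<forall>y. \<forall>v\<in>controls U. (\<lambda>t. a t y (v t)) \<in> borel_measurable (lebesgue_on {0..})) \<and>
     (\<forall>t\<ge>0. continuous_on (UNIV \<times> U t) (\<lambda>(y, u). a t y u))"

definition locally_lipschitz ::
  "(real \<Rightarrow> 'u::euclidean_space set) \<Rightarrow>
   (real \<Rightarrow> 'e::euclidean_space \<Rightarrow> 'u \<Rightarrow> 'd::euclidean_space) \<Rightarrow> bool" where
  "locally_lipschitz U a \<longleftrightarrow>
     (\<forall>K. compact K \<and> K \<subseteq> UNIV \<times> Gr U \<longrightarrow>
       (\<exists>L. integrable_on_compacts L \<and>
         (\<forall>x' x'' t u. (x', t, u) \<in> K \<and> (x'', t, u) \<in> K \<longrightarrow>
            norm (a t x' u - a t x'' u) \<le> L t * norm (x' - x''))))"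

definition measurable_majorant ::
  "(real \<Rightarrow> 'u::euclidean_space set) \<Rightarrow>
   (real \<Rightarrow> 'e::euclidean_space \<Rightarrow> 'u \<Rightarrow> 'd::euclidean_space) \<Rightarrow> bool" where
  "measurable_majorant U a \<longleftrightarrow>
     (\<forall>K. compact K \<and> K \<subseteq> UNIV \<times> Gr U \<longrightarrow>
       (\<exists>M. integrable_on_compacts M \<and> (\<forall>(x, t, u)\<in>K. norm (a t x u) \<le> M t)))"

definition extendability ::
  "(real \<Rightarrow> 'u::euclidean_space set) \<Rightarrow>
   (real \<Rightarrow> 'e::euclidean_space \<Rightarrow> 'u \<Rightarrow> 'd::euclidean_space) \<Rightarrow> bool" where
  "extendability U a \<longleftrightarrow>
     (\<exists>M. integrable_on_compacts M \<and>
       (\<forall>x. \<forall>(t, u)\<in>Gr U. norm (a t x u) \<le> M t * (1 + norm x)))"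

definition cond_f ::
  "(real \<Rightarrow> 'u::euclidean_space set) \<Rightarrow> (real \<Rightarrow> real^'m \<Rightarrow> 'u \<Rightarrow> real^'m) \<Rightarrow> bool" where
  "cond_f U f \<longleftrightarrow>
     caratheodory U f \<and> locally_lipschitz U f \<and> measurable_majorant U f \<and> extendability U f"


subsection \<open>Solutions of differential equations\<close>

definition absolutely_continuous_on_interval ::
  "real \<Rightarrow> real \<Rightarrow> (real \<Rightarrow> 'a::euclidean_space) \<Rightarrow> bool" where
  "absolutely_continuous_on_interval a b x \<longleftrightarrow>
     (\<forall>\<epsilon>>0. \<exists>\<delta>>0. \<forall>D. D division_of (\<Union>D) \<and> \<Union>D \<subseteq> {a..b} \<and> (\<Sum>k\<in>D. Sup k - Inf k) < \<delta> \<longrightarrow>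
        (\<Sum>k\<in>D. norm (x (Sup k) - x (Inf k))) < \<epsilon>)"

(* x'(t) = v(t) for almost all t, in the Caratheodory sense: x is locally absolutely continuous. *)
definition has_ae_derivative ::
  "(real \<Rightarrow> 'a::euclidean_space) \<Rightarrow> (real \<Rightarrow> 'a) \<Rightarrow> bool" where
  "has_ae_derivative x v \<longleftrightarrow>
     (\<forall>T\<ge>0. absolutely_continuous_on_interval 0 T x) \<and>
     (AE t in lebesgue_on {0..}. (x has_vector_derivative v t) (at t within {0..}))"

(* The restriction to extensional functions only pins down the values at negative times. *)
definition traj ::
  "(real \<Rightarrow> real^'m \<Rightarrow> 'u::euclidean_space \<Rightarrow> real^'m) \<Rightarrow> (real \<Rightarrow> 'u) \<Rightarrow> real \<Rightarrow> real^'m" where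
  "traj f u = (THE x. x \<in> extensional {0..} \<and> x \<in> C_loc \<and>
                 has_ae_derivative x (\<lambda>t. f t (x t) (u t)) \<and> x 0 = 0)"

definition cond_g ::
  "(real \<Rightarrow> 'u::euclidean_space set) \<Rightarrow> (real \<Rightarrow> real^'m \<Rightarrow> 'u \<Rightarrow> real^'m) \<Rightarrow>
   (real \<Rightarrow> real^'m \<Rightarrow> 'u \<Rightarrow> real) \<Rightarrow> bool" where
  "cond_g U f g \<longleftrightarrow>
     locally_lipschitz U g \<and> caratheodory U g \<and> measurable_majorant U g \<and>
     (\<exists>\<omega>\<in>Omega. \<forall>u\<in>controls U. \<forall>T\<ge>0.
        \<exists>I. has_improper_integral T (\<lambda>t. \<bar>g t (traj f u t) (u t)\<bar>) I \<and> I \<le> \<omega> T)"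

definition gradient :: "('a::euclidean_space \<Rightarrow> real) \<Rightarrow> 'a \<Rightarrow> 'a" where
  "gradient F x = (THE d. GDERIV F x :> d)"

definition cond_d ::
  "(real \<Rightarrow> 'u::euclidean_space set) \<Rightarrow> (real \<Rightarrow> real^'m \<Rightarrow> 'u \<Rightarrow> real^'m) \<Rightarrow>
   (real \<Rightarrow> real^'m \<Rightarrow> 'u \<Rightarrow> real) \<Rightarrow> bool" where
  "cond_d U f g \<longleftrightarrow>
     (\<forall>t\<ge>0. \<forall>x u. (\<lambda>y. f t y u) differentiable (at x) \<and> (\<lambda>y. g t y u) differentiable (at x)) \<and>
     (let fx = (\<lambda>t x u. jacobian (\<lambda>y. f t y u) (at x));
          gx = (\<lambda>t x u. gradient (\<lambda>y. g t y u) x)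
      in locally_lipschitz U fx \<and> caratheodory U fx \<and> measurable_majorant U fx \<and>
         locally_lipschitz U gx \<and> caratheodory U gx \<and> measurable_majorant U gx)"


subsection \<open>The control problem and the maximum principle\<close>

definition J ::
  "(real \<Rightarrow> real^'m \<Rightarrow> 'u::euclidean_space \<Rightarrow> real^'m) \<Rightarrow> (real \<Rightarrow> real^'m \<Rightarrow> 'u \<Rightarrow> real) \<Rightarrow>
   (real \<Rightarrow> 'u) \<Rightarrow> real" where
  "J f g u = improper_integral 0 (\<lambda>t. g t (traj f u t) (u t))"

definition optimal_pair ::
  "(real \<Rightarrow> 'u::euclidean_space set) \<Rightarrow> (real \<Rightarrow> real^'m \<Rightarrow> 'u \<Rightarrow> real^'m) \<Rightarrow>
   (real \<Rightarrow> real^'m \<Rightarrow> 'u \<Rightarrow> real) \<Rightarrow> (real \<Rightarrow> real^'m) \<Rightarrow> (real \<Rightarrow> 'u) \<Rightarrow> bool" where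
  "optimal_pair U f g x\<^sub>0 u\<^sub>0 \<longleftrightarrow>
     x\<^sub>0 \<in> C_loc \<and> u\<^sub>0 \<in> controls U \<and> (\<forall>t\<ge>0. x\<^sub>0 t = traj f u\<^sub>0 t) \<and>
     (\<forall>u\<in>controls U. J f g u \<le> J f g u\<^sub>0)"

(* Row vectors psi are identified with elements of R^m, so psi f is an inner product and dH/dx
   is a gradient. *)
definition Ham ::
  "(real \<Rightarrow> real^'m \<Rightarrow> 'u::euclidean_space \<Rightarrow> real^'m) \<Rightarrow> (real \<Rightarrow> real^'m \<Rightarrow> 'u \<Rightarrow> real) \<Rightarrow>
   real^'m \<Rightarrow> real \<Rightarrow> 'u \<Rightarrow> real \<Rightarrow> real^'m \<Rightarrow> real" where
  "Ham f g x t u lam \<psi> = \<psi> \<bullet> f t x u + lam * g t x u"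

definition Ham_x ::
  "(real \<Rightarrow> real^'m \<Rightarrow> 'u::euclidean_space \<Rightarrow> real^'m) \<Rightarrow> (real \<Rightarrow> real^'m \<Rightarrow> 'u \<Rightarrow> real) \<Rightarrow>
   real^'m \<Rightarrow> real \<Rightarrow> 'u \<Rightarrow> real \<Rightarrow> real^'m \<Rightarrow> real^'m" where
  "Ham_x f g x t u lam \<psi> = gradient (\<lambda>y. Ham f g y t u lam \<psi>) x"

(* The equation lambda' = 0 is accounted for by taking lambda to be a constant. *)
definition state_adjoint_solution ::
  "(real \<Rightarrow> real^'m \<Rightarrow> 'u::euclidean_space \<Rightarrow> real^'m) \<Rightarrow> (real \<Rightarrow> real^'m \<Rightarrow> 'u \<Rightarrow> real) \<Rightarrow>
   (real \<Rightarrow> 'u) \<Rightarrow> (real \<Rightarrow> real^'m) \<Rightarrow> (real \<Rightarrow> real^'m) \<Rightarrow> real \<Rightarrow> bool" where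
  "state_adjoint_solution f g u x \<psi> lam \<longleftrightarrow>
     x \<in> C_loc \<and> \<psi> \<in> C_loc \<and>
     has_ae_derivative x (\<lambda>t. f t (x t) (u t)) \<and>
     has_ae_derivative \<psi> (\<lambda>t. - Ham_x f g (x t) t (u t) lam (\<psi> t))"

definition PMP ::
  "(real \<Rightarrow> 'u::euclidean_space set) \<Rightarrow> (real \<Rightarrow> real^'m \<Rightarrow> 'u \<Rightarrow> real^'m) \<Rightarrow>
   (real \<Rightarrow> real^'m \<Rightarrow> 'u \<Rightarrow> real) \<Rightarrow>
   ((real \<Rightarrow> real^'m) \<times> (real \<Rightarrow> 'u) \<times> real \<times> (real \<Rightarrow> real^'m)) set" where
  "PMP U f g = {(x, u, lam, \<psi>).
     u \<in> controls U \<and> lam \<in> {0..1} \<and>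
     state_adjoint_solution f g u x \<psi> lam \<and>
     (AE t in lebesgue_on {0..}.
        Ham f g (x t) t (u t) lam (\<psi> t) = (SUP p\<in>U t. Ham f g (x t) t p lam (\<psi> t))) \<and>
     x 0 = 0 \<and> norm (\<psi> 0) + lam = 1}"

definition lyapunov_stable_component ::
  "((real^'m) \<times> (real^'m) \<times> real) set \<Rightarrow>
   (real \<Rightarrow> real^'m \<Rightarrow> 'u::euclidean_space \<Rightarrow> real^'m) \<Rightarrow> (real \<Rightarrow> real^'m \<Rightarrow> 'u \<Rightarrow> real) \<Rightarrow>
   (real \<Rightarrow> 'u) \<Rightarrow> (real \<Rightarrow> real^'m) \<Rightarrow> (real \<Rightarrow> real^'m) \<Rightarrow> real \<Rightarrow> bool" where
  "lyapunov_stable_component G f g u x\<^sub>0 \<psi>\<^sub>0 lam\<^sub>0 \<longleftrightarrow>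
     (\<forall>\<epsilon>>0. \<exists>\<delta>>0. \<forall>x \<psi> lam.
        state_adjoint_solution f g u x \<psi> lam \<and> (x 0, \<psi> 0, lam) \<in> G \<and>
        dist (x 0, \<psi> 0, lam) (x\<^sub>0 0, \<psi>\<^sub>0 0, lam\<^sub>0) < \<delta> \<longrightarrow>
        (\<forall>s\<ge>0. norm (\<psi> s - \<psi>\<^sub>0 s) < \<epsilon>))"

end

(* A maximiser is approximated on the finite horizons tau n. By the uniform tail bound, u0 maximises
   the cost on [0, tau n] up to an error that tends to 0. Replace u0 on small sets E by a fixed
   competing control w and take an almost maximiser E of (cost on [0, tau n]) - |E|^2: then |E| tends
   to 0, and the adjoint function of the modified control that vanishes at tau n, normalised at
   time 0, satisfies the Hamiltonian inequality for w up to a vanishing error. After a time Theta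
   the modified control is u0, so its state and adjoint can be continued backward from Theta by the
   u0-system; this changes the initial values by o(1). Lyapunov stability compares this continued
   solution, which vanishes at tau n, with the one starting at the limiting initial value, and so
   forces the latter to be small at tau n. Finally the set of normalised initial values with
   vanishing lower limit is compact: if each of them violated the maximum condition, finitely many
   violations would cover the set, and a single w glued from the corresponding controls would
   contradict the first part. *)

theory Submission
  imports Defs
begin

section \<open>Indefinite integrals and absolutely continuous functions\<close>

text \<open>Lyapunov stability is assumed for the \<open>u\<^sub>0\<close>-system alone and says
  nothing about adjoint functions of other controls. Hence competitors differ from
  \<open>u\<^sub>0\<close> only on a bounded set of times, cut down further to times where a common
  majorant of the data is bounded: there, for a fixed horizon, the first-order expansion of the cost
  has an error quadratic in the measure, uniformly in the competitor. The penalty is quadratic for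
  two reasons: near-optimality of \<open>u\<^sub>0\<close> bounds \<open>|E|^2\<close> by the tail
  error, and the marginal penalty \<open>2|E|\<close> then vanishes as well, as in Ekeland's
  principle. The adjoint functions may be unbounded at time 0 as the horizon grows; dividing by
  \<open>1 + norm (\<phi> 0)\<close> keeps the multipliers in a compact set, at the price of a
  possible limit \<open>lam = 0\<close>. The limit depends on the competitor \<open>w\<close>, so it
  need not satisfy the maximum condition for all controls. Closedness of the set of possible limits,
  again a consequence of stability, turns the passage to all controls into a finite intersection
  argument.\<close>

lemma AE_lebesgue_on_iff_negligible:
  assumes "S \<in> sets lebesgue"
  shows "(AE x in lebesgue_on S. P x) \<longleftrightarrow> negligible {x\<in>S. \<not> P x}"
proof -
  have "(AE x in lebesgue_on S. P x) \<longleftrightarrow> (AE x in lebesgue. x \<in> S \<longrightarrow> P x)"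
    using assms by (simp add: AE_restrict_space_iff)
  also have "\<dots> \<longleftrightarrow> (\<exists>N\<in>null_sets lebesgue. {x\<in>S. \<not> P x} \<subseteq> N)"
    by (auto simp: eventually_ae_filter)
  also have "\<dots> \<longleftrightarrow> negligible {x\<in>S. \<not> P x}"
    using negligible_iff_null_sets negligible_subset by blast
  finally show ?thesis .
qed

text \<open>The bad points are Vitali covered by intervals on which the Henstock sum of \<open>h\<close> is off by more
  than \<open>e\<close> times the length; by Henstock's lemma disjoint such intervals have small total length.\<close>

lemma lebesgue_differentiation_aux:
  fixes h :: "real \<Rightarrow> 'a::euclidean_space"
  assumes h: "h integrable_on {a..b}" and e: "e > 0"
    and F: "\<And>t. F t = integral {a..t} h"
  shows "negligible {x\<in>{a<..<b}. \<forall>d>0. \<exists>y\<in>{a<..<b}. \<bar>y - x\<bar> < d \<and> y \<noteq> x \<and>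
           e * \<bar>y - x\<bar> < norm (F y - F x - (y - x) *\<^sub>R h x)}" (is "negligible ?B")
  unfolding negligible_outer_le
proof (intro allI impI)
  fix \<eta> :: real assume \<eta>: "0 < \<eta>"
  have h': "h integrable_on cbox a b" using h by simp
  obtain \<gamma> where \<gamma>: "gauge \<gamma>"
    and hen: "\<And>p. \<lbrakk>p tagged_partial_division_of (cbox a b); \<gamma> fine p\<rbrakk> \<Longrightarrow>
             sum (\<lambda>(x,k). norm (measure lborel k *\<^sub>R h x - integral k h)) p < e * \<eta>"
    using Henstock_lemma[OF h', of "e * \<eta>"] e \<eta> by auto
  \<comment> \<open>A pair \<open>i\<close> encodes the interval between a bad point
    \<open>fst i\<close>, which becomes its tag, and a witness \<open>snd i\<close>. Written as a
    ball it fits Vitali's theorem; keeping it inside \<open>\<gamma> (fst i)\<close> makes every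
    finite disjoint subfamily \<open>\<gamma>\<close>-fine.\<close>
  define c where "c = (\<lambda>i::real \<times> real. (fst i + snd i) / 2)"
  define r where "r = (\<lambda>i::real \<times> real. \<bar>snd i - fst i\<bar> / 2)"
  define K where "K = {i. fst i \<in> {a<..<b} \<and> snd i \<in> {a<..<b} \<and> snd i \<noteq> fst i \<and>
      e * \<bar>snd i - fst i\<bar> < norm (F (snd i) - F (fst i) - (snd i - fst i) *\<^sub>R h (fst i)) \<and>
      cball (c i) (r i) \<subseteq> \<gamma> (fst i)}"
  have cb: "cball (c i) (r i) = {min (fst i) (snd i)..max (fst i) (snd i)}" for i
    unfolding cball_eq_atLeastAtMost c_def r_def by (auto simp: min_def max_def field_simps abs_if)
  have r0: "0 < r i" if "i \<in> K" for i using that by (auto simp: K_def r_def)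
  have V: "\<exists>i. i \<in> K \<and> x \<in> cball (c i) (r i) \<and> r i < d" if x: "x \<in> ?B" and d: "0 < d" for x d
  proof -
    have "open (\<gamma> x)" "x \<in> \<gamma> x" using \<gamma> by (auto simp: gauge_def)
    then obtain \<delta> where \<delta>: "\<delta> > 0" "ball x \<delta> \<subseteq> \<gamma> x" by (meson openE)
    have "\<exists>y\<in>{a<..<b}. \<bar>y - x\<bar> < min d \<delta> \<and> y \<noteq> x \<and> e * \<bar>y - x\<bar> < norm (F y - F x - (y - x) *\<^sub>R h x)"
      using x d \<delta>(1) unfolding mem_Collect_eq by (metis (no_types, lifting) min_less_iff_conj)
    then obtain y where y: "y \<in> {a<..<b}" "\<bar>y - x\<bar> < min d \<delta>" "y \<noteq> x"
      "e * \<bar>y - x\<bar> < norm (F y - F x - (y - x) *\<^sub>R h x)" by blast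
    have "cball (c (x,y)) (r (x,y)) \<subseteq> ball x \<delta>"
      unfolding cb using y by (auto simp: dist_real_def min_def max_def abs_if split: if_splits)
    then have "(x,y) \<in> K" unfolding K_def using x y \<delta>(2) by auto
    moreover have "x \<in> cball (c (x,y)) (r (x,y))" unfolding cb by auto
    moreover have "r (x,y) < d" using y by (auto simp: r_def)
    ultimately show ?thesis by blast
  qed
  obtain C where C: "countable C" "C \<subseteq> K"
    "pairwise (\<lambda>i j. disjnt (cball (c i) (r i)) (cball (c j) (r j))) C"
    "negligible (?B - (\<Union>i \<in> C. cball (c i) (r i)))"
    using Vitali_covering_theorem_cballs[of K r ?B c, OF r0 V] by auto
  let ?A = "\<lambda>i. cball (c i) (r i)"
  have Fdiff: "integral {u..v} h = F v - F u" if "a \<le> u" "u \<le> v" "v \<le> b" for u v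
  proof -
    have "h integrable_on {a..v}" using h by (rule integrable_on_subinterval) (use that in auto)
    then have "integral {a..u} h + integral {u..v} h = integral {a..v} h"
      using that by (intro Henstock_Kurzweil_Integration.integral_combine) auto
    then show ?thesis by (simp add: F algebra_simps)
  qed
  have bound: "measure lebesgue (\<Union>i\<in>I. ?A i) \<le> \<eta>" if I: "I \<subseteq> C" "finite I" for I
  proof -
    define p where "p = (\<lambda>i. (fst i, ?A i)) ` I"
    have dis: "?A i \<inter> ?A j = {}" if "i \<in> I" "j \<in> I" "i \<noteq> j" for i j
      using C(3) I that by (auto simp: pairwise_def disjnt_def)
    have mem: "fst i \<in> ?A i" for i unfolding cb by auto
    have inj: "inj_on (\<lambda>i. (fst i, ?A i)) I"
      using dis mem by (fastforce simp: inj_on_def)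
    have IK: "i \<in> K" if "i \<in> I" for i using that I C by auto
    have "p tagged_partial_division_of (cbox a b)"
      unfolding tagged_partial_division_of_def
    proof (intro conjI allI impI)
      show "finite p" using I by (auto simp: p_def)
      fix x k assume xk: "(x,k) \<in> p"
      then obtain i where i: "i \<in> I" "x = fst i" "k = ?A i" by (auto simp: p_def)
      show "x \<in> k" using mem i by auto
      show "k \<subseteq> cbox a b" using IK[OF i(1)] unfolding i cb by (auto simp: K_def)
      show "\<exists>a b. k = cbox a b" unfolding i cb by (metis box_real(2))
    next
      fix x k x' k' assume x'k': "(x,k) \<in> p \<and> (x',k') \<in> p \<and> (x,k) \<noteq> (x',k')"
      then obtain i where i: "i \<in> I" "x = fst i" "k = ?A i" by (auto simp: p_def)
      from x'k' obtain j where j: "j \<in> I" "x' = fst j" "k' = ?A j" by (auto simp: p_def)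
      have "i \<noteq> j" using x'k' i j by auto
      then have "k \<inter> k' = {}" using dis i j by blast
      then show "interior k \<inter> interior k' = {}" using interior_subset by blast
    qed
    moreover have "\<gamma> fine p" using IK by (auto simp: fine_def p_def K_def)
    ultimately have lt: "sum (\<lambda>(x,k). norm (measure lborel k *\<^sub>R h x - integral k h)) p < e * \<eta>"
      by (rule hen)
    have "e * measure lebesgue (\<Union>i\<in>I. ?A i) \<le> e * (\<Sum>i\<in>I. measure lebesgue (?A i))"
      using e I by (intro mult_left_mono measure_UNION_le) auto
    also have "\<dots> = (\<Sum>i\<in>I. e * measure lebesgue (?A i))" by (simp add: sum_distrib_left)
    also have "\<dots> \<le> (\<Sum>i\<in>I. norm (measure lborel (?A i) *\<^sub>R h (fst i) - integral (?A i) h))"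
    proof (rule sum_mono)
      fix i assume "i \<in> I"
      then have i: "i \<in> K" using IK by auto
      obtain x y where xy: "i = (x,y)" by (cases i)
      have *: "a \<le> x" "x \<le> b" "a \<le> y" "y \<le> b" using i xy by (auto simp: K_def)
      have bd: "e * \<bar>y - x\<bar> < norm (F y - F x - (y - x) *\<^sub>R h x)" using i xy by (auto simp: K_def)
      show "e * measure lebesgue (?A i) \<le> norm (measure lborel (?A i) *\<^sub>R h (fst i) - integral (?A i) h)"
      proof (cases "x \<le> y")
        case True
        then have "?A i = {x..y}" using cb[of i] xy by auto
        moreover have "norm ((y - x) *\<^sub>R h x - (F y - F x)) = norm (F y - F x - (y - x) *\<^sub>R h x)"
          by (rule norm_minus_commute)
        ultimately show ?thesis using True bd xy Fdiff[of x y] * by simp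
      next
        case False
        then have "?A i = {y..x}" using cb[of i] xy by auto
        moreover have "norm ((x - y) *\<^sub>R h x - (F x - F y)) = norm (F y - F x - (y - x) *\<^sub>R h x)"
          by (simp add: algebra_simps)
        ultimately show ?thesis using False bd xy Fdiff[of y x] * by simp
      qed
    qed
    also have "\<dots> = sum (\<lambda>(x,k). norm (measure lborel k *\<^sub>R h x - integral k h)) p"
      unfolding p_def by (subst sum.reindex[OF inj]) simp
    also have "\<dots> < e * \<eta>" by (rule lt)
    finally show ?thesis using e by simp
  qed
  have T1: "(\<Union>i\<in>C. ?A i) \<in> lmeasurable" "measure lebesgue (\<Union>i\<in>C. ?A i) \<le> \<eta>"
    by (rule fmeasurable_UN_bound[OF C(1) _ bound] measure_UN_bound[OF C(1) _ bound]; simp)+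
  have N: "?B - (\<Union>i\<in>C. ?A i) \<in> null_sets lebesgue"
    using C(4) negligible_iff_null_sets by blast
  then have N': "?B - (\<Union>i\<in>C. ?A i) \<in> lmeasurable"
    using C(4) negligible_imp_measurable by blast
  have "measure lebesgue ((\<Union>i\<in>C. ?A i) \<union> (?B - (\<Union>i\<in>C. ?A i))) = measure lebesgue (\<Union>i\<in>C. ?A i)"
    using N T1(1) by (simp add: measure_Un_null_set fmeasurableD del: Un_Diff_cancel)
  then show "\<exists>T. ?B \<subseteq> T \<and> T \<in> lmeasurable \<and> measure lebesgue T \<le> \<eta>"
    using T1 N' by (intro exI[of _ "(\<Union>i\<in>C. ?A i) \<union> (?B - (\<Union>i\<in>C. ?A i))"]) (auto simp del: Un_Diff_cancel)
qed

text \<open>If the derivative at \<open>x\<close> fails, then some tolerance is violated at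
  arbitrarily small scales. The tolerances \<open>1 / (n + 1)\<close> suffice, so the exceptional
  set lies in a countable union of null sets.\<close>

lemma lebesgue_differentiation:
  fixes h :: "real \<Rightarrow> 'a::euclidean_space"
  assumes h: "h integrable_on {a..b}"
  shows "negligible {x\<in>{a<..<b}. \<not> ((\<lambda>t. integral {a..t} h) has_vector_derivative h x) (at x)}"
proof -
  define F where "F = (\<lambda>t. integral {a..t} h)"
  define B where "B = (\<lambda>e. {x\<in>{a<..<b}. \<forall>d>0. \<exists>y\<in>{a<..<b}. \<bar>y - x\<bar> < d \<and> y \<noteq> x \<and>
           e * \<bar>y - x\<bar> < norm (F y - F x - (y - x) *\<^sub>R h x)})"
  have "negligible (B (1 / (real n + 1)))" for n
    unfolding B_def by (rule lebesgue_differentiation_aux[OF h]) (auto simp: F_def)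
  then have "negligible (\<Union>n. B (1 / (real n + 1)))" by (intro negligible_countable_Union) auto
  moreover have "(F has_vector_derivative h x) (at x)"
    if x: "x \<in> {a<..<b}" and nB: "x \<notin> (\<Union>n. B (1 / (real n + 1)))" for x
    unfolding has_vector_derivative_def has_derivative_within_alt
  proof (intro conjI allI impI)
    show "bounded_linear (\<lambda>y. y *\<^sub>R h x)" by (rule bounded_linear_scaleR_left)
    fix e :: real assume "e > 0"
    then obtain n where n: "1 / (real n + 1) < e"
      using reals_Archimedean[of e] by (auto simp: inverse_eq_divide add.commute)
    have "x \<notin> B (1 / (real n + 1))" using nB by auto
    then obtain d where d: "d > 0" "\<And>y. y \<in> {a<..<b} \<Longrightarrow> \<bar>y - x\<bar> < d \<Longrightarrow> y \<noteq> x \<Longrightarrow>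
         norm (F y - F x - (y - x) *\<^sub>R h x) \<le> 1 / (real n + 1) * \<bar>y - x\<bar>"
    proof -
      have "\<not> (\<forall>d>0. \<exists>y\<in>{a<..<b}. \<bar>y - x\<bar> < d \<and> y \<noteq> x \<and>
           1 / (real n + 1) * \<bar>y - x\<bar> < norm (F y - F x - (y - x) *\<^sub>R h x))"
        using x \<open>x \<notin> B (1 / (real n + 1))\<close> unfolding B_def by blast
      then obtain d where "d > 0" "\<not> (\<exists>y\<in>{a<..<b}. \<bar>y - x\<bar> < d \<and> y \<noteq> x \<and>
           1 / (real n + 1) * \<bar>y - x\<bar> < norm (F y - F x - (y - x) *\<^sub>R h x))" by blast
      then show thesis by (intro that[of d]) (auto simp only: not_less)
    qed
    \<comment> \<open>The bad sets test only \<open>y\<close> inside \<open>{a<..<b}\<close>, so the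
      radius must also keep \<open>y\<close> in this interval.\<close>
    define d' where "d' = min d (min (x - a) (b - x))"
    have "d' > 0" using d x by (auto simp: d'_def)
    moreover have "norm (F y - F x - (y - x) *\<^sub>R h x) \<le> e * norm (y - x)" if y: "norm (y - x) < d'" for y
    proof (cases "y = x")
      case False
      have "y \<in> {a<..<b}" "\<bar>y - x\<bar> < d" using y x by (auto simp: d'_def)
      then have "norm (F y - F x - (y - x) *\<^sub>R h x) \<le> 1 / (real n + 1) * \<bar>y - x\<bar>" using d False by blast
      also have "\<dots> \<le> e * \<bar>y - x\<bar>" using n by (intro mult_right_mono) auto
      finally show ?thesis by simp
    qed auto
    ultimately show "\<exists>d>0. \<forall>y\<in>UNIV. norm (y - x) < d \<longrightarrow> norm (F y - F x - (y - x) *\<^sub>R h x) \<le> e * norm (y - x)"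
      by blast
  qed
  ultimately show ?thesis
    unfolding F_def[symmetric] by (elim negligible_subset) auto
qed

text \<open>Dominated convergence for the truncations of \<open>m\<close> at height
  \<open>k\<close>. It supplies the absolute continuity of the integral in the form used next:
  \<open>m\<close> is bounded by \<open>N\<close> up to an excess of small integral.\<close>

lemma integral_excess_small:
  fixes m :: "real \<Rightarrow> real"
  assumes m: "m absolutely_integrable_on {a..b}" and m0: "\<And>t. t \<in> {a..b} \<Longrightarrow> 0 \<le> m t" and e: "e > 0"
  obtains N :: real where "N \<ge> 0" "integral {a..b} (\<lambda>t. m t - min (m t) N) < e"
    "(\<lambda>t. m t - min (m t) N) integrable_on {a..b}"
proof -
  have "(\<lambda>t. c) absolutely_integrable_on {a..b}" for c :: real
    by (intro absolutely_integrable_continuous_real continuous_intros)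
  then have int: "(\<lambda>t. m t - min (m t) c) absolutely_integrable_on {a..b}" for c
    using m by (intro absolutely_integrable_min_1 set_integral_diff) auto
  have "(\<lambda>k. integral {a..b} (\<lambda>t. m t - min (m t) (real k))) \<longlonglongrightarrow> integral {a..b} (\<lambda>t. 0)"
  proof (rule dominated_convergence)
    show "(\<lambda>t. m t - min (m t) (real k)) integrable_on {a..b}" for k
      using int set_lebesgue_integral_eq_integral(1) by blast
    show "m integrable_on {a..b}" using m set_lebesgue_integral_eq_integral(1) by blast
    show "norm (m t - min (m t) (real k)) \<le> m t" if "t \<in> {a..b}" for k t
      using m0[OF that] by (auto simp: min_def)
    show "(\<lambda>k. m t - min (m t) (real k)) \<longlonglongrightarrow> 0" if "t \<in> {a..b}" for t
    proof (rule tendsto_eventually)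
      obtain n where "m t \<le> real n" using real_arch_simple by blast
      then show "\<forall>\<^sub>F k in sequentially. m t - min (m t) (real k) = 0"
        by (auto simp: eventually_sequentially min_def intro!: exI[of _ n])
    qed
  qed
  then have "\<forall>\<^sub>F k in sequentially. integral {a..b} (\<lambda>t. m t - min (m t) (real k)) < e"
    using e by (simp add: order_tendstoD(2))
  then obtain k where "integral {a..b} (\<lambda>t. m t - min (m t) (real k)) < e"
    by (auto simp: eventually_sequentially)
  then show thesis using set_lebesgue_integral_eq_integral(1)[OF int[of "real k"]]
    by (intro that[of "real k"]) simp_all
qed

text \<open>The increments over a division add up to at most the integral of the excess of
  \<open>m\<close> over \<open>N\<close> plus \<open>N\<close> times the total length.\<close>

lemma absolutely_continuous_dominated:
  fixes x :: "real \<Rightarrow> 'a::euclidean_space"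
  assumes m: "m absolutely_integrable_on {a..b}" and m0: "\<And>t. t \<in> {a..b} \<Longrightarrow> 0 \<le> m t"
    and x: "\<And>s t. a \<le> s \<Longrightarrow> s \<le> t \<Longrightarrow> t \<le> b \<Longrightarrow> norm (x t - x s) \<le> integral {s..t} m"
  shows "absolutely_continuous_on_interval a b x"
  unfolding absolutely_continuous_on_interval_def
proof (intro allI impI)
  fix \<epsilon> :: real assume \<epsilon>: "\<epsilon> > 0"
  obtain N where N: "N \<ge> 0" "integral {a..b} (\<lambda>t. m t - min (m t) N) < \<epsilon>/2"
    and int: "(\<lambda>t. m t - min (m t) N) integrable_on {a..b}"
    using integral_excess_small[OF m m0, of "\<epsilon>/2"] \<epsilon> by auto
  have mi: "m integrable_on {a..b}" using m set_lebesgue_integral_eq_integral(1) by blast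
  have mini: "(\<lambda>t. min (m t) N) integrable_on {a..b}"
    using integrable_diff[OF mi int] by simp
  \<comment> \<open>The total length is kept below \<open>\<epsilon> / (2 * (N + 1))\<close>, where
    \<open>N + 1\<close> also covers \<open>N = 0\<close>.\<close>
  have "norm (\<Sum>k\<in>D. norm (x (Sup k) - x (Inf k))) < \<epsilon>"
    if D: "D division_of (\<Union>D)" "\<Union>D \<subseteq> {a..b}" "(\<Sum>k\<in>D. Sup k - Inf k) < \<epsilon> / (2 * (N + 1))" for D
  proof -
    have "(\<Sum>k\<in>D. norm (x (Sup k) - x (Inf k)))
        \<le> (\<Sum>k\<in>D. integral k (\<lambda>t. m t - min (m t) N) + N * (Sup k - Inf k))"
    proof (rule sum_mono)
      fix k assume k: "k \<in> D"
      obtain c d where "k = cbox c d" "k \<noteq> {}" using division_ofD(3,4)[OF D(1) k] by blast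
      then have cd: "k = {c..d}" "c \<le> d" by auto
      have sub: "{c..d} \<subseteq> {a..b}" using D(2) k cd by blast
      have "norm (x d - x c) \<le> integral {c..d} m" using sub cd by (intro x) auto
      also have "\<dots> = integral {c..d} (\<lambda>t. (m t - min (m t) N) + min (m t) N)" by simp
      also have "\<dots> = integral {c..d} (\<lambda>t. m t - min (m t) N) + integral {c..d} (\<lambda>t. min (m t) N)"
        using integrable_on_subinterval[OF int sub] integrable_on_subinterval[OF mini sub]
        by (rule integral_add)
      also have "integral {c..d} (\<lambda>t. min (m t) N) \<le> integral {c..d} (\<lambda>t. N)"
        using integrable_on_subinterval[OF mini sub] by (intro integral_le) auto
      also have "\<dots> = N * (d - c)" using cd by simp
      finally show "norm (x (Sup k) - x (Inf k)) \<le> integral k (\<lambda>t. m t - min (m t) N) + N * (Sup k - Inf k)"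
        using cd by simp
    qed
    also have "\<dots> = (\<Sum>k\<in>D. integral k (\<lambda>t. m t - min (m t) N)) + N * (\<Sum>k\<in>D. Sup k - Inf k)"
      by (simp add: sum.distrib sum_distrib_left)
    also have "(\<Sum>k\<in>D. integral k (\<lambda>t. m t - min (m t) N)) = integral (\<Union>D) (\<lambda>t. m t - min (m t) N)"
      using has_integral_combine_division_topdown[OF int D(1,2)] by (simp add: integral_unique)
    also have "integral (\<Union>D) (\<lambda>t. m t - min (m t) N) \<le> integral {a..b} (\<lambda>t. m t - min (m t) N)"
      using has_integral_combine_division_topdown[OF int D(1,2)] D(2) int
      by (intro integral_subset_le) (auto simp: integrable_on_def)
    also have "\<dots> < \<epsilon>/2" by (rule N)
    also have "N * (\<Sum>k\<in>D. Sup k - Inf k) \<le> N * (\<epsilon> / (2 * (N + 1)))"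
      using N D(3) by (intro mult_left_mono) auto
    also have "\<dots> \<le> \<epsilon>/2" using N \<epsilon> by (simp add: field_simps)
    finally show ?thesis by (simp add: sum_nonneg)
  qed
  then show "\<exists>\<delta>>0. \<forall>D. D division_of \<Union> D \<and> \<Union> D \<subseteq> {a..b} \<and> (\<Sum>k\<in>D. Sup k - Inf k) < \<delta> \<longrightarrow>
              (\<Sum>k\<in>D. norm (x (Sup k) - x (Inf k))) < \<epsilon>"
    using \<epsilon> N by (intro exI[of _ "\<epsilon> / (2 * (N + 1))"]) (auto simp: sum_nonneg)
qed

text \<open>Henstock sums are compared with the telescoping sum of the increments of
  \<open>x\<close>. Intervals tagged off \<open>N\<close> are controlled by the derivative,
  intervals tagged in \<open>N\<close> by absolute continuity, since they lie in an open set of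
  small measure.\<close>

lemma absolutely_continuous_ftc:
  fixes x :: "real \<Rightarrow> 'a::euclidean_space"
  assumes ab: "a \<le> b" and ac: "absolutely_continuous_on_interval a b x" and N: "negligible N"
    and v: "\<And>t. t \<in> {a..b} - N \<Longrightarrow> (x has_vector_derivative v t) (at t within {a..b})"
  shows "(v has_integral (x b - x a)) {a..b}"
proof (rule has_integral_spike[OF N])
  \<comment> \<open>The values of \<open>v\<close> on \<open>N\<close> are arbitrary; with the value
    0 there, tags in \<open>N\<close> contribute nothing to the Riemann sum.\<close>
  define w where "w = (\<lambda>t. if t \<in> N then 0 else v t)"
  show "v t = w t" if "t \<in> {a..b} - N" for t using that by (auto simp: w_def)
  show "(w has_integral (x b - x a)) {a..b}"
    unfolding has_integral_real
  proof (intro allI impI)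
    fix \<epsilon> :: real assume \<epsilon>: "\<epsilon> > 0"
    \<comment> \<open>Summed over the intervals tagged off \<open>N\<close> this tolerance yields at
      most \<open>e * (b - a) < \<epsilon> / 2\<close>; the \<open>+ 1\<close> covers
      \<open>a = b\<close>.\<close>
    define e where "e = \<epsilon> / (2 * (b - a + 1))"
    have e: "e > 0" using \<epsilon> ab by (auto simp: e_def)
    obtain \<delta> where \<delta>: "\<delta> > 0" and ac': "\<And>D. D division_of (\<Union>D) \<Longrightarrow> \<Union>D \<subseteq> {a..b} \<Longrightarrow>
        (\<Sum>k\<in>D. Sup k - Inf k) < \<delta> \<Longrightarrow> (\<Sum>k\<in>D. norm (x (Sup k) - x (Inf k))) < \<epsilon>/2"
      using ac \<epsilon> unfolding absolutely_continuous_on_interval_def by (meson half_gt_zero)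
    have Nnull: "N \<in> null_sets lebesgue" using N negligible_iff_null_sets by blast
    obtain G where G: "open G" "N \<subseteq> G" "(G - N) \<in> lmeasurable" "emeasure lebesgue (G - N) < ennreal \<delta>"
      using sets_lebesgue_outer_open[of N \<delta>] Nnull \<delta> by blast
    have Gm: "G \<in> lmeasurable"
      using G(3) Nnull by (metis G(2) fmeasurable.Un N negligible_imp_measurable Un_Diff_cancel2 sup.absorb1)
    have "measure lebesgue G = measure lebesgue (G - N)"
      using Gm Nnull by (simp add: measure_Diff_null_set fmeasurableD)
    also have "\<dots> < \<delta>"
      using G(3,4) \<delta> by (simp add: emeasure_eq_measure2 ennreal_less_iff)
    finally have G\<delta>: "measure lebesgue G < \<delta>" .
    \<comment> \<open>The gauge at \<open>t\<close>: inside \<open>G\<close> for \<open>t\<close> in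
      \<open>N\<close>, otherwise small enough for the derivative estimate with tolerance
      \<open>e\<close>. Off \<open>{a..b}\<close> any radius will do.\<close>
    have "\<exists>d>0. (t \<in> N \<longrightarrow> ball t d \<subseteq> G) \<and>
            (t \<in> {a..b} - N \<longrightarrow> (\<forall>y\<in>{a..b}. \<bar>y - t\<bar> < d \<longrightarrow> norm (x y - x t - (y - t) *\<^sub>R w t) \<le> e * \<bar>y - t\<bar>))" for t
    proof (cases "t \<in> N")
      case True
      then show ?thesis using G by (meson DiffD2 openE subsetD)
    next
      case False
      show ?thesis
      proof (cases "t \<in> {a..b}")
        case True
        then have "(x has_vector_derivative w t) (at t within {a..b})" using v[of t] False by (auto simp: w_def)
        then show ?thesis
          unfolding has_vector_derivative_def has_derivative_within_alt using e False by (auto simp: True)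
      qed (use False in \<open>auto intro: exI[of _ 1]\<close>)
    qed
    then obtain d where d0: "\<And>t. d t > 0" and dN: "\<And>t. t \<in> N \<Longrightarrow> ball t (d t) \<subseteq> G"
      and dn: "\<And>t y. t \<in> {a..b} - N \<Longrightarrow> y \<in> {a..b} \<Longrightarrow> \<bar>y - t\<bar> < d t \<Longrightarrow>
           norm (x y - x t - (y - t) *\<^sub>R w t) \<le> e * \<bar>y - t\<bar>"
      by metis
    define \<gamma> where "\<gamma> = (\<lambda>t. ball t (d t))"
    have gau: "gauge \<gamma>" using d0 by (auto simp: gauge_def \<gamma>_def)
    have key: "norm ((\<Sum>(t,k)\<in>p. measure lborel k *\<^sub>R w t) - (x b - x a)) < \<epsilon>"
      if p: "p tagged_division_of {a..b}" and fine: "\<gamma> fine p" for p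
    proof -
      have fin: "finite p" using p by auto
      have pD: "\<exists>c d'. k = {c..d'} \<and> c \<le> t \<and> t \<le> d' \<and> a \<le> c \<and> d' \<le> b \<and> k \<subseteq> ball t (d t)" if tk: "(t,k) \<in> p" for t k
      proof -
        have 1: "t \<in> k" "k \<subseteq> {a..b}" using p tk by blast+
        obtain c d' where 2: "k = cbox c d'" using tagged_division_ofD(4)[OF p tk] by blast
        have 3: "k \<subseteq> ball t (d t)" using fine tk by (auto simp: fine_def \<gamma>_def)
        show ?thesis using 1 2 3 by (intro exI[of _ c] exI[of _ d']) auto
      qed
      define p1 where "p1 = {q\<in>p. fst q \<in> N}"
      define p2 where "p2 = {q\<in>p. fst q \<notin> N}"
      have pp: "p = p1 \<union> p2" "p1 \<inter> p2 = {}" "finite p1" "finite p2" using fin by (auto simp: p1_def p2_def)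
      have part: "p1 tagged_partial_division_of {a..b}"
        using tagged_division_of_def p tagged_partial_division_subset[of p "{a..b}" p1] by (auto simp: p1_def)
      let ?S = "\<lambda>(t,k). measure lborel k *\<^sub>R w t - (x (Sup k) - x (Inf k))"
      have "(\<Sum>(t,k)\<in>p. measure lborel k *\<^sub>R w t) - (x b - x a) = (\<Sum>q\<in>p. ?S q)"
        using additive_tagged_division_1[OF ab p, of x] by (simp add: sum_subtractf case_prod_unfold)
      also have "\<dots> = (\<Sum>q\<in>p1. ?S q) + (\<Sum>q\<in>p2. ?S q)"
        using pp by (simp add: sum.union_disjoint)
      finally have eq: "norm ((\<Sum>(t,k)\<in>p. measure lborel k *\<^sub>R w t) - (x b - x a))
           \<le> norm (\<Sum>q\<in>p1. ?S q) + norm (\<Sum>q\<in>p2. ?S q)" by (simp add: norm_triangle_ineq)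
      have "norm (\<Sum>q\<in>p2. ?S q) \<le> (\<Sum>q\<in>p2. case q of (t,k) \<Rightarrow> e * (Sup k - Inf k))"
      proof (rule sum_norm_le)
        fix q assume q: "q \<in> p2"
        obtain t k where tk: "q = (t,k)" by (cases q)
        then have "(t,k) \<in> p" "t \<notin> N" using q by (auto simp: p2_def)
        then obtain c d' where k: "k = {c..d'}" "c \<le> t" "t \<le> d'" "a \<le> c" "d' \<le> b" "k \<subseteq> ball t (d t)" using pD by blast
        have cin: "c \<in> ball t (d t)" "d' \<in> ball t (d t)"
          using k(2,3) k(6)[unfolded k(1), THEN subsetD] by auto
        have 1: "norm (x c - x t - (c - t) *\<^sub>R w t) \<le> e * \<bar>c - t\<bar>"
          using cin k \<open>t \<notin> N\<close> by (intro dn) (auto simp: dist_real_def)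
        have 2: "norm (x d' - x t - (d' - t) *\<^sub>R w t) \<le> e * \<bar>d' - t\<bar>"
          using cin k \<open>t \<notin> N\<close> by (intro dn) (auto simp: dist_real_def)
        \<comment> \<open>Straddle estimate: the interval is split at its tag, both endpoints are in
          reach of the derivative estimate, and
          \<open>\<bar>c - t\<bar> + \<bar>d' - t\<bar>\<close> is the length.\<close>
        have "?S q = (x c - x t - (c - t) *\<^sub>R w t) - (x d' - x t - (d' - t) *\<^sub>R w t)"
          using k tk by (simp add: algebra_simps)
        then have "norm (?S q) \<le> e * \<bar>c - t\<bar> + e * \<bar>d' - t\<bar>"
          using norm_triangle_ineq4 add_mono[OF 1 2] order_trans by (simp only:) blast
        also have "\<dots> = e * (Sup k - Inf k)" using k by (simp add: algebra_simps)
        finally show "norm (?S q) \<le> (case q of (t,k) \<Rightarrow> e * (Sup k - Inf k))" using tk by simp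
      qed
      also have "\<dots> \<le> (\<Sum>q\<in>p. case q of (t,k) \<Rightarrow> e * (Sup k - Inf k))"
      proof (rule sum_mono2[OF fin])
        show "p2 \<subseteq> p" by (auto simp: p2_def)
        fix q assume "q \<in> p - p2"
        then obtain t k where tk: "q = (t,k)" "(t,k) \<in> p" by (cases q) auto
        then obtain c d' where "k = {c..d'}" "c \<le> t" "t \<le> d'" using pD by blast
        then show "0 \<le> (case q of (t,k) \<Rightarrow> e * (Sup k - Inf k))" using e tk by simp
      qed
      also have "\<dots> = e * (\<Sum>(t,k)\<in>p. Sup k - Inf k)"
        by (simp add: sum_distrib_left case_prod_unfold)
      also have "(\<Sum>(t,k)\<in>p. Sup k - Inf k) = b - a"
        using additive_tagged_division_1[OF ab p, of "\<lambda>x. x"] by simp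
      also have "e * (b - a) < \<epsilon>/2" using \<epsilon> ab by (simp add: e_def field_simps)
      finally have s2: "norm (\<Sum>q\<in>p2. ?S q) < \<epsilon>/2" .
      let ?D = "snd ` p1"
      have D: "?D division_of \<Union>?D" using partial_division_of_tagged_division[OF part] .
      have kD: "\<exists>c d'. k = {c..d'} \<and> c \<le> d'" if k: "k \<in> ?D" for k
      proof -
        obtain t where "(t,k) \<in> p" using k by (auto simp: p1_def)
        from pD[OF this] show ?thesis by force
      qed
      have "(\<Sum>k\<in>?D. Sup k - Inf k) = (\<Sum>k\<in>?D. measure lborel k)"
      proof (rule sum.cong)
        fix k assume "k \<in> ?D"
        then obtain c d' where "k = {c..d'}" "c \<le> d'" using kD by blast
        then show "Sup k - Inf k = measure lborel k" by simp
      qed simp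
      also have "\<dots> = (\<Sum>k\<in>?D. measure lebesgue k)"
      proof (rule sum.cong)
        fix k assume "k \<in> ?D"
        then obtain c d' where "k = {c..d'}" "c \<le> d'" using kD by blast
        then show "measure lborel k = measure lebesgue k" by simp
      qed simp
      also have "\<dots> = measure lebesgue (\<Union>?D)" using D by (rule content_division)
      also have "\<dots> \<le> measure lebesgue G"
      proof (rule measure_mono_fmeasurable)
        show "\<Union>?D \<subseteq> G"
        proof
          fix y assume "y \<in> \<Union>?D"
          then obtain t k where tk: "(t,k) \<in> p" "t \<in> N" "y \<in> k" by (auto simp: p1_def)
          then have "y \<in> ball t (d t)" using pD[OF tk(1)] by blast
          then show "y \<in> G" using dN tk by blast
        qed
        show "\<Union>?D \<in> sets lebesgue" using D by (simp add: lmeasurable_division fmeasurableD)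
      qed (rule Gm)
      also have "\<dots> < \<delta>" by (rule G\<delta>)
      finally have "(\<Sum>k\<in>?D. norm (x (Sup k) - x (Inf k))) < \<epsilon>/2"
      proof (intro ac'[OF D])
        show "\<Union>?D \<subseteq> {a..b}" using tagged_partial_division_ofD(3)[OF part] by fastforce
      qed
      moreover have "(\<Sum>(t,k)\<in>p1. norm (x (Sup k) - x (Inf k))) = (\<Sum>k\<in>?D. norm (x (Sup k) - x (Inf k)))"
      proof -
        \<comment> \<open>An interval can carry several tags in \<open>p1\<close> only if it is
          degenerate, and there \<open>?d\<close> vanishes; hence the sum over tagged intervals
          equals the sum over the set \<open>?D\<close>.\<close>
        let ?d = "\<lambda>k::real set. if k = {} then 0 else norm (x (Sup k) - x (Inf k))"
        have *: "?d {u..v} = 0" if "v \<le> u" for u v :: real using that by (cases "u = v") auto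
        have "(\<Sum>(t,k)\<in>p1. norm (x (Sup k) - x (Inf k))) = (\<Sum>(t,k)\<in>p1. ?d k)"
          using tagged_partial_division_ofD(2)[OF part] by (intro sum.cong) fastforce+
        also have "\<dots> = (\<Sum>k\<in>?D. ?d k)"
        proof (rule sum.over_tagged_division_lemma[OF tagged_partial_division_of_Union_self[OF part]])
          show "?d (cbox u v) = 0" if "box u v = {}" for u v :: real
            using *[of v u] that by (simp add: not_less)
        qed
        also have "\<dots> = (\<Sum>k\<in>?D. norm (x (Sup k) - x (Inf k)))"
        proof (rule sum.cong)
          fix k assume "k \<in> ?D"
          then obtain c d' where "k = {c..d'}" "c \<le> d'" using kD by blast
          then show "?d k = norm (x (Sup k) - x (Inf k))" by simp
        qed simp
        finally show ?thesis .
      qed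
      moreover have "norm (\<Sum>q\<in>p1. ?S q) \<le> (\<Sum>(t,k)\<in>p1. norm (x (Sup k) - x (Inf k)))"
        by (rule sum_norm_le) (auto simp: p1_def w_def norm_minus_commute)
      ultimately have "norm (\<Sum>q\<in>p1. ?S q) < \<epsilon>/2" by simp
      then show ?thesis using eq s2 by linarith
    qed
    show "\<exists>\<gamma>. gauge \<gamma> \<and> (\<forall>\<D>. \<D> tagged_division_of {a..b} \<and> \<gamma> fine \<D> \<longrightarrow>
          norm ((\<Sum>(x, k)\<in>\<D>. measure lborel k *\<^sub>R w x) - (x b - x a)) < \<epsilon>)"
      by (intro exI[of _ \<gamma>] conjI allI impI gau key) (erule conjE, assumption)+
  qed
qed

section \<open>Locally integrable functions and their primitives on the half line\<close>

definition loc_int :: "(real \<Rightarrow> 'a::euclidean_space) \<Rightarrow> bool" where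
  "loc_int h \<longleftrightarrow> (\<forall>T. h absolutely_integrable_on {0..T})"

text \<open>The integral form of local absolute continuity with derivative \<open>h\<close>; all
  differential equations below are treated in this form.\<close>

definition primitive :: "(real \<Rightarrow> 'a::euclidean_space) \<Rightarrow> (real \<Rightarrow> 'a) \<Rightarrow> bool" where
  "primitive x h \<longleftrightarrow> loc_int h \<and> (\<forall>t\<ge>0. x t = x 0 + integral {0..t} h)"

lemma loc_intD: "loc_int h \<Longrightarrow> 0 \<le> s \<Longrightarrow> h absolutely_integrable_on {s..t}"
  unfolding loc_int_def by (erule allE[of _ t], erule set_integrable_subset) simp_all

lemma loc_int_integrable: "loc_int h \<Longrightarrow> 0 \<le> s \<Longrightarrow> h integrable_on {s..t}"
  using loc_intD set_lebesgue_integral_eq_integral(1) by blast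

lemma loc_int_measurable:
  fixes h :: "real \<Rightarrow> 'a::euclidean_space"
  assumes "loc_int h" shows "h \<in> borel_measurable (lebesgue_on {0..})"
proof -
  have "(\<lambda>t. if t \<in> {0..} then h t else 0) \<in> borel_measurable lebesgue"
  proof (rule borel_measurable_LIMSEQ_metric)
    fix n :: nat
    have "h \<in> borel_measurable (lebesgue_on {0..real n})"
      using assms absolutely_integrable_measurable[of "{0..real n}" h] by (auto simp: loc_int_def)
    then show "(\<lambda>t. if t \<in> {0..real n} then h t else 0) \<in> borel_measurable lebesgue"
      by (subst borel_measurable_if) auto
  next
    fix t :: real
    obtain n where "t \<le> real n" using real_arch_simple by blast
    then show "(\<lambda>n. if t \<in> {0..real n} then h t else 0) \<longlonglongrightarrow> (if t \<in> {0..} then h t else 0)"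
      by (intro tendsto_eventually) (auto simp: eventually_sequentially intro!: exI[of _ n])
  qed
  then show ?thesis by (subst (asm) borel_measurable_if) auto
qed

lemma measurable_lebesgue_on_mono:
  fixes f :: "real \<Rightarrow> 'a::euclidean_space"
  assumes "f \<in> borel_measurable (lebesgue_on {0..})" "0 \<le> s"
  shows "f \<in> borel_measurable (lebesgue_on {s..t})"
  by (rule measurable_restrict_mono[OF assms(1)]) (use assms in auto)

lemma loc_int_dominated:
  fixes f :: "real \<Rightarrow> 'a::euclidean_space"
  assumes "f \<in> borel_measurable (lebesgue_on {0..})" "loc_int m" "\<And>t. 0 \<le> t \<Longrightarrow> norm (f t) \<le> m t"
  shows "loc_int f"
  unfolding loc_int_def
proof
  fix T
  show "f absolutely_integrable_on {0..T}"
    by (rule measurable_bounded_by_integrable_imp_absolutely_integrable[of f _ m])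
       (use assms measurable_lebesgue_on_mono[OF assms(1)] loc_int_integrable[OF assms(2)] in auto)
qed

lemma loc_int_cong:
  assumes "\<And>t. 0 \<le> t \<Longrightarrow> f t = g t" shows "loc_int f \<longleftrightarrow> loc_int g"
  unfolding loc_int_def by (intro all_cong1 set_integrable_cong) (auto simp: assms)

lemma loc_int_add: "loc_int f \<Longrightarrow> loc_int g \<Longrightarrow> loc_int (\<lambda>t. f t + g t)"
  unfolding loc_int_def by (auto intro: set_integral_add)

lemma loc_int_diff: "loc_int f \<Longrightarrow> loc_int g \<Longrightarrow> loc_int (\<lambda>t. f t - g t)"
  unfolding loc_int_def by (auto intro: set_integral_diff)

lemma loc_int_scaleR: "loc_int f \<Longrightarrow> loc_int (\<lambda>t. c *\<^sub>R f t)"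
  unfolding loc_int_def by (auto intro: set_integrable_scaleR_right)

lemma loc_int_norm: "loc_int f \<Longrightarrow> loc_int (\<lambda>t. norm (f t))"
  unfolding loc_int_def by (auto intro: absolutely_integrable_norm[unfolded comp_def])

lemma continuous_on_measurable_half_line:
  fixes c :: "real \<Rightarrow> 'a::euclidean_space"
  shows "continuous_on {0..} c \<Longrightarrow> c \<in> borel_measurable (lebesgue_on {0..})"
  by (rule continuous_imp_measurable_on_sets_lebesgue) auto

lemma loc_int_continuous:
  fixes c :: "real \<Rightarrow> 'a::euclidean_space"
  assumes "continuous_on {0..} c" shows "loc_int c"
  unfolding loc_int_def
  by (intro allI absolutely_integrable_continuous_real continuous_on_subset[OF assms]) auto

lemma loc_int_const: "loc_int (\<lambda>t. c)" by (intro loc_int_continuous continuous_intros)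

lemma continuous_bound:
  fixes c :: "real \<Rightarrow> 'a::euclidean_space"
  assumes "continuous_on {a..b} c"
  obtains B where "B \<ge> 0" "\<And>t. t \<in> {a..b} \<Longrightarrow> norm (c t) \<le> B"
proof -
  have "bounded (c ` {a..b})" using assms by (intro compact_imp_bounded compact_continuous_image) auto
  then obtain B where "\<forall>y\<in>c ` {a..b}. norm y \<le> B" by (auto simp: bounded_iff)
  then show thesis by (intro that[of "max B 0"]) (auto intro: max.coboundedI1)
qed

lemma loc_int_mult_continuous:
  fixes c h :: "real \<Rightarrow> real"
  assumes c: "continuous_on {0..} c" and h: "loc_int h"
  shows "loc_int (\<lambda>t. h t * c t)"
  unfolding loc_int_def
proof
  fix T
  have c': "continuous_on {0..T} c" using c by (rule continuous_on_subset) auto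
  then obtain B where B: "B \<ge> 0" "\<And>t. t \<in> {0..T} \<Longrightarrow> norm (c t) \<le> B" using continuous_bound by metis
  show "(\<lambda>t. h t * c t) absolutely_integrable_on {0..T}"
  proof (rule measurable_bounded_by_integrable_imp_absolutely_integrable[where g="\<lambda>t. norm (h t) * B"])
    have "(\<lambda>t. h t * c t) \<in> borel_measurable (lebesgue_on {0..})"
      using loc_int_measurable[OF h] continuous_on_measurable_half_line[OF c] by measurable
    then show "(\<lambda>t. h t * c t) \<in> borel_measurable (lebesgue_on {0..T})"
      by (rule measurable_lebesgue_on_mono) simp
    show "(\<lambda>t. norm (h t) * B) integrable_on {0..T}"
      using loc_int_integrable[OF loc_int_norm[OF h], of 0 T] by (rule integrable_on_mult_left) simp
    show "norm (h t * c t) \<le> norm (h t) * B" if "t \<in> {0..T}" for t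
      using B(2)[OF that] by (simp add: abs_mult mult_left_mono)
  qed simp
qed

lemma integral_diff_half_line:
  assumes "loc_int h" "0 \<le> s" "s \<le> t"
  shows "integral {0..t} h - integral {0..s} h = integral {s..t} h"
  using Henstock_Kurzweil_Integration.integral_combine[of 0 s t h] loc_int_integrable[OF assms(1), of 0 t] assms
  by (simp add: algebra_simps)

lemma primitive_loc_int: "primitive x h \<Longrightarrow> loc_int h"
  unfolding primitive_def by blast

lemma primitive_eq: "primitive x h \<Longrightarrow> 0 \<le> t \<Longrightarrow> x t = x 0 + integral {0..t} h"
  unfolding primitive_def by blast

lemma primitive_diff:
  assumes "primitive x h" "0 \<le> s" "s \<le> t" shows "x t - x s = integral {s..t} h"
proof -
  have "x t = x 0 + integral {0..t} h" "x s = x 0 + integral {0..s} h"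
    by (rule primitive_eq[OF assms(1)]; use assms(2,3) in linarith)+
  then show ?thesis using integral_diff_half_line[OF primitive_loc_int[OF assms(1)] assms(2,3)] by simp
qed

lemma primitive_continuous:
  fixes x :: "real \<Rightarrow> 'a::euclidean_space"
  assumes "primitive x h" shows "continuous_on {0..} x"
proof -
  have "continuous (at t within {0..}) x" if t: "0 \<le> t" for t
  proof -
    have "continuous_on {0..t+1} (\<lambda>s. x 0 + integral {0..s} h)"
      using assms by (intro continuous_intros indefinite_integral_continuous_1 loc_int_integrable)
        (auto intro: primitive_loc_int)
    then have "continuous_on {0..t+1} x"
      by (rule continuous_on_eq) (use primitive_eq[OF assms] in \<open>metis atLeastAtMost_iff\<close>)
    then have "continuous (at t within {0..t+1}) x" using t by (simp add: continuous_on_eq_continuous_within)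
    moreover have "at t within {0..t+1} = at t within {0..}"
      by (rule at_within_nhd[of _ "{..<t+1}"]) auto
    ultimately show ?thesis by simp
  qed
  then show ?thesis by (simp add: continuous_on_eq_continuous_within)
qed

lemma integral_norm_le:
  fixes h :: "real \<Rightarrow> 'a::euclidean_space"
  assumes "loc_int h" "loc_int m" "0 \<le> s" "\<And>r. r \<in> {s..t} \<Longrightarrow> norm (h r) \<le> m r"
  shows "norm (integral {s..t} h) \<le> integral {s..t} m"
  using assms by (intro Henstock_Kurzweil_Integration.integral_norm_bound_integral loc_int_integrable) auto

lemma primitive_norm_diff_le:
  fixes x :: "real \<Rightarrow> 'a::euclidean_space"
  assumes "primitive x h" "0 \<le> s" "s \<le> t" shows "norm (x t - x s) \<le> integral {s..t} (\<lambda>r. norm (h r))"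
  using primitive_diff[OF assms] integral_norm_le[of h "\<lambda>r. norm (h r)" s t] assms
  by (simp add: primitive_loc_int loc_int_norm)

lemma primitive_cong:
  assumes "\<And>t. 0 \<le> t \<Longrightarrow> h t = k t" "\<And>t. 0 \<le> t \<Longrightarrow> x t = y t" 
  shows "primitive x h \<longleftrightarrow> primitive y k"
proof -
  have "integral {0..t} h = integral {0..t} k" for t
    using assms by (intro Henstock_Kurzweil_Integration.integral_cong) auto
  moreover have "loc_int h \<longleftrightarrow> loc_int k" using assms by (intro loc_int_cong)
  moreover have "x t = y t" if "0 \<le> t" for t using assms that by simp
  ultimately show ?thesis unfolding primitive_def by simp
qed

lemma primitive_integral: "loc_int h \<Longrightarrow> primitive (\<lambda>t. c + integral {0..t} h) h"
  by (simp add: primitive_def)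

lemma primitive_ae_derivative:
  fixes x :: "real \<Rightarrow> 'a::euclidean_space"
  assumes "primitive x h"
  shows "AE t in lebesgue_on {0..}. (x has_vector_derivative h t) (at t within {0..})"
proof -
  let ?I = "\<lambda>t. integral {0..t} h"
  define N where "N = (\<lambda>n::nat. {t\<in>{0<..<real n}. \<not> (?I has_vector_derivative h t) (at t)})"
  have "negligible (N n)" for n
    unfolding N_def using assms by (intro lebesgue_differentiation loc_int_integrable primitive_loc_int) auto
  \<comment> \<open>The differentiation theorem speaks of interior points only, so the endpoint 0
    joins the exceptional set.\<close>
  then have "negligible (insert 0 (\<Union>n. N n))" by (intro negligible_insert[THEN iffD2] negligible_countable_Union) auto
  moreover have "{t\<in>{0..}. \<not> (x has_vector_derivative h t) (at t within {0..})} \<subseteq> insert 0 (\<Union>n. N n)"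
  proof
    fix t assume t: "t \<in> {t\<in>{0..}. \<not> (x has_vector_derivative h t) (at t within {0..})}"
    show "t \<in> insert 0 (\<Union>n. N n)"
    proof (rule ccontr)
      assume n: "t \<notin> insert 0 (\<Union>n. N n)"
      obtain n where "t < real n" using reals_Archimedean2 by blast
      then have "(?I has_vector_derivative h t) (at t)" using n t by (auto simp: N_def)
      then have "(?I has_vector_derivative h t) (at t within {0..})" by (rule has_vector_derivative_at_within)
      then have "((\<lambda>t. x 0 + ?I t) has_vector_derivative h t) (at t within {0..})"
        by (auto intro!: derivative_eq_intros)
      have "(x has_vector_derivative h t) (at t within {0..})"
      proof (rule has_vector_derivative_transform[OF _ _ \<open>((\<lambda>t. x 0 + ?I t) has_vector_derivative h t) (at t within {0..})\<close>])
        show "t \<in> {0..}" using t by simp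
        show "x s = x 0 + ?I s" if "s \<in> {0..}" for s by (rule primitive_eq[OF assms]) (use that in simp)
      qed
      then show False using t by simp
    qed
  qed
  ultimately have "negligible {t\<in>{0..}. \<not> (x has_vector_derivative h t) (at t within {0..})}"
    by (rule negligible_subset)
  then show ?thesis by (subst AE_lebesgue_on_iff_negligible) simp_all
qed

text \<open>Connects the differential equations of the problem with \<open>primitive\<close>. One
  direction is the differentiation theorem together with domination of the increments by the
  integral of \<open>norm (h t)\<close>, the other the fundamental theorem for absolutely continuous
  functions.\<close>

lemma has_ae_derivative_iff_primitive:
  fixes x :: "real \<Rightarrow> 'a::euclidean_space"
  assumes h: "loc_int h"
  shows "has_ae_derivative x h \<longleftrightarrow> primitive x h"
proof
  assume p: "primitive x h"
  have "absolutely_continuous_on_interval 0 T x" for T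
    using loc_intD[OF loc_int_norm[OF h]] primitive_norm_diff_le[OF p]
    by (intro absolutely_continuous_dominated[where m="\<lambda>t. norm (h t)"]) auto
  then show "has_ae_derivative x h" using primitive_ae_derivative[OF p] by (simp add: has_ae_derivative_def)
next
  assume d: "has_ae_derivative x h"
  let ?N = "{t\<in>{0..}. \<not> (x has_vector_derivative h t) (at t within {0..})}"
  have N: "negligible ?N" using d by (simp add: has_ae_derivative_def AE_lebesgue_on_iff_negligible)
  have "x t = x 0 + integral {0..t} h" if t: "0 \<le> t" for t
  proof -
    have "(h has_integral (x t - x 0)) {0..t}"
    proof (rule absolutely_continuous_ftc[OF t _ N])
      show "absolutely_continuous_on_interval 0 t x" using d t by (simp add: has_ae_derivative_def)
      show "(x has_vector_derivative h s) (at s within {0..t})" if "s \<in> {0..t} - ?N" for s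
        using that by (auto intro: has_vector_derivative_within_subset)
    qed
    then show ?thesis by (simp add: integral_unique)
  qed
  then show "primitive x h" using h unfolding primitive_def by blast
qed

text \<open>Once increments are dominated by the integral of one locally integrable function, a rule
  of calculus needs to be checked only pointwise almost everywhere. The product and exponential
  rules below are obtained in this way.\<close>

lemma primitive_dominatedI:
  fixes x :: "real \<Rightarrow> 'a::euclidean_space"
  assumes v: "loc_int v" and m: "loc_int m" "\<And>t. 0 \<le> t \<Longrightarrow> 0 \<le> m t"
    and x: "\<And>T. 0 \<le> T \<Longrightarrow> \<exists>C\<ge>0. \<forall>s t. 0 \<le> s \<longrightarrow> s \<le> t \<longrightarrow> t \<le> T \<longrightarrow> norm (x t - x s) \<le> C * integral {s..t} m"
    and d: "AE t in lebesgue_on {0..}. (x has_vector_derivative v t) (at t within {0..})"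
  shows "primitive x v"
proof -
  have "absolutely_continuous_on_interval 0 T x" if T: "0 \<le> T" for T
  proof -
    obtain C where C: "C \<ge> 0" "\<And>s t. 0 \<le> s \<Longrightarrow> s \<le> t \<Longrightarrow> t \<le> T \<Longrightarrow> norm (x t - x s) \<le> C * integral {s..t} m"
      using x[OF T] by blast
    have "loc_int (\<lambda>t. C * m t)" using loc_int_scaleR[OF m(1), of C] by simp
    then show ?thesis using C m loc_intD[of "\<lambda>t. C * m t" 0 T]
      by (intro absolutely_continuous_dominated[where m="\<lambda>t. C * m t"]) (auto simp: integral_mult_right)
  qed
  then have "has_ae_derivative x v" using d by (simp add: has_ae_derivative_def)
  then show ?thesis using v has_ae_derivative_iff_primitive by blast
qed

text \<open>Integration by parts in the form of a product rule. Applied to an adjoint function and a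
  difference of trajectories it yields the first variation of the cost.\<close>

lemma primitive_inner:
  fixes x y :: "real \<Rightarrow> 'a::euclidean_space"
  assumes x: "primitive x p" and y: "primitive y q"
  shows "primitive (\<lambda>t. x t \<bullet> y t) (\<lambda>t. x t \<bullet> q t + p t \<bullet> y t)"
proof -
  have xc: "continuous_on {0..} x" and yc: "continuous_on {0..} y" using x y primitive_continuous by auto
  have pi: "loc_int (\<lambda>t. norm (p t))" "loc_int (\<lambda>t. norm (q t))" 
    using primitive_loc_int[OF x] primitive_loc_int[OF y] by (simp_all add: loc_int_norm)
  have pm: "p \<in> borel_measurable (lebesgue_on {0..})" "q \<in> borel_measurable (lebesgue_on {0..})"
    
    using primitive_loc_int[OF x] primitive_loc_int[OF y] by (simp_all add: loc_int_measurable)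
  note xm = continuous_on_measurable_half_line[OF xc] continuous_on_measurable_half_line[OF yc]
  show ?thesis
  proof (rule primitive_dominatedI[where m="\<lambda>t. norm (p t) + norm (q t)"])
    show "loc_int (\<lambda>t. x t \<bullet> q t + p t \<bullet> y t)"
    proof (rule loc_int_dominated[where m="\<lambda>t. norm (q t) * norm (x t) + norm (p t) * norm (y t)"])
      show "(\<lambda>t. x t \<bullet> q t + p t \<bullet> y t) \<in> borel_measurable (lebesgue_on {0..})"
        using pm xm by measurable
      show "loc_int (\<lambda>t. norm (q t) * norm (x t) + norm (p t) * norm (y t))"
        using pi xc yc by (intro loc_int_add loc_int_mult_continuous continuous_intros)
      show "norm (x t \<bullet> q t + p t \<bullet> y t) \<le> norm (q t) * norm (x t) + norm (p t) * norm (y t)" for t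
        using Cauchy_Schwarz_ineq2[of "x t" "q t"] Cauchy_Schwarz_ineq2[of "p t" "y t"] by (simp add: mult.commute)
    qed
    show "loc_int (\<lambda>t. norm (p t) + norm (q t))" using pi by (rule loc_int_add)
    show "AE t in lebesgue_on {0..}. ((\<lambda>t. x t \<bullet> y t) has_vector_derivative x t \<bullet> q t + p t \<bullet> y t) (at t within {0..})"
      using primitive_ae_derivative[OF x] primitive_ae_derivative[OF y]
    proof eventually_elim
      case (elim t)
      then show ?case
        unfolding has_vector_derivative_def
        by (auto intro!: derivative_eq_intros simp: algebra_simps inner_commute fun_eq_iff)
    qed
    fix T :: real assume T: "0 \<le> T"
    have "continuous_on {0..T} x" "continuous_on {0..T} y" using xc yc by (auto intro: continuous_on_subset)
    then obtain A B where A: "A \<ge> 0" "\<And>t. t \<in> {0..T} \<Longrightarrow> norm (x t) \<le> A"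
      and B: "B \<ge> 0" "\<And>t. t \<in> {0..T} \<Longrightarrow> norm (y t) \<le> B" by (metis continuous_bound)
    show "\<exists>C\<ge>0. \<forall>s t. 0 \<le> s \<longrightarrow> s \<le> t \<longrightarrow> t \<le> T \<longrightarrow>
        norm (x t \<bullet> y t - x s \<bullet> y s) \<le> C * integral {s..t} (\<lambda>t. norm (p t) + norm (q t))"
    proof (intro exI[of _ "A + B"] conjI allI impI)
      fix s t :: real assume st: "0 \<le> s" "s \<le> t" "t \<le> T"
      have dx: "norm (x t - x s) \<le> integral {s..t} (\<lambda>r. norm (p r))"
        and dy: "norm (y t - y s) \<le> integral {s..t} (\<lambda>r. norm (q r))"
        using st x y primitive_norm_diff_le by auto
      have eq: "x t \<bullet> y t - x s \<bullet> y s = x t \<bullet> (y t - y s) + (x t - x s) \<bullet> y s"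
        by (simp add: inner_diff_left inner_diff_right)
      have "norm (x t \<bullet> y t - x s \<bullet> y s) \<le> norm (x t) * norm (y t - y s) + norm (x t - x s) * norm (y s)"
        unfolding eq using Cauchy_Schwarz_ineq2[of "x t" "y t - y s"] Cauchy_Schwarz_ineq2[of "x t - x s" "y s"]
        by (simp add: abs_le_iff)
      also have "\<dots> \<le> A * integral {s..t} (\<lambda>r. norm (q r)) + integral {s..t} (\<lambda>r. norm (p r)) * B"
        using A(1,2) B(1,2) dx dy st by (intro add_mono mult_mono) (auto intro: order_trans[OF norm_ge_zero])
      also have "\<dots> \<le> (A + B) * integral {s..t} (\<lambda>r. norm (q r)) + integral {s..t} (\<lambda>r. norm (p r)) * (A + B)"
        using A(1) B(1) dx dy norm_ge_zero order_trans
        by (intro add_mono mult_left_mono mult_right_mono) (auto intro: order_trans[OF norm_ge_zero])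
      also have "\<dots> = (A + B) * integral {s..t} (\<lambda>t. norm (p t) + norm (q t))"
        using pi st by (subst integral_add) (auto intro: loc_int_integrable simp: algebra_simps)
      finally show "norm (x t \<bullet> y t - x s \<bullet> y s) \<le> (A + B) * integral {s..t} (\<lambda>t. norm (p t) + norm (q t))" .
    qed (use A B in auto)
  qed simp
qed

lemma primitive_exp:
  fixes L l :: "real \<Rightarrow> real"
  assumes L: "primitive L l"
  shows "primitive (\<lambda>t. exp (c * L t)) (\<lambda>t. c * l t * exp (c * L t))"
proof (rule primitive_dominatedI[where m="\<lambda>t. norm (l t)"])
  have Lc: "continuous_on {0..} L" and li: "loc_int l" using L primitive_continuous primitive_loc_int by auto
  have "loc_int (\<lambda>t. l t * (c * exp (c * L t)))"
    using li Lc by (intro loc_int_mult_continuous continuous_intros)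
  then show "loc_int (\<lambda>t. c * l t * exp (c * L t))" by (simp only: mult_ac)
  show "loc_int (\<lambda>t. norm (l t))" using li by (rule loc_int_norm)
  show "AE t in lebesgue_on {0..}. ((\<lambda>t. exp (c * L t)) has_vector_derivative c * l t * exp (c * L t)) (at t within {0..})"
    using primitive_ae_derivative[OF L]
  proof eventually_elim
    case (elim t)
    then have "(L has_field_derivative l t) (at t within {0..})"
      by (simp add: has_real_derivative_iff_has_vector_derivative)
    then show ?case
      unfolding has_real_derivative_iff_has_vector_derivative[symmetric]
      by (auto intro!: derivative_eq_intros)
  qed
  fix T :: real assume T: "0 \<le> T"
  have "continuous_on {0..T} L" using Lc by (auto intro: continuous_on_subset)
  then obtain A where A: "A \<ge> 0" "\<And>t. t \<in> {0..T} \<Longrightarrow> norm (L t) \<le> A" by (metis continuous_bound)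
  show "\<exists>C\<ge>0. \<forall>s t. 0 \<le> s \<longrightarrow> s \<le> t \<longrightarrow> t \<le> T \<longrightarrow>
        norm (exp (c * L t) - exp (c * L s)) \<le> C * integral {s..t} (\<lambda>t. norm (l t))"
  proof (intro exI[of _ "exp (\<bar>c\<bar> * A) * \<bar>c\<bar>"] conjI allI impI)
    fix s t :: real assume st: "0 \<le> s" "s \<le> t" "t \<le> T"
    have "\<bar>L s\<bar> \<le> A" "\<bar>L t\<bar> \<le> A" using A(2)[of s] A(2)[of t] st by auto
    then have b: "\<bar>c * L s\<bar> \<le> \<bar>c\<bar> * A" "\<bar>c * L t\<bar> \<le> \<bar>c\<bar> * A" by (auto simp: abs_mult mult_left_mono)
    \<comment> \<open>Mean value inequality for \<open>exp\<close> on an interval containing all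
      values \<open>c * L t\<close> up to time \<open>T\<close>.\<close>
    have "norm (exp (c * L t) - exp (c * L s)) \<le> exp (\<bar>c\<bar> * A) * norm (c * L t - c * L s)"
    proof (rule field_differentiable_bound[of "{-(\<bar>c\<bar> * A)..\<bar>c\<bar> * A}" exp exp])
      show "norm (exp z) \<le> exp (\<bar>c\<bar> * A)" if "z \<in> {-(\<bar>c\<bar> * A)..\<bar>c\<bar> * A}" for z using that by simp
    qed (use b in \<open>auto intro!: derivative_eq_intros simp: abs_le_iff\<close>)
    also have "norm (c * L t - c * L s) = \<bar>c\<bar> * norm (L t - L s)"
      by (simp add: abs_mult right_diff_distrib[symmetric])
    also have "\<dots> \<le> \<bar>c\<bar> * integral {s..t} (\<lambda>t. norm (l t))"
      using primitive_norm_diff_le[OF L st(1,2)] by (intro mult_left_mono) auto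
    finally show "norm (exp (c * L t) - exp (c * L s)) \<le> exp (\<bar>c\<bar> * A) * \<bar>c\<bar> * integral {s..t} (\<lambda>t. norm (l t))"
      by (simp add: mult_ac)
  qed simp
qed simp

section \<open>Gronwall inequality and Caratheodory differential equations\<close>

lemma integral_exp_primitive:
  fixes L l :: "real \<Rightarrow> real"
  assumes L: "primitive L l" and st: "0 \<le> s" "s \<le> t"
  shows "integral {s..t} (\<lambda>r. c * l r * exp (c * L r)) = exp (c * L t) - exp (c * L s)"
    and "loc_int (\<lambda>r. c * l r * exp (c * L r))"
  using primitive_diff[OF primitive_exp[OF L, of c] st] primitive_loc_int[OF primitive_exp[OF L, of c]] by simp_all

lemma integral_nonneg_half_line:
  fixes l :: "real \<Rightarrow> real"
  assumes "loc_int l" "\<And>t. 0 \<le> t \<Longrightarrow> 0 \<le> l t" "0 \<le> s"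
  shows "0 \<le> integral {s..t} l"
  using assms by (intro Henstock_Kurzweil_Integration.integral_nonneg loc_int_integrable) auto

lemma integral_mono_half_line:
  fixes l m :: "real \<Rightarrow> real"
  assumes "loc_int l" "loc_int m" "0 \<le> s" "\<And>r. r \<in> {s..t} \<Longrightarrow> l r \<le> m r"
  shows "integral {s..t} l \<le> integral {s..t} m"
  using assms by (intro integral_le loc_int_integrable) auto

lemma integral_subset_half_line:
  fixes l :: "real \<Rightarrow> real"
  assumes "loc_int l" "\<And>t. 0 \<le> t \<Longrightarrow> 0 \<le> l t" "0 \<le> s'" "s' \<le> s" "t \<le> t'"
  shows "integral {s..t} l \<le> integral {s'..t'} l"
  using assms by (intro integral_subset_le loc_int_integrable) auto

text \<open>Both directions of time at once: \<open>\<sigma> = 1\<close> integrates forward from \<open>a\<close>, \<open>\<sigma> = -1\<close> backward from \<open>b\<close>.\<close>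

lemma gronwall_weighted:
  fixes l y :: "real \<Rightarrow> real" and \<sigma> :: real
  assumes l: "loc_int l" "\<And>t. 0 \<le> t \<Longrightarrow> 0 \<le> l t" and y: "continuous_on {0..} y"
    and ab: "0 \<le> a" "a \<le> b" and c: "0 \<le> c"
    and sig: "\<sigma> = 1 \<and> I = (\<lambda>t. {a..t}) \<or> \<sigma> = -1 \<and> I = (\<lambda>t. {t..b})"
    and le: "\<And>t. t \<in> {a..b} \<Longrightarrow> y t \<le> c + integral (I t) (\<lambda>s. l s * y s)"
    and t: "t \<in> {a..b}"
  shows "y t \<le> 2 * c * exp (2 * integral {a..b} l)"
proof -
  define L where "L = (\<lambda>t. \<sigma> * (0 + integral {0..t} l))"
  have "primitive (\<lambda>t. \<sigma> * (0 + integral {0..t} l)) (\<lambda>t. \<sigma> *\<^sub>R l t)"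
    unfolding primitive_def using l loc_int_scaleR[OF l(1), of \<sigma>] by (auto simp: integral_mult_right)
  then have L: "primitive L (\<lambda>t. \<sigma> * l t)" by (simp add: L_def)
  have Lc: "continuous_on {0..} L" using L by (rule primitive_continuous)
  \<comment> \<open>Because of the factor 2 in the weight, the integral term at a maximum point of
    \<open>w\<close> reproduces only half of the left side and can be absorbed. No differentiation
    of \<open>y\<close> is involved.\<close>
  define w where "w = (\<lambda>t. exp (- (2 * L t)) * y t)"
  have wc: "continuous_on {a..b} w" unfolding w_def using ab
    by (intro continuous_intros continuous_on_subset[OF Lc] continuous_on_subset[OF y]) auto
  obtain r where r: "r \<in> {a..b}" "\<And>s. s \<in> {a..b} \<Longrightarrow> w s \<le> w r"
    using continuous_attains_sup[OF _ _ wc] ab by fastforce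
  have r0: "0 \<le> r" using r ab by simp
  \<comment> \<open>The end at which the integral starts; \<open>L\<close> is minimal there.\<close>
  define s0 where "s0 = (if \<sigma> = 1 then a else b)"
  have s0: "0 \<le> s0" "s0 \<in> {a..b}" using ab by (auto simp: s0_def)
  have yw: "y s = w s * exp (2 * L s)" for s by (simp add: w_def exp_minus)
  have sub: "I r \<subseteq> {a..b}" "\<exists>p q. I r = {p..q} \<and> 0 \<le> p \<and> p \<le> q" using sig r ab by auto
  then obtain p q where pq: "I r = {p..q}" "0 \<le> p" "p \<le> q" by auto
  have ie: "integral {p..q} (\<lambda>s. 2 * (\<sigma> * l s) * exp (2 * L s)) = exp (2 * L q) - exp (2 * L p)"
    and li: "loc_int (\<lambda>s. 2 * (\<sigma> * l s) * exp (2 * L s))"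
    using integral_exp_primitive[OF L pq(2,3), of 2] by auto
  have sg: "\<sigma> * \<sigma> = 1" using sig by auto
  have le1: "l s * exp (2 * L s) = (\<sigma> / 2) *\<^sub>R (2 * (\<sigma> * l s) * exp (2 * L s))" for s
    using sg by (simp add: algebra_simps)
  have i1: "integral {p..q} (\<lambda>s. l s * exp (2 * L s)) = \<sigma> / 2 * (exp (2 * L q) - exp (2 * L p))"
    unfolding le1 integral_cmul ie by simp
  have i2: "\<dots> = (exp (2 * L r) - exp (2 * L s0)) / 2"
    using sig pq r unfolding s0_def by (auto simp: Icc_eq_Icc field_simps)
  have lexp: "loc_int (\<lambda>s. l s * exp (2 * L s))" unfolding le1 using li by (rule loc_int_scaleR)
  have ly: "loc_int (\<lambda>s. l s * y s)" using l y by (intro loc_int_mult_continuous)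
  have "y r \<le> c + integral {p..q} (\<lambda>s. l s * y s)" using le[OF r(1)] pq by simp
  also have "integral {p..q} (\<lambda>s. l s * y s) \<le> integral {p..q} (\<lambda>s. w r * (l s * exp (2 * L s)))"
  proof (rule integral_mono_half_line)
    show "loc_int (\<lambda>s. w r * (l s * exp (2 * L s)))" using loc_int_scaleR[OF lexp, of "w r"] by simp
    fix s assume s: "s \<in> {p..q}"
    then have "s \<in> {a..b}" using sub pq by auto
    then have "w s * exp (2 * L s) \<le> w r * exp (2 * L s)" using r by (intro mult_right_mono) auto
    then have "l s * (w s * exp (2 * L s)) \<le> l s * (w r * exp (2 * L s))"
      using l(2)[of s] s pq by (intro mult_left_mono) auto
    then show "l s * y s \<le> w r * (l s * exp (2 * L s))" by (simp add: yw mult_ac)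
  qed (use ly pq in auto)
  also have "\<dots> = w r * ((exp (2 * L r) - exp (2 * L s0)) / 2)" using i1 i2 by (simp add: integral_mult_right)
  finally have main: "w r * exp (2 * L r) \<le> c + w r * ((exp (2 * L r) - exp (2 * L s0)) / 2)" by (simp add: yw)
  have Lmono: "L t - L s0 \<le> integral {a..b} l \<and> 0 \<le> L t - L s0" if "t \<in> {a..b}" for t
  proof (cases "\<sigma> = 1")
    case True
    then have "L t - L s0 = integral {a..t} l"
      using integral_diff_half_line[OF l(1), of a t] that ab by (simp add: L_def s0_def)
    then show ?thesis using that ab integral_subset_half_line[OF l, of a a t b] integral_nonneg_half_line[OF l, of a t] by simp
  next
    case False
    then have "\<sigma> = -1" using sig by auto
    then have "L t - L s0 = integral {t..b} l"
      using integral_diff_half_line[OF l(1), of t b] that ab by (simp add: L_def s0_def)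
    then show ?thesis using that ab integral_subset_half_line[OF l, of a t b b] integral_nonneg_half_line[OF l, of t b] by simp
  qed
  have wr: "w r * exp (2 * L s0) \<le> 2 * c"
  proof (cases "w r \<le> 0")
    case True
    then have "w r * exp (2 * L s0) \<le> 0" by (simp add: mult_le_0_iff)
    then show ?thesis using c by linarith
  next
    case False
    have "w r * exp (2 * L r) + w r * exp (2 * L s0) \<le> 2 * c" using main by (simp add: field_simps)
    moreover have "0 \<le> w r * exp (2 * L r)" using False by simp
    ultimately show ?thesis by linarith
  qed
  have "y t = w t * exp (2 * L t)" by (rule yw)
  also have "\<dots> \<le> w r * exp (2 * L t)" using r(2)[OF t] by simp
  also have "\<dots> = (w r * exp (2 * L s0)) * exp (2 * (L t - L s0))"
    by (simp add: exp_diff right_diff_distrib)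
  also have "\<dots> \<le> (2 * c) * exp (2 * (L t - L s0))" using wr by (intro mult_right_mono) auto
  also have "\<dots> \<le> (2 * c) * exp (2 * integral {a..b} l)" using Lmono[OF t] c by (intro mult_left_mono) auto
  finally show ?thesis .
qed

text \<open>Gronwall forward to the right of \<open>s\<close> and backward to its left, the integral
  of the defect \<open>d\<close> entering the additive constant. The perturbation estimates for
  states and adjoint functions are instances with suitable \<open>d\<close>.\<close>

lemma primitive_comparison:
  fixes x y :: "real \<Rightarrow> 'a::euclidean_space"
  assumes x: "primitive x p" and y: "primitive y q"
    and l: "loc_int l" "\<And>t. 0 \<le> t \<Longrightarrow> 0 \<le> l t"
    and d: "loc_int d" "\<And>t. 0 \<le> t \<Longrightarrow> 0 \<le> d t"
    and le: "\<And>t. t \<in> {0..T} \<Longrightarrow> norm (p t - q t) \<le> l t * norm (x t - y t) + d t"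
    and s: "s \<in> {0..T}" and t: "t \<in> {0..T}"
  shows "norm (x t - y t) \<le> 2 * (norm (x s - y s) + integral {0..T} d) * exp (2 * integral {0..T} l)"
proof -
  define z where "z = (\<lambda>t. norm (x t - y t))"
  have zc: "continuous_on {0..} z" unfolding z_def
    using primitive_continuous[OF x] primitive_continuous[OF y] by (intro continuous_intros)
  have lz: "loc_int (\<lambda>r. l r * z r)" using l zc by (intro loc_int_mult_continuous)
  have pq: "loc_int p" "loc_int q" using x y primitive_loc_int by auto
  have bound: "norm ((x v - y v) - (x u - y u)) \<le> integral {0..T} d + integral {u..v} (\<lambda>r. l r * z r)"
    if uv: "0 \<le> u" "u \<le> v" "v \<le> T" for u v
  proof -
    have "(x v - y v) - (x u - y u) = (x v - x u) - (y v - y u)" by simp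
    also have "\<dots> = integral {u..v} (\<lambda>r. p r - q r)"
      using primitive_diff[OF x uv(1,2)] primitive_diff[OF y uv(1,2)] pq uv
      by (simp add: integral_diff loc_int_integrable)
    finally have "norm ((x v - y v) - (x u - y u)) = norm (integral {u..v} (\<lambda>r. p r - q r))" by simp
    also have "\<dots> \<le> integral {u..v} (\<lambda>r. d r + l r * z r)"
    proof (rule integral_norm_le)
      show "loc_int (\<lambda>r. p r - q r)" using pq by (rule loc_int_diff)
      show "loc_int (\<lambda>r. d r + l r * z r)" using d(1) lz by (rule loc_int_add)
      show "norm (p r - q r) \<le> d r + l r * z r" if "r \<in> {u..v}" for r
        using le[of r] that uv by (simp add: z_def add.commute)
    qed (use uv in simp)
    also have "\<dots> = integral {u..v} d + integral {u..v} (\<lambda>r. l r * z r)"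
      using d(1) lz uv by (intro integral_add loc_int_integrable) auto
    also have "integral {u..v} d \<le> integral {0..T} d" using d uv by (intro integral_subset_half_line) auto
    finally show ?thesis by simp
  qed
  define c where "c = norm (x s - y s) + integral {0..T} d"
  have c0: "0 \<le> c" unfolding c_def using integral_nonneg_half_line[OF d, of 0 T] by simp
  show ?thesis
  proof (cases "s \<le> t")
    case True
    have "z t \<le> 2 * c * exp (2 * integral {s..T} l)"
    proof (rule gronwall_weighted[OF l zc _ _ c0, of s T 1 "\<lambda>t. {s..t}"])
      fix r assume r: "r \<in> {s..T}"
      have "z r \<le> norm (x s - y s) + norm ((x r - y r) - (x s - y s))"
        unfolding z_def using norm_triangle_sub[of "x r - y r" "x s - y s"] by simp
      then show "z r \<le> c + integral {s..r} (\<lambda>r. l r * z r)"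
        using bound[of s r] r s unfolding c_def by auto
    qed (use s t True in auto)
    also have "\<dots> \<le> 2 * c * exp (2 * integral {0..T} l)"
      using c0 s integral_subset_half_line[OF l, of 0 s T T] by (intro mult_left_mono) auto
    finally show ?thesis by (simp add: z_def c_def)
  next
    case False
    have "z t \<le> 2 * c * exp (2 * integral {0..s} l)"
    proof (rule gronwall_weighted[OF l zc _ _ c0, of 0 s "-1" "\<lambda>t. {t..s}"])
      fix r assume r: "r \<in> {0..s}"
      have "z r \<le> norm (x s - y s) + norm ((x s - y s) - (x r - y r))"
        unfolding z_def using norm_triangle_sub[of "x r - y r" "x s - y s"] by (simp add: norm_minus_commute)
      then show "z r \<le> c + integral {r..s} (\<lambda>r. l r * z r)"
        using bound[of r s] r s unfolding c_def by auto
    qed (use s t False in auto)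
    also have "\<dots> \<le> 2 * c * exp (2 * integral {0..T} l)"
      using c0 s integral_subset_half_line[OF l, of 0 0 s T] by (intro mult_left_mono) auto
    finally show ?thesis by (simp add: z_def c_def)
  qed
qed

section \<open>Initial value problems under Caratheodory conditions\<close>

lemma caratheodory_compose_measurable:
  fixes a :: "'t \<Rightarrow> 'e::euclidean_space \<Rightarrow> 'd::euclidean_space"
  assumes m: "\<And>y. (\<lambda>t. a t y) \<in> borel_measurable M"
    and c: "\<And>t. t \<in> space M \<Longrightarrow> continuous_on UNIV (a t)"
    and x: "x \<in> borel_measurable M"
  shows "(\<lambda>t. a t (x t)) \<in> borel_measurable M"
proof -
  obtain F where F: "\<And>i. simple_function M (F i)" "\<And>t. t \<in> space M \<Longrightarrow> (\<lambda>i. F i t) \<longlonglongrightarrow> x t"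
    using borel_measurable_implies_sequence_metric[OF x, of undefined] by blast
  show ?thesis
  \<comment> \<open>Along a simple function the composition is pieced together from finitely many
    measurable sections; continuity of \<open>a t\<close> carries measurability to the limit
    \<open>x\<close>.\<close>
  proof (rule borel_measurable_LIMSEQ_metric)
    fix i
    have fin: "finite (F i ` space M)" using F(1) by (simp add: simple_function_def)
    have "F i \<in> measurable M (count_space (F i ` space M))"
      by (rule measurable_count_space_extend[OF subset_UNIV _ measurable_simple_function[OF F(1)]]) auto
    then show "(\<lambda>t. a t (F i t)) \<in> borel_measurable M"
      using m fin by (intro measurable_compose_countable'[where I="F i ` space M" and f="\<lambda>y t. a t y" and g="F i"])
        (auto intro: countable_finite)
  next
    fix t assume t: "t \<in> space M"
    have "isCont (a t) (x t)" using c[OF t] by (simp add: continuous_on_eq_continuous_at)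
    then show "(\<lambda>i. a t (F i t)) \<longlonglongrightarrow> a t (x t)" using F(2)[OF t] by (rule isCont_tendsto_compose)
  qed
qed

text \<open>The integral oriented from \<open>s\<close> to \<open>t\<close>: the initial time may be
  interior to the half line, and solutions then extend in both directions.\<close>

definition signed_integral :: "real \<Rightarrow> real \<Rightarrow> (real \<Rightarrow> 'a::euclidean_space) \<Rightarrow> 'a" where
  "signed_integral s t h = integral {0..t} h - integral {0..s} h"

lemma signed_integral_cases:
  assumes "loc_int h" "0 \<le> s" "0 \<le> t"
  shows "signed_integral s t h = (if s \<le> t then integral {s..t} h else - integral {t..s} h)"
  using integral_diff_half_line[OF assms(1), of s t] integral_diff_half_line[OF assms(1), of t s] assms
  by (auto simp: signed_integral_def algebra_simps)

lemma norm_signed_integral_le: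
  assumes "loc_int h" "loc_int m" "0 \<le> s" "0 \<le> t" "\<And>r. 0 \<le> r \<Longrightarrow> norm (h r) \<le> m r"
  shows "norm (signed_integral s t h) \<le> \<bar>signed_integral s t m\<bar>"
proof -
  have "norm (integral {u..v} h) \<le> integral {u..v} m" if "0 \<le> u" for u v
    using assms that by (intro integral_norm_le) auto
  from this[of s t] this[of t s] show ?thesis
    using signed_integral_cases[OF assms(1,3,4)] signed_integral_cases[OF assms(2,3,4)] assms(3,4)
    by auto
qed

text \<open>Banach's fixed point theorem in the weighted supremum norm with weight
  \<open>exp (2 * \<bar>L t - L \<tau>\<bar>)\<close>, \<open>L\<close> a primitive of the Lipschitz modulus: the Picard operator is a
  contraction with constant \<open>1/2\<close> on the whole half line, and in both directions from \<open>\<tau>\<close>.\<close>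

lemma ivp_exists_lipschitz:
  fixes F :: "real \<Rightarrow> 'a::euclidean_space \<Rightarrow> 'a"
  assumes meas: "\<And>x. continuous_on {0..} x \<Longrightarrow> (\<lambda>t. F t (x t)) \<in> borel_measurable (lebesgue_on {0..})"
    and l: "loc_int l" "\<And>t. 0 \<le> t \<Longrightarrow> 0 \<le> l t"
    and lip: "\<And>t x y. 0 \<le> t \<Longrightarrow> norm (F t x - F t y) \<le> l t * norm (x - y)"
    and F0: "\<And>t. 0 \<le> t \<Longrightarrow> norm (F t 0) \<le> l t"
    and \<tau>: "0 \<le> \<tau>"
  obtains x where "primitive x (\<lambda>t. F t (x t))" "x \<tau> = \<xi>"
proof -
  define L where "L = (\<lambda>t. 0 + integral {0..t} l)"
  have L: "primitive L l" unfolding L_def by (rule primitive_integral[OF l(1)])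
  have Lc: "continuous_on {0..} L" using L by (rule primitive_continuous)
  have Lm: "L s \<le> L t" if "0 \<le> s" "s \<le> t" for s t
    using integral_subset_half_line[OF l, of 0 0 s t] that by (simp add: L_def)
  define W where "W = (\<lambda>t. exp (2 * \<bar>L t - L \<tau>\<bar>))"
  have W0: "W t > 0" "W t \<ge> 1" for t by (auto simp: W_def)
  have Wc: "continuous_on {0..} W" unfolding W_def using Lc by (intro continuous_intros)
  have lW: "loc_int (\<lambda>s. l s * W s)" using Wc l by (intro loc_int_mult_continuous)
  \<comment> \<open>The exact value \<open>(W t - 1) / 2\<close> is the source of the contraction
    constant 1/2.\<close>
  have Wint: "\<bar>signed_integral \<tau> t (\<lambda>s. l s * W s)\<bar> = (W t - 1) / 2" if t: "0 \<le> t" for t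
  proof (cases "\<tau> \<le> t")
    case True
    have "integral {\<tau>..t} (\<lambda>s. l s * W s) = integral {\<tau>..t} (\<lambda>s. (exp (- 2 * L \<tau>) / 2) *\<^sub>R (2 * l s * exp (2 * L s)))"
    proof (rule Henstock_Kurzweil_Integration.integral_cong)
      fix s assume "s \<in> {\<tau>..t}"
      then have "L \<tau> \<le> L s" using Lm \<tau> by simp
      then have "W s = exp (- 2 * L \<tau>) * exp (2 * L s)" unfolding W_def exp_add[symmetric] by simp
      then show "l s * W s = (exp (- 2 * L \<tau>) / 2) *\<^sub>R (2 * l s * exp (2 * L s))" by simp
    qed
    also have "\<dots> = (exp (- 2 * L \<tau>) / 2) * (exp (2 * L t) - exp (2 * L \<tau>))"
      unfolding integral_cmul integral_exp_primitive(1)[OF L \<tau> True] by simp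
    also have "\<dots> = (exp (- 2 * L \<tau>) * exp (2 * L t) - exp (- 2 * L \<tau>) * exp (2 * L \<tau>)) / 2"
      by (simp add: algebra_simps)
    also have "\<dots> = (W t - 1) / 2" using Lm[OF \<tau> True] unfolding W_def exp_add[symmetric] by simp
    finally show ?thesis using signed_integral_cases[OF lW \<tau> t] True W0(2)[of t] by simp
  next
    case False
    then have tt: "t \<le> \<tau>" by simp
    have "integral {t..\<tau>} (\<lambda>s. l s * W s) = integral {t..\<tau>} (\<lambda>s. (- exp (2 * L \<tau>) / 2) *\<^sub>R (-2 * l s * exp (-2 * L s)))"
    proof (rule Henstock_Kurzweil_Integration.integral_cong)
      fix s assume "s \<in> {t..\<tau>}"
      then have "L s \<le> L \<tau>" using Lm[of s \<tau>] t by simp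
      then have "W s = exp (2 * L \<tau>) * exp (-2 * L s)" unfolding W_def exp_add[symmetric] by simp
      then show "l s * W s = (- exp (2 * L \<tau>) / 2) *\<^sub>R (-2 * l s * exp (-2 * L s))" by simp
    qed
    also have "\<dots> = (- exp (2 * L \<tau>) / 2) * (exp (-2 * L \<tau>) - exp (-2 * L t))"
      unfolding integral_cmul integral_exp_primitive(1)[OF L t tt] by simp
    also have "\<dots> = (exp (2 * L \<tau>) * exp (-2 * L t) - exp (2 * L \<tau>) * exp (-2 * L \<tau>)) / 2"
      by (simp add: algebra_simps)
    also have "\<dots> = (W t - 1) / 2" using Lm[OF t tt] unfolding W_def exp_add[symmetric] by simp
    finally show ?thesis using signed_integral_cases[OF lW \<tau> t] False W0(2)[of t] by simp
  qed
  have FI: "loc_int (\<lambda>s. F s (W s *\<^sub>R z s))" and Fb: "\<And>s. 0 \<le> s \<Longrightarrow> norm (F s (W s *\<^sub>R z s)) \<le> (1 + B) * (l s * W s)"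
    if z: "continuous_on {0..} z" and B: "\<And>s. norm (z s) \<le> B" for z B
  proof -
    have B0: "0 \<le> B" using B[of 0] norm_ge_zero order_trans by blast
    show b: "norm (F s (W s *\<^sub>R z s)) \<le> (1 + B) * (l s * W s)" if s: "0 \<le> s" for s
    proof -
      have "norm (F s (W s *\<^sub>R z s)) \<le> norm (F s 0) + norm (F s (W s *\<^sub>R z s) - F s 0)"
        using norm_triangle_sub by blast
      also have "\<dots> \<le> l s + l s * norm (W s *\<^sub>R z s)" using F0[OF s] lip[OF s, of "W s *\<^sub>R z s" 0] by simp
      also have "\<dots> = l s * 1 + l s * (W s * norm (z s))" using W0(1)[of s] by simp
      also have "\<dots> \<le> l s * W s + l s * (W s * B)"
        using B[of s] W0[of s] l(2)[OF s] by (intro add_mono mult_left_mono) auto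
      finally show ?thesis by (simp add: algebra_simps)
    qed
    show "loc_int (\<lambda>s. F s (W s *\<^sub>R z s))"
    proof (rule loc_int_dominated[OF _ _ b])
      show "(\<lambda>s. F s (W s *\<^sub>R z s)) \<in> borel_measurable (lebesgue_on {0..})"
        using z Wc by (intro meas continuous_intros)
      show "loc_int (\<lambda>s. (1 + B) * (l s * W s))" using loc_int_scaleR[OF lW, of "1+B"] by simp
    qed
  qed
  \<comment> \<open>The Picard operator conjugated with the weight: \<open>z\<close> stands for
    \<open>x / W\<close>, so the weighted norm becomes the plain supremum norm.\<close>
  define P where "P = (\<lambda>z::real \<Rightarrow> 'a. \<lambda>t. (1 / W t) *\<^sub>R (\<xi> + signed_integral \<tau> t (\<lambda>s. F s (W s *\<^sub>R z s))))"
  have Pcont: "continuous_on {0..} (P z)" if "continuous_on {0..} z" "\<And>s. norm (z s) \<le> B" for z B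
  proof -
    have "continuous_on {0..} (\<lambda>t. 0 + integral {0..t} (\<lambda>s. F s (W s *\<^sub>R z s)))"
      by (rule primitive_continuous[OF primitive_integral[OF FI[OF that]]])
    then have "continuous_on {0..} (\<lambda>t. integral {0..t} (\<lambda>s. F s (W s *\<^sub>R z s)))" by simp
    moreover have "\<forall>t\<in>{0..}. W t \<noteq> 0" using W0 by (metis less_irrefl)
    ultimately show ?thesis unfolding P_def signed_integral_def using Wc
      by (intro continuous_intros) auto
  qed
  have Pbound: "norm (P z t) \<le> norm \<xi> + (1 + B)" if z: "continuous_on {0..} z" "\<And>s. norm (z s) \<le> B" and t: "0 \<le> t" for z B t
  proof -
    have B0: "0 \<le> B" using z(2)[of 0] norm_ge_zero order_trans by blast
    have "norm (signed_integral \<tau> t (\<lambda>s. F s (W s *\<^sub>R z s))) \<le> \<bar>signed_integral \<tau> t (\<lambda>s. (1 + B) * (l s * W s))\<bar>"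
      using FI[OF z] Fb[OF z] \<tau> t loc_int_scaleR[OF lW, of "1+B"] by (intro norm_signed_integral_le) auto
    also have "\<dots> = \<bar>(1 + B) * signed_integral \<tau> t (\<lambda>s. l s * W s)\<bar>"
      by (simp add: signed_integral_def integral_mult_right right_diff_distrib)
    also have "\<dots> = (1 + B) * ((W t - 1) / 2)" using B0 Wint[OF t] by (simp add: abs_mult)
    also have "\<dots> \<le> (1 + B) * W t" using B0 W0(1)[of t] by (intro mult_left_mono) auto
    finally have 1: "norm (\<xi> + signed_integral \<tau> t (\<lambda>s. F s (W s *\<^sub>R z s))) \<le> norm \<xi> * W t + (1 + B) * W t"
      using mult_left_mono[OF W0(2)[of t] norm_ge_zero[of \<xi>]] norm_triangle_ineq order_trans
      by (smt (verit) mult.right_neutral)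
    have "norm (P z t) = norm (\<xi> + signed_integral \<tau> t (\<lambda>s. F s (W s *\<^sub>R z s))) / W t"
      using W0(1)[of t] by (simp add: P_def)
    also have "\<dots> \<le> (norm \<xi> * W t + (1 + B) * W t) / W t" using 1 W0(1)[of t] by (intro divide_right_mono) auto
    also have "\<dots> = norm \<xi> + (1 + B)" using W0(1)[of t] by (simp add: field_simps)
    finally show ?thesis .
  qed
  have Plip: "norm (P z t - P z' t) \<le> 1/2 * B" if z: "continuous_on {0..} z" "\<And>s. norm (z s) \<le> A"
    and z': "continuous_on {0..} z'" "\<And>s. norm (z' s) \<le> A'" and B: "\<And>s. norm (z s - z' s) \<le> B" and t: "0 \<le> t" for z z' A A' B t
  proof -
    have B0: "0 \<le> B" using B[of 0] norm_ge_zero order_trans by blast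
    let ?h = "\<lambda>s. F s (W s *\<^sub>R z s)" and ?h' = "\<lambda>s. F s (W s *\<^sub>R z' s)"
    have "norm (signed_integral \<tau> t (\<lambda>s. ?h s - ?h' s)) \<le> \<bar>signed_integral \<tau> t (\<lambda>s. B * (l s * W s))\<bar>"
    proof (rule norm_signed_integral_le)
      show "loc_int (\<lambda>s. ?h s - ?h' s)" using FI[OF z] FI[OF z'] by (rule loc_int_diff)
      show "loc_int (\<lambda>s. B * (l s * W s))" using loc_int_scaleR[OF lW, of B] by simp
      fix s :: real assume s: "0 \<le> s"
      have "norm (?h s - ?h' s) \<le> l s * norm (W s *\<^sub>R z s - W s *\<^sub>R z' s)" by (rule lip[OF s])
      also have "\<dots> = l s * W s * norm (z s - z' s)" using W0(1)[of s] by (simp add: scaleR_diff_right[symmetric])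
      also have "\<dots> \<le> l s * W s * B" using B[of s] l(2)[OF s] W0(1)[of s] by (intro mult_left_mono) auto
      finally show "norm (?h s - ?h' s) \<le> B * (l s * W s)" by (simp add: mult_ac)
    qed (use \<tau> t in auto)
    also have "\<dots> = \<bar>B * signed_integral \<tau> t (\<lambda>s. l s * W s)\<bar>"
      by (simp add: signed_integral_def integral_mult_right right_diff_distrib)
    also have "\<dots> = B * ((W t - 1) / 2)" using B0 Wint[OF t] by (simp add: abs_mult)
    also have "\<dots> \<le> 1/2 * B * W t" using B0 by (simp add: algebra_simps)
    finally have 1: "norm (signed_integral \<tau> t (\<lambda>s. ?h s - ?h' s)) \<le> 1/2 * B * W t" .
    have "signed_integral \<tau> t (\<lambda>s. ?h s - ?h' s) = signed_integral \<tau> t ?h - signed_integral \<tau> t ?h'"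
      unfolding signed_integral_def using FI[OF z] FI[OF z'] by (simp add: integral_diff loc_int_integrable)
    then have "P z t - P z' t = (1 / W t) *\<^sub>R signed_integral \<tau> t (\<lambda>s. ?h s - ?h' s)"
      unfolding P_def by (simp add: scaleR_diff_right[symmetric])
    then have "norm (P z t - P z' t) = norm (signed_integral \<tau> t (\<lambda>s. ?h s - ?h' s)) / W t"
      using W0(1)[of t] by simp
    also have "\<dots> \<le> (1/2 * B * W t) / W t" using 1 W0(1)[of t] by (intro divide_right_mono) auto
    also have "\<dots> = 1/2 * B" using W0(1)[of t] by simp
    finally show ?thesis .
  qed
  \<comment> \<open>Bounded continuous functions live on the whole line; negative times receive the
    value at 0, which preserves continuity and the estimates.\<close>
  define Q where "Q = (\<lambda>\<phi>::real \<Rightarrow>\<^sub>C 'a. Bcontfun (\<lambda>t. P (apply_bcontfun \<phi>) (max 0 t)))"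
  have ac: "continuous_on {0..} (apply_bcontfun \<phi>)" for \<phi> :: "real \<Rightarrow>\<^sub>C 'a" by simp
  have ab: "norm (apply_bcontfun \<phi> s) \<le> norm \<phi>" for \<phi> :: "real \<Rightarrow>\<^sub>C 'a" and s by (rule norm_bounded)
  have Qa: "apply_bcontfun (Q \<phi>) t = P (apply_bcontfun \<phi>) (max 0 t)" for \<phi> t
  proof -
    have "continuous_on UNIV (\<lambda>t. P (apply_bcontfun \<phi>) (max 0 t))"
      by (rule continuous_on_compose2[OF Pcont[OF ac ab]]) (auto intro!: continuous_intros)
    then have "(\<lambda>t. P (apply_bcontfun \<phi>) (max 0 t)) \<in> bcontfun"
      using Pbound[OF ac ab] by (rule bcontfun_normI) simp
    then show ?thesis unfolding Q_def by (simp add: Bcontfun_inverse)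
  qed
  have "\<forall>\<phi> \<phi>'. dist (Q \<phi>) (Q \<phi>') \<le> 1/2 * dist \<phi> \<phi>'"
  proof (intro allI)
    fix \<phi> \<phi>'
    show "dist (Q \<phi>) (Q \<phi>') \<le> 1/2 * dist \<phi> \<phi>'"
    proof (rule dist_bound)
      fix t
      have "norm (P (apply_bcontfun \<phi>) (max 0 t) - P (apply_bcontfun \<phi>') (max 0 t)) \<le> 1/2 * dist \<phi> \<phi>'"
      proof (rule Plip[OF ac ab ac ab])
        show "norm (apply_bcontfun \<phi> s - apply_bcontfun \<phi>' s) \<le> dist \<phi> \<phi>'" for s
          using dist_bounded[of \<phi> s \<phi>'] by (simp add: dist_norm)
      qed simp
      then show "dist (apply_bcontfun (Q \<phi>) t) (apply_bcontfun (Q \<phi>') t) \<le> 1/2 * dist \<phi> \<phi>'"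
        by (simp add: Qa dist_norm)
    qed
  qed
  then have "\<exists>!\<phi>. Q \<phi> = \<phi>" by (intro banach_fix_type[where c="1/2"]) auto
  then obtain \<phi> where \<phi>: "Q \<phi> = \<phi>" by blast
  define z where "z = apply_bcontfun \<phi>"
  define x where "x = (\<lambda>t. W t *\<^sub>R z t)"
  have zP: "z t = P z t" if "0 \<le> t" for t using Qa[of \<phi> t] \<phi> that by (simp add: z_def)
  have zc: "continuous_on {0..} z" unfolding z_def by (rule ac)
  have zb: "norm (z s) \<le> norm \<phi>" for s unfolding z_def by (rule ab)
  have xe: "x t = \<xi> + signed_integral \<tau> t (\<lambda>s. F s (x s))" if "0 \<le> t" for t
    using zP[OF that] W0(1)[of t] by (simp add: x_def P_def)
  have li: "loc_int (\<lambda>s. F s (x s))" unfolding x_def by (rule FI[OF zc zb])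
  have "x t = x 0 + integral {0..t} (\<lambda>s. F s (x s))" if "0 \<le> t" for t
    using xe[OF that] xe[of 0] by (simp add: signed_integral_def)
  then have "primitive x (\<lambda>t. F t (x t))" using li unfolding primitive_def by blast
  moreover have "x \<tau> = \<xi>" using xe[OF \<tau>] by (simp add: signed_integral_def)
  ultimately show thesis by (rule that)
qed

text \<open>Scaling the projection onto the unit ball, instead of projecting onto \<open>cball 0 r\<close>, makes joint
  continuity in the radius evident.\<close>

definition trunc :: "real \<Rightarrow> 'a::euclidean_space \<Rightarrow> 'a" where
  "trunc r x = r *\<^sub>R closest_point (cball 0 1) (x /\<^sub>R r)"

lemma trunc_id: "0 < r \<Longrightarrow> norm x \<le> r \<Longrightarrow> trunc r x = x"
  unfolding trunc_def by (subst closest_point_self) (auto simp: field_simps)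

lemma norm_trunc_le: assumes "0 < r" shows "norm (trunc r x) \<le> r"
proof -
  have "closest_point (cball 0 1) (x /\<^sub>R r) \<in> cball 0 1" by (rule closest_point_in_set) auto
  then show ?thesis using assms by (simp add: trunc_def mult_left_le)
qed

lemma trunc_lipschitz: assumes "0 < r" shows "norm (trunc r x - trunc r y) \<le> norm (x - y)"
proof -
  have "norm (trunc r x - trunc r y) = r * dist (closest_point (cball 0 1) (x /\<^sub>R r)) (closest_point (cball 0 1) (y /\<^sub>R r))"
    using assms by (simp add: trunc_def dist_norm scaleR_diff_right[symmetric])
  also have "\<dots> \<le> r * dist (x /\<^sub>R r) (y /\<^sub>R r)"
    using assms by (intro mult_left_mono closest_point_lipschitz) auto
  also have "\<dots> = norm (x - y)" using assms by (simp add: dist_norm scaleR_diff_right[symmetric])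
  finally show ?thesis .
qed

lemma norm_trunc_le_norm:
  fixes x :: "'a::euclidean_space"
  assumes "0 < r" shows "norm (trunc r x) \<le> norm x"
  using trunc_lipschitz[OF assms, of x 0] trunc_id[OF assms, of "0::'a"] assms by simp

lemma continuous_on_trunc:
  fixes x :: "'t::topological_space \<Rightarrow> 'a::euclidean_space"
  assumes "continuous_on S r" "continuous_on S x" "\<And>t. t \<in> S \<Longrightarrow> 0 < r t"
  shows "continuous_on S (\<lambda>t. trunc (r t) (x t))"
proof -
  have c: "continuous_on UNIV (closest_point (cball (0::'a) 1))"
    by (rule continuous_on_closest_point) auto
  show ?thesis unfolding trunc_def
    by (intro continuous_intros assms continuous_on_compose2[OF c]) (use assms(3) in force)+
qed

text \<open>The a priori bound \<open>\<rho>\<close> from the growth condition comes before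
  existence. Truncating the state at radius \<open>\<rho> t\<close> makes the right side globally
  Lipschitz and preserves the growth bound; hence the truncated solution stays below
  \<open>\<rho>\<close> and the truncation is never active.\<close>

lemma ivp_exists:
  fixes F :: "real \<Rightarrow> 'a::euclidean_space \<Rightarrow> 'a"
  assumes meas: "\<And>x. continuous_on {0..} x \<Longrightarrow> (\<lambda>t. F t (x t)) \<in> borel_measurable (lebesgue_on {0..})"
    and lip: "\<And>\<rho>. continuous_on {0..} \<rho> \<Longrightarrow> \<exists>l. loc_int l \<and> (\<forall>t\<ge>0. 0 \<le> l t) \<and>
      (\<forall>t x y. 0 \<le> t \<longrightarrow> norm x \<le> \<rho> t \<longrightarrow> norm y \<le> \<rho> t \<longrightarrow> norm (F t x - F t y) \<le> l t * norm (x - y))"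
    and M: "loc_int M" "\<And>t. 0 \<le> t \<Longrightarrow> 0 \<le> M t"
    and growth: "\<And>t x. 0 \<le> t \<Longrightarrow> norm (F t x) \<le> M t * (1 + norm x)"
    and \<tau>: "0 \<le> \<tau>"
  obtains x where "primitive x (\<lambda>t. F t (x t))" "x \<tau> = \<xi>"
proof -
  define L where "L = (\<lambda>t. 0 + integral {0..t} M)"
  have Lc: "continuous_on {0..} L" unfolding L_def by (rule primitive_continuous[OF primitive_integral[OF M(1)]])
  have Lc': "continuous_on {0..} (\<lambda>t. L (t + \<tau>))"
    by (rule continuous_on_compose2[OF Lc]) (use \<tau> in \<open>auto intro!: continuous_intros\<close>)
  have L0: "0 \<le> L t" for t unfolding L_def using integral_nonneg_half_line[OF M, of 0 t] by simp
  \<comment> \<open>The interval \<open>{0..t + \<tau>}\<close> contains both \<open>t\<close> and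
    \<open>\<tau>\<close>, so one formula bounds the solution on either side of
    \<open>\<tau>\<close>. The \<open>+ 1\<close> keeps the radius positive.\<close>
  define \<rho> where "\<rho> = (\<lambda>t. 2 * (norm \<xi> + L (t + \<tau>)) * exp (2 * L (t + \<tau>)) + 1)"
  have \<rho>c: "continuous_on {0..} \<rho>" unfolding \<rho>_def using Lc' by (intro continuous_intros)
  have \<rho>0: "0 < \<rho> t" for t unfolding \<rho>_def using L0[of "t+\<tau>"] by (intro add_nonneg_pos mult_nonneg_nonneg) auto
  obtain l where l: "loc_int l" "\<And>t. 0 \<le> t \<Longrightarrow> 0 \<le> l t"
    and lipl: "\<And>t x y. 0 \<le> t \<Longrightarrow> norm x \<le> \<rho> t \<Longrightarrow> norm y \<le> \<rho> t \<Longrightarrow> norm (F t x - F t y) \<le> l t * norm (x - y)"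
    using lip[OF \<rho>c] by blast
  define G where "G = (\<lambda>t x. F t (trunc (\<rho> t) x))"
  have Gg: "norm (G t x) \<le> M t * (1 + norm x)" if "0 \<le> t" for t x
  proof -
    have "norm (G t x) \<le> M t * (1 + norm (trunc (\<rho> t) x))" unfolding G_def by (rule growth[OF that])
    also have "\<dots> \<le> M t * (1 + norm x)" using M(2)[OF that] norm_trunc_le_norm[OF \<rho>0] by (intro mult_left_mono) auto
    finally show ?thesis .
  qed
  obtain x where x: "primitive x (\<lambda>t. G t (x t))" "x \<tau> = \<xi>"
  proof (rule ivp_exists_lipschitz[of G "\<lambda>t. l t + M t" \<tau> \<xi>])
    show "(\<lambda>t. G t (x t)) \<in> borel_measurable (lebesgue_on {0..})" if "continuous_on {0..} x" for x
      unfolding G_def using \<rho>0 by (intro meas continuous_on_trunc \<rho>c that) auto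
    show "loc_int (\<lambda>t. l t + M t)" using l M by (intro loc_int_add)
    show "0 \<le> l t + M t" if "0 \<le> t" for t using l M that by auto
    show "norm (G t x - G t y) \<le> (l t + M t) * norm (x - y)" if t: "0 \<le> t" for t x y
    proof -
      have "norm (G t x - G t y) \<le> l t * norm (trunc (\<rho> t) x - trunc (\<rho> t) y)"
        unfolding G_def by (rule lipl[OF t norm_trunc_le[OF \<rho>0] norm_trunc_le[OF \<rho>0]])
      also have "\<dots> \<le> (l t + M t) * norm (x - y)"
        using l(2)[OF t] M(2)[OF t] trunc_lipschitz[OF \<rho>0] by (intro mult_mono) auto
      finally show ?thesis .
    qed
    show "norm (G t 0) \<le> l t + M t" if t: "0 \<le> t" for t
      using Gg[OF t, of 0] l(2)[OF t] by simp
  qed (use \<tau> in auto)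
  have apriori: "norm (x t) \<le> \<rho> t" if t: "0 \<le> t" for t
  proof -
    have z: "primitive (\<lambda>t. 0::'a) (\<lambda>t. 0)" by (simp add: primitive_def loc_int_const)
    have "norm (x t - 0) \<le> 2 * (norm (x \<tau> - 0) + integral {0..t+\<tau>} M) * exp (2 * integral {0..t+\<tau>} M)"
    proof (rule primitive_comparison[OF x(1) z M M])
      show "norm (G s (x s) - 0) \<le> M s * norm (x s - 0) + M s" if "s \<in> {0..t+\<tau>}" for s
        using Gg[of s "x s"] that by (simp add: algebra_simps)
    qed (use t \<tau> in auto)
    then show ?thesis unfolding \<rho>_def L_def x(2) by simp
  qed
  have "primitive x (\<lambda>t. F t (x t))"
  proof -
    have "G t (x t) = F t (x t)" if "0 \<le> t" for t
      unfolding G_def trunc_id[OF \<rho>0 apriori[OF that]] by simp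
    then show ?thesis using x(1) primitive_cong[of "\<lambda>t. G t (x t)" "\<lambda>t. F t (x t)" x x] by simp
  qed
  then show thesis using x(2) by (rule that)
qed

lemma ivp_unique:
  fixes F :: "real \<Rightarrow> 'a::euclidean_space \<Rightarrow> 'a"
  assumes lip: "\<And>\<rho>. continuous_on {0..} \<rho> \<Longrightarrow> \<exists>l. loc_int l \<and> (\<forall>t\<ge>0. 0 \<le> l t) \<and>
      (\<forall>t x y. 0 \<le> t \<longrightarrow> norm x \<le> \<rho> t \<longrightarrow> norm y \<le> \<rho> t \<longrightarrow> norm (F t x - F t y) \<le> l t * norm (x - y))"
    and x: "primitive x (\<lambda>t. F t (x t))" and y: "primitive y (\<lambda>t. F t (y t))"
    and s: "0 \<le> s" "x s = y s" and t: "0 \<le> t"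
  shows "x t = y t"
proof -
  have "continuous_on {0..} (\<lambda>t. norm (x t) + norm (y t))"
    using primitive_continuous[OF x] primitive_continuous[OF y] by (intro continuous_intros)
  from lip[OF this] obtain l where l: "loc_int l" "\<And>t. 0 \<le> t \<Longrightarrow> 0 \<le> l t"
    "\<And>t. 0 \<le> t \<Longrightarrow> norm (F t (x t) - F t (y t)) \<le> l t * norm (x t - y t)" by fastforce
  have "norm (x t - y t) \<le> 2 * (norm (x s - y s) + integral {0..max s t} (\<lambda>_. 0)) * exp (2 * integral {0..max s t} l)"
    using l s t by (intro primitive_comparison[OF x y l(1,2)]) (auto simp: loc_int_const)
  then show ?thesis using s by simp
qed

section \<open>Measurable selections\<close>

text \<open>Kuratowski--Ryll-Nardzewski: shrink \<open>S\<close> by balls around the first centre of a dense sequence that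
  still meets it.\<close>

primrec shrink :: "(nat \<Rightarrow> 'u::euclidean_space) \<Rightarrow> 'u set \<Rightarrow> nat \<Rightarrow> 'u set" where
  "shrink d S 0 = S"
| "shrink d S (Suc k) = shrink d S k \<inter> cball (d (LEAST i. shrink d S k \<inter> cball (d i) (1 / 2 ^ k) \<noteq> {})) (1 / 2 ^ k)"

text \<open>Every stage inherits the hypothesis on hitting times: the sets where
  \<open>I k t = i\<close> are differences of hitting sets, and \<open>G (Suc k) t\<close> meets
  \<open>C\<close> exactly when \<open>G k t\<close> meets the chosen ball intersected with
  \<open>C\<close>. Compact test sets suffice because only closed balls are intersected.\<close>

lemma measurable_selection:
  fixes W :: "real \<Rightarrow> 'u::euclidean_space set"
  assumes T: "T \<in> sets lebesgue"
    and W: "\<And>t. t \<in> T \<Longrightarrow> compact (W t) \<and> W t \<noteq> {}"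
    and hit: "\<And>C. compact C \<Longrightarrow> {t\<in>T. W t \<inter> C \<noteq> {}} \<in> sets lebesgue"
  obtains v where "v \<in> borel_measurable (lebesgue_on T)" "\<And>t. t \<in> T \<Longrightarrow> v t \<in> W t"
proof -
  obtain D :: "'u set" where D: "countable D" "\<And>X. open X \<Longrightarrow> X \<noteq> {} \<Longrightarrow> \<exists>d\<in>D. d \<in> X"
    by (rule countable_dense_setE) blast
  have "D \<noteq> {}" using D(2)[of UNIV] by auto
  then obtain d :: "nat \<Rightarrow> 'u" where d: "range d = D" using D(1) by (metis range_from_nat_into)
  have dense: "\<exists>i. dist (d i) x < e" if "e > 0" for x e
    using D(2)[of "ball x e"] that d by (auto simp: dist_commute)
  define G where "G = (\<lambda>k t. shrink d (W t) k)"
  define I where "I = (\<lambda>k t. LEAST i. G k t \<inter> cball (d i) (1 / 2 ^ k) \<noteq> {})"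
  have GS: "G (Suc k) t = G k t \<inter> cball (d (I k t)) (1 / 2 ^ k)" for k t by (simp add: G_def I_def)
  have G0: "G 0 t = W t" for t by (simp add: G_def)
  have Gex: "\<exists>i. G k t \<inter> cball (d i) (1 / 2 ^ k) \<noteq> {}" if "G k t \<noteq> {}" for k t
  proof -
    obtain x where x: "x \<in> G k t" using \<open>G k t \<noteq> {}\<close> by auto
    obtain i where "dist (d i) x < 1 / 2 ^ k" using dense[of "1 / 2 ^ k" x] by auto
    then show ?thesis using x by (intro exI[of _ i]) auto
  qed
  have G: "compact (G k t) \<and> G k t \<noteq> {}" if t: "t \<in> T" for k t
  proof (induction k)
    case 0 then show ?case using W[OF t] by (simp add: G0)
  next
    case (Suc k)
    then have "G k t \<inter> cball (d (I k t)) (1 / 2 ^ k) \<noteq> {}"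
      unfolding I_def using Gex by (intro LeastI_ex[of "\<lambda>i. G k t \<inter> cball (d i) (1 / 2 ^ k) \<noteq> {}"]) auto
    then show ?case unfolding GS using Suc by (auto intro: compact_Int)
  qed
  have Ieq: "{t\<in>T. I k t = i} = {t\<in>T. G k t \<inter> cball (d i) (1 / 2 ^ k) \<noteq> {}}
      - (\<Union>j<i. {t\<in>T. G k t \<inter> cball (d j) (1 / 2 ^ k) \<noteq> {}})" for k i
  proof -
    have "I k t = i \<longleftrightarrow> G k t \<inter> cball (d i) (1 / 2 ^ k) \<noteq> {} \<and> (\<forall>j<i. \<not> G k t \<inter> cball (d j) (1 / 2 ^ k) \<noteq> {})"
      if t: "t \<in> T" for t
    proof
      assume i: "I k t = i"
      show "G k t \<inter> cball (d i) (1 / 2 ^ k) \<noteq> {} \<and> (\<forall>j<i. \<not> G k t \<inter> cball (d j) (1 / 2 ^ k) \<noteq> {})"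
        using LeastI_ex[OF Gex[OF conjunct2[OF G[OF t]]], of k] not_less_Least[of _ "\<lambda>i. G k t \<inter> cball (d i) (1 / 2 ^ k) \<noteq> {}"] i
        unfolding I_def by blast
    next
      assume "G k t \<inter> cball (d i) (1 / 2 ^ k) \<noteq> {} \<and> (\<forall>j<i. \<not> G k t \<inter> cball (d j) (1 / 2 ^ k) \<noteq> {})"
      then show "I k t = i" unfolding I_def by (intro Least_equality) (auto simp: not_less[symmetric])
    qed
    then show ?thesis by auto
  qed
  have Ghit: "{t\<in>T. G k t \<inter> C \<noteq> {}} \<in> sets lebesgue" if "compact C" for k C
    using that
  proof (induction k arbitrary: C)
    case 0 then show ?case using hit by (simp add: G0)
  next
    case (Suc k)
    have I: "{t\<in>T. I k t = i} \<in> sets lebesgue" for i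
      unfolding Ieq by (intro sets.Diff sets.finite_UN Suc.IH) auto
    have eq: "{t\<in>T. G (Suc k) t \<inter> C \<noteq> {}} =
        (\<Union>i. {t\<in>T. I k t = i} \<inter> {t\<in>T. G k t \<inter> (cball (d i) (1 / 2 ^ k) \<inter> C) \<noteq> {}})"
      unfolding GS by (auto simp: Int_assoc)
    have "{t\<in>T. I k t = i} \<inter> {t\<in>T. G k t \<inter> (cball (d i) (1 / 2 ^ k) \<inter> C) \<noteq> {}} \<in> sets lebesgue" for i
      by (intro sets.Int I Suc.IH compact_Int compact_cball Suc.prems)
    then have "(\<Union>i. {t\<in>T. I k t = i} \<inter> {t\<in>T. G k t \<inter> (cball (d i) (1 / 2 ^ k) \<inter> C) \<noteq> {}}) \<in> sets lebesgue"
      by (intro sets.countable_UN) auto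
    then show ?case unfolding eq .
  qed
  have Im: "(\<lambda>t. d (I k t)) \<in> borel_measurable (lebesgue_on T)" for k
  proof (rule measurable_compose[where N="count_space UNIV" and f="I k" and g=d])
    have "{t\<in>T. I k t = i} \<in> sets lebesgue" for i
      unfolding Ieq by (intro sets.Diff sets.finite_UN Ghit) auto
    moreover have "I k -` {i} \<inter> T = {t\<in>T. I k t = i}" for i by auto
    ultimately show "I k \<in> lebesgue_on T \<rightarrow>\<^sub>M count_space UNIV"
      using T by (subst measurable_count_space_eq2_countable) (auto simp: sets_restrict_space_iff)
  qed simp
  \<comment> \<open>The nested compact sets \<open>G k t\<close> share a point \<open>p\<close>; it
    lies within \<open>1 / 2 ^ k\<close> of the \<open>k\<close>-th centre, so the centres converge
    to it.\<close>
  have lim: "\<exists>p\<in>W t. (\<lambda>k. d (I k t)) \<longlonglongrightarrow> p" if t: "t \<in> T" for t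
  proof -
    have "G n t \<subseteq> G m t" if "m \<le> n" for m n
      using that by (induction rule: dec_induct) (auto simp: GS)
    then have "\<Inter>(range (\<lambda>k. G k t)) \<noteq> {}" using G[OF t] by (intro compact_nest) auto
    then obtain p where p: "\<And>k. p \<in> G k t" by auto
    have "dist (d (I k t)) p \<le> (1/2) ^ k" for k using p[of "Suc k"] by (auto simp: GS power_one_over)
    moreover have "(\<lambda>k. (1/2::real) ^ k) \<longlonglongrightarrow> 0" by (rule LIMSEQ_power_zero) simp
    ultimately have "(\<lambda>k. dist (d (I k t)) p) \<longlonglongrightarrow> 0"
      by (rule_tac tendsto_sandwich[OF _ _ tendsto_const]) auto
    then have "(\<lambda>k. d (I k t)) \<longlonglongrightarrow> p" by (rule tendsto_dist_iff[THEN iffD2])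
    then show ?thesis using p[of 0] by (auto simp: G0)
  qed
  define v where "v = (\<lambda>t. lim (\<lambda>k. d (I k t)))"
  have v: "v t \<in> W t \<and> (\<lambda>k. d (I k t)) \<longlonglongrightarrow> v t" if "t \<in> T" for t
    using lim[OF that] unfolding v_def by (metis limI)
  have "v \<in> borel_measurable (lebesgue_on T)"
    by (rule borel_measurable_LIMSEQ_metric[where f="\<lambda>k t. d (I k t)", OF Im]) (use v T in simp)
  then show thesis using v by (intro that) auto
qed

lemma closed_hitting_times:
  fixes U :: "real \<Rightarrow> 'u::euclidean_space set"
  assumes gr: "closed (Gr U)" and C: "compact C"
  shows "closed {t. 0 \<le> t \<and> U t \<inter> C \<noteq> {}}"
  unfolding closed_sequential_limits
proof (intro allI impI, elim conjE)
  fix s :: "nat \<Rightarrow> real" and t assume s: "\<forall>n. s n \<in> {t. 0 \<le> t \<and> U t \<inter> C \<noteq> {}}" "s \<longlonglongrightarrow> t"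
  then have "\<forall>n. \<exists>u. u \<in> U (s n) \<and> u \<in> C" by auto
  then obtain u where u: "\<And>n. u n \<in> U (s n)" "\<And>n. u n \<in> C" by metis
  then obtain v r where v: "v \<in> C" "strict_mono r" "(u \<circ> r) \<longlonglongrightarrow> v"
    using C unfolding compact_def by blast
  have lim: "(\<lambda>n. (s (r n), u (r n))) \<longlonglongrightarrow> (t, v)"
    using LIMSEQ_subseq_LIMSEQ[OF s(2) v(2)] v(3) by (intro tendsto_Pair) (auto simp: o_def)
  have "(s (r n), u (r n)) \<in> Gr U" for n using u s by (auto simp: Gr_def)
  then have "(t, v) \<in> Gr U" by (rule closed_sequentially[OF gr _ lim])
  then show "t \<in> {t. 0 \<le> t \<and> U t \<inter> C \<noteq> {}}" using v by (auto simp: Gr_def)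
qed

lemma controls_if:
  assumes u: "u \<in> controls U" and v: "v \<in> controls U" and E: "E \<in> sets lebesgue"
  shows "(\<lambda>t. if t \<in> E then v t else u t) \<in> controls U"
proof -
  have "{t \<in> space (lebesgue_on {0..}). t \<in> E} = {0..} \<inter> E" "{0::real..} \<in> sets lebesgue" by auto
  then have "{t \<in> space (lebesgue_on {0..}). t \<in> E} \<in> sets (lebesgue_on {0..})"
    using E by (simp add: sets_restrict_space_iff sets.Int)
  then show ?thesis using u v unfolding controls_def by (auto intro!: measurable_If simp del: space_restrict_space)
qed

text \<open>A measurable selector of \<open>U t \<inter> C\<close> is taken on the closed set of
  times where this intersection is nonempty, and continued by the given \<open>u\<close>.\<close>

lemma control_in_compact:
  fixes U :: "real \<Rightarrow> 'u::euclidean_space set"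
  assumes cu: "cond_u U" and u: "u \<in> controls U" and C: "compact C"
  obtains v where "v \<in> controls U" "\<And>t. 0 \<le> t \<Longrightarrow> U t \<inter> C \<noteq> {} \<Longrightarrow> v t \<in> C"
proof -
  define T where "T = {t. 0 \<le> t \<and> U t \<inter> C \<noteq> {}}"
  have gr: "closed (Gr U)" and comp: "\<And>t. 0 \<le> t \<Longrightarrow> compact (U t)" using cu by (auto simp: cond_u_def)
  have T: "T \<in> sets lebesgue" unfolding T_def using closed_hitting_times[OF gr C] by auto
  obtain v where v: "v \<in> borel_measurable (lebesgue_on T)" "\<And>t. t \<in> T \<Longrightarrow> v t \<in> U t \<inter> C"
  proof (rule measurable_selection[OF T, of "\<lambda>t. U t \<inter> C"])
    show "compact (U t \<inter> C) \<and> U t \<inter> C \<noteq> {}" if "t \<in> T" for t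
      using that comp C by (auto simp: T_def intro: compact_Int)
    show "{t\<in>T. U t \<inter> C \<inter> C' \<noteq> {}} \<in> sets lebesgue" if "compact C'" for C'
    proof -
      have "{t\<in>T. U t \<inter> C \<inter> C' \<noteq> {}} = {t. 0 \<le> t \<and> U t \<inter> (C \<inter> C') \<noteq> {}}" by (auto simp: T_def)
      then show ?thesis using closed_hitting_times[OF gr compact_Int[OF C that]] by auto
    qed
  qed blast
  define w where "w = (\<lambda>t. if t \<in> T then v t else u t)"
  have um: "u \<in> borel_measurable (lebesgue_on {0..})" and uU: "\<And>t. 0 \<le> t \<Longrightarrow> u t \<in> U t" using u by (auto simp: controls_def)
  have v': "(\<lambda>t. if t \<in> T then v t else 0) \<in> borel_measurable lebesgue" using v(1) T by (subst borel_measurable_if)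
  then have v'': "(\<lambda>t. if t \<in> T then v t else 0) \<in> borel_measurable (lebesgue_on {0..})"
    by (rule measurable_restrict_space1)
  have "{t \<in> space (lebesgue_on {0..}). t \<in> T} = {0..} \<inter> T" "{0::real..} \<in> sets lebesgue" by auto
  then have Tm: "{t \<in> space (lebesgue_on {0..}). t \<in> T} \<in> sets (lebesgue_on {0..})"
    using T by (simp add: sets_restrict_space_iff sets.Int)
  have "(\<lambda>t. if t \<in> T then (if t \<in> T then v t else 0) else u t) \<in> borel_measurable (lebesgue_on {0..})"
    using v'' um Tm by (rule measurable_If)
  then have "w \<in> borel_measurable (lebesgue_on {0..})" unfolding w_def by (simp cong: if_cong)
  moreover have "w t \<in> U t" if "0 \<le> t" for t using v(2)[of t] uU[OF that] by (auto simp: w_def)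
  ultimately have "w \<in> controls U" by (simp add: controls_def)
  moreover have "w t \<in> C" if "0 \<le> t" "U t \<inter> C \<noteq> {}" for t using v(2)[of t] that by (auto simp: w_def T_def)
  ultimately show thesis by (rule that)
qed

text \<open>One selection for each ball with centre in a dense sequence and radius
  \<open>1 / (n + 1)\<close>. This reduces a maximum condition over all of \<open>U t\<close> to
  countably many exceptional null sets.\<close>

lemma castaing_controls:
  fixes U :: "real \<Rightarrow> 'u::euclidean_space set"
  assumes cu: "cond_u U" and u: "u \<in> controls U"
  obtains V :: "nat \<Rightarrow> real \<Rightarrow> 'u" where "\<And>j. V j \<in> controls U"
    "\<And>t p e. 0 \<le> t \<Longrightarrow> p \<in> U t \<Longrightarrow> e > 0 \<Longrightarrow> \<exists>j. dist (V j t) p < e"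
proof -
  obtain D :: "'u set" where D: "countable D" "\<And>X. open X \<Longrightarrow> X \<noteq> {} \<Longrightarrow> \<exists>d\<in>D. d \<in> X"
    by (rule countable_dense_setE) blast
  have "D \<noteq> {}" using D(2)[of UNIV] by auto
  then obtain d :: "nat \<Rightarrow> 'u" where d: "range d = D" using D(1) by (metis range_from_nat_into)
  have dense: "\<exists>i. dist (d i) x < e" if "e > 0" for x e
    using D(2)[of "ball x e"] that d by (auto simp: dist_commute)
  define C where "C = (\<lambda>j. cball (d (fst (prod_decode j))) (1 / real (Suc (snd (prod_decode j)))))"
  have "\<exists>v. v \<in> controls U \<and> (\<forall>t\<ge>0. U t \<inter> C j \<noteq> {} \<longrightarrow> v t \<in> C j)" for j
    using control_in_compact[OF cu u, of "C j"] unfolding C_def by (metis compact_cball)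
  then obtain V where V: "\<And>j. V j \<in> controls U" "\<And>j t. 0 \<le> t \<Longrightarrow> U t \<inter> C j \<noteq> {} \<Longrightarrow> V j t \<in> C j" by metis
  show thesis
  proof (rule that[OF V(1)])
    fix t :: real and p e assume t: "0 \<le> t" "p \<in> U t" "(e::real) > 0"
    obtain n where n: "1 / real (Suc n) < e / 2" using t(3) by (meson half_gt_zero nat_approx_posE)
    obtain i where i: "dist (d i) p < 1 / real (Suc n)" using dense[of "1 / real (Suc n)" p] by auto
    define j where "j = prod_encode (i, n)"
    have Cj: "C j = cball (d i) (1 / real (Suc n))" by (simp add: C_def j_def)
    then have "V j t \<in> C j" using i t by (intro V(2)) auto
    then have "dist (d i) (V j t) < e / 2" using n unfolding Cj by auto
    moreover have "dist (d i) p < e / 2" using i n by simp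
    ultimately have "dist (V j t) p < e" using dist_triangle2[of "V j t" p "d i"] by (metis dist_commute dist_triangle_half_r)
    then show "\<exists>j. dist (V j t) p < e" by blast
  qed
qed

section \<open>Bounds on the data of the control problem\<close>

lemma integrable_on_compactsD:
  assumes "integrable_on_compacts M" shows "loc_int M" "\<And>t. 0 \<le> t \<Longrightarrow> 0 \<le> M t"
proof -
  have "set_integrable lebesgue {0..T} M" for T
  proof -
    have "compact {0..T} \<and> {0..T} \<subseteq> {0::real..}" by auto
    then show ?thesis using assms unfolding integrable_on_compacts_def by blast
  qed
  then show "loc_int M" by (simp add: loc_int_def)
qed (use assms in \<open>auto simp: integrable_on_compacts_def\<close>)

text \<open>The hypotheses of the problem give one majorant per compact set; on
  \<open>(k - 1, k]\<close> the \<open>k\<close>-th one is used. Up to time \<open>T\<close> only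
  finitely many occur, and their sum dominates.\<close>

lemma loc_int_piecewise:
  fixes h :: "nat \<Rightarrow> real \<Rightarrow> real"
  assumes h: "\<And>k. loc_int (h k)" "\<And>k t. 0 \<le> t \<Longrightarrow> 0 \<le> h k t"
  shows "loc_int (\<lambda>t. h (nat \<lceil>t\<rceil>) t)"
  unfolding loc_int_def
proof
  fix T :: real
  let ?n = "nat \<lceil>T\<rceil>"
  show "(\<lambda>t. h (nat \<lceil>t\<rceil>) t) absolutely_integrable_on {0..T}"
  proof (rule measurable_bounded_by_integrable_imp_absolutely_integrable[where g="\<lambda>t. \<Sum>k\<le>?n. h k t"])
    have "(\<lambda>t. h (nat \<lceil>t\<rceil>) t) \<in> borel_measurable (lebesgue_on {0..})"
    proof (rule measurable_compose_countable'[where I=UNIV and f="\<lambda>k t. h k t"])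
      have "(\<lambda>t::real. nat \<lceil>t\<rceil>) \<in> borel \<rightarrow>\<^sub>M count_space UNIV" by measurable
      then show "(\<lambda>t::real. nat \<lceil>t\<rceil>) \<in> lebesgue_on {0..} \<rightarrow>\<^sub>M count_space UNIV"
        by (intro measurable_restrict_space1 measurable_completion) simp
    qed (use h loc_int_measurable in auto)
    then show "(\<lambda>t. h (nat \<lceil>t\<rceil>) t) \<in> borel_measurable (lebesgue_on {0..T})"
      by (rule measurable_lebesgue_on_mono) simp
    show "(\<lambda>t. \<Sum>k\<le>?n. h k t) integrable_on {0..T}"
      by (intro integrable_sum loc_int_integrable h(1)) auto
    fix t assume t: "t \<in> {0..T}"
    then have "nat \<lceil>t\<rceil> \<le> ?n" by (intro nat_mono ceiling_mono) simp
    then have "h (nat \<lceil>t\<rceil>) t \<le> (\<Sum>k\<le>?n. h k t)" using t h by (intro member_le_sum) auto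
    then show "norm (h (nat \<lceil>t\<rceil>) t) \<le> (\<Sum>k\<le>?n. h k t)" using t h by auto
  qed simp
qed

lemma compact_Gr_slab:
  assumes cu: "cond_u U"
  shows "compact (cball (0::'e::euclidean_space) R \<times> (Gr U \<inter> ({0..T} \<times> UNIV)))"
proof -
  have "bounded (\<Union>t\<in>{0..T}. U t)" using cu by (auto simp: cond_u_def)
  moreover have "Gr U \<inter> ({0..T} \<times> UNIV) \<subseteq> {0..T} \<times> (\<Union>t\<in>{0..T}. U t)" by (auto simp: Gr_def)
  ultimately have "bounded (Gr U \<inter> ({0..T} \<times> UNIV))" 
    by (intro bounded_subset[OF bounded_Times[OF bounded_closed_interval]])
  moreover have "closed (Gr U \<inter> ({0..T} \<times> UNIV))"
    using cu by (intro closed_Int closed_Times) (auto simp: cond_u_def)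
  ultimately show ?thesis by (intro compact_Times) (auto simp: compact_eq_bounded_closed)
qed

text \<open>A single \<open>l\<close> is majorant and Lipschitz modulus at once, on a tube whose
  radius \<open>\<rho>\<close> varies with time; so one bound is valid on the whole half
  line.\<close>

definition loc_bound ::
  "(real \<Rightarrow> 'u::euclidean_space set) \<Rightarrow> (real \<Rightarrow> 'e::euclidean_space \<Rightarrow> 'u \<Rightarrow> 'd::euclidean_space) \<Rightarrow>
   (real \<Rightarrow> real) \<Rightarrow> (real \<Rightarrow> real) \<Rightarrow> bool" where
  "loc_bound U a \<rho> l \<longleftrightarrow> (\<forall>t x u. 0 \<le> t \<longrightarrow> u \<in> U t \<longrightarrow> norm x \<le> \<rho> t \<longrightarrow>
     norm (a t x u) \<le> l t \<and> (\<forall>y. norm y \<le> \<rho> t \<longrightarrow> norm (a t x u - a t y u) \<le> l t * norm (x - y)))"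

lemma loc_bound_exists:
  fixes a :: "real \<Rightarrow> 'e::euclidean_space \<Rightarrow> 'u::euclidean_space \<Rightarrow> 'd::euclidean_space"
  assumes cu: "cond_u U" and lip: "locally_lipschitz U a" and maj: "measurable_majorant U a"
    and \<rho>: "continuous_on {0..} \<rho>"
  shows "\<exists>l. loc_int l \<and> (\<forall>t\<ge>0. 0 \<le> l t) \<and> loc_bound U a \<rho> l"
proof -
  have "\<exists>R. \<forall>t\<in>{0..real k}. \<rho> t \<le> R" for k
  proof -
    have "continuous_on {0..real k} \<rho>" using \<rho> by (rule continuous_on_subset) auto
    then obtain B where "\<And>t. t \<in> {0..real k} \<Longrightarrow> norm (\<rho> t) \<le> B" by (metis continuous_bound)
    then show ?thesis by (intro exI[of _ B]) force
  qed
  then obtain R where R: "\<And>k t. t \<in> {0..real k} \<Longrightarrow> \<rho> t \<le> R k" by metis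
  define K where "K = (\<lambda>k. cball (0::'e) (R k) \<times> (Gr U \<inter> ({0..real k} \<times> UNIV)))"
  have K: "compact (K k) \<and> K k \<subseteq> UNIV \<times> Gr U" for k
    unfolding K_def using compact_Gr_slab[OF cu] by auto
  have "\<exists>L. integrable_on_compacts L \<and> (\<forall>x' x'' t u. (x', t, u) \<in> K k \<and> (x'', t, u) \<in> K k \<longrightarrow>
            norm (a t x' u - a t x'' u) \<le> L t * norm (x' - x''))" for k
    using lip[unfolded locally_lipschitz_def, rule_format, OF K] .
  then obtain L where L: "\<And>k. integrable_on_compacts (L k)"
    "\<And>k x' x'' t u. (x', t, u) \<in> K k \<Longrightarrow> (x'', t, u) \<in> K k \<Longrightarrow>
            norm (a t x' u - a t x'' u) \<le> L k t * norm (x' - x'')" by metis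
  have "\<exists>M. integrable_on_compacts M \<and> (\<forall>x t u. (x, t, u) \<in> K k \<longrightarrow> norm (a t x u) \<le> M t)" for k
    using maj[unfolded measurable_majorant_def, rule_format, OF K, of k] by fast
  then obtain M where M: "\<And>k. integrable_on_compacts (M k)"
    "\<And>k x t u. (x, t, u) \<in> K k \<Longrightarrow> norm (a t x u) \<le> M k t" by metis
  define h where "h = (\<lambda>k t. L k t + M k t)"
  have h: "loc_int (h k)" "0 \<le> t \<Longrightarrow> 0 \<le> h k t" for k t
    unfolding h_def using integrable_on_compactsD[OF L(1)] integrable_on_compactsD[OF M(1)]
    by (auto intro: loc_int_add)
  have "loc_bound U a \<rho> (\<lambda>t. h (nat \<lceil>t\<rceil>) t)"
    unfolding loc_bound_def
  proof (intro allI impI conjI)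
    fix t x u assume t: "(0::real) \<le> t" and u: "u \<in> U t" and x: "norm (x::'e) \<le> \<rho> t"
    let ?k = "nat \<lceil>t\<rceil>"
    have tk: "t \<in> {0..real ?k}" using t by (auto simp: of_nat_ceiling)
    have mem: "(y, t, u) \<in> K ?k" if "norm y \<le> \<rho> t" for y
      using that R[OF tk] t u tk by (auto simp: K_def Gr_def)
    have "norm (a t x u) \<le> M ?k t" by (rule M(2)[OF mem[OF x]])
    then show "norm (a t x u) \<le> h ?k t"
      unfolding h_def using integrable_on_compactsD(2)[OF L(1) t] by (simp add: add_increasing)
    fix y :: 'e assume y: "norm y \<le> \<rho> t"
    have "norm (a t x u - a t y u) \<le> L ?k t * norm (x - y)" by (rule L(2)[OF mem[OF x] mem[OF y]])
    also have "\<dots> \<le> h ?k t * norm (x - y)"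
      unfolding h_def using integrable_on_compactsD(2)[OF M(1) t] by (intro mult_right_mono) auto
    finally show "norm (a t x u - a t y u) \<le> h ?k t * norm (x - y)" .
  qed
  moreover have "loc_int (\<lambda>t. h (nat \<lceil>t\<rceil>) t)" using h by (rule loc_int_piecewise)
  ultimately show ?thesis using h(2) by (intro exI[of _ "\<lambda>t. h (nat \<lceil>t\<rceil>) t"]) auto
qed

lemma loc_boundD:
  assumes "loc_bound U a \<rho> l" "0 \<le> t" "u \<in> U t" "norm x \<le> \<rho> t"
  shows "norm (a t x u) \<le> l t" "norm y \<le> \<rho> t \<Longrightarrow> norm (a t x u - a t y u) \<le> l t * norm (x - y)"
  using assms unfolding loc_bound_def by blast+

lemma loc_bound_mono:
  fixes a :: "real \<Rightarrow> 'e::euclidean_space \<Rightarrow> 'u::euclidean_space \<Rightarrow> 'd::euclidean_space"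
  assumes "loc_bound U a \<rho> l" "\<And>t. 0 \<le> t \<Longrightarrow> l t \<le> l' t"
  shows "loc_bound U a \<rho> l'"
  unfolding loc_bound_def
proof (intro allI impI conjI)
  fix t :: real and x :: 'e and u assume *: "0 \<le> t" "u \<in> U t" "norm x \<le> \<rho> t"
  show "norm (a t x u) \<le> l' t" using assms * unfolding loc_bound_def by (meson order_trans)
  fix y :: 'e assume "norm y \<le> \<rho> t"
  then have "norm (a t x u - a t y u) \<le> l t * norm (x - y)" using assms * unfolding loc_bound_def by blast
  also have "\<dots> \<le> l' t * norm (x - y)" using assms(2)[OF *(1)] by (intro mult_right_mono) auto
  finally show "norm (a t x u - a t y u) \<le> l' t * norm (x - y)" .
qed

text \<open>For a fixed state, measurability along \<open>u\<close> is the second clause of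
  \<open>caratheodory\<close>; continuity in the state then admits a moving
  \<open>x\<close>.\<close>

lemma caratheodory_measurable:
  assumes a: "caratheodory U a" and u: "u \<in> controls U" and x: "continuous_on {0..} x"
  shows "(\<lambda>t. a t (x t) (u t)) \<in> borel_measurable (lebesgue_on {0..})"
proof (rule caratheodory_compose_measurable[where a="\<lambda>t y. a t y (u t)"])
  show "(\<lambda>t. a t y (u t)) \<in> borel_measurable (lebesgue_on {0..})" for y
    using a u by (auto simp: caratheodory_def)
  show "x \<in> borel_measurable (lebesgue_on {0..})" using x by (rule continuous_on_measurable_half_line)
  fix t assume "t \<in> space (lebesgue_on {0::real..})"
  then have t: "0 \<le> t" "u t \<in> U t" using u by (auto simp: controls_def)
  then have "continuous_on (UNIV \<times> U t) (\<lambda>(y, u). a t y u)" using a by (auto simp: caratheodory_def)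
  then have "continuous_on UNIV ((\<lambda>(y, u). a t y u) \<circ> (\<lambda>y. (y, u t)))"
    using t by (intro continuous_on_compose continuous_intros) (auto elim: continuous_on_subset)
  then show "continuous_on UNIV (\<lambda>y. a t y (u t))" by (simp add: o_def)
qed

section \<open>Matrix bounds, gradients and second-order remainders\<close>

lemma norm_matrix_vector_le:
  fixes A :: "real^'n^'m"
  shows "norm (A *v x) \<le> norm A * norm x"
proof -
  have "norm (A *v x) = L2_set (\<lambda>i. norm (A $ i \<bullet> x)) UNIV"
    by (simp add: norm_vec_def matrix_vector_mul_component)
  also have "\<dots> \<le> L2_set (\<lambda>i. norm (A $ i) * norm x) UNIV"
    by (rule L2_set_mono) (use Cauchy_Schwarz_ineq2 in auto)
  also have "\<dots> = norm A * norm x" by (simp add: norm_vec_def[of A] L2_set_left_distrib)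
  finally show ?thesis .
qed

lemma norm_vector_matrix_le:
  fixes A :: "real^'n^'m"
  shows "norm (p v* A) \<le> norm A * norm p"
proof (cases "norm (p v* A) = 0")
  case False
  have "norm (p v* A) * norm (p v* A) = (p v* A) \<bullet> (p v* A)" by (simp add: power2_norm_eq_inner[symmetric] power2_eq_square)
  also have "\<dots> = p \<bullet> (A *v (p v* A))" by (rule dot_lmul_matrix)
  also have "\<dots> \<le> norm p * norm (A *v (p v* A))" by (rule norm_cauchy_schwarz)
  also have "\<dots> \<le> norm p * (norm A * norm (p v* A))" by (intro mult_left_mono norm_matrix_vector_le) auto
  finally show ?thesis using False by (simp add: mult.commute mult.left_commute)
qed simp

lemma continuous_on_vector_matrix:
  "continuous_on UNIV (\<lambda>z. fst z v* (snd z :: real^'n^'m))"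
proof -
  have "bounded_bilinear (\<lambda>p (A::real^'n^'m). p v* A)"
  proof (rule bounded_bilinear.intro)
    show "\<exists>K. \<forall>p (A::real^'n^'m). norm (p v* A) \<le> norm p * norm A * K"
      using norm_vector_matrix_le[where ?'n='n and ?'m='m] by (intro exI[of _ 1]) (metis mult.commute mult.right_neutral)
  qed (simp_all add: vector_matrix_left_distrib vector_matrix_mult_add_rdistrib scaleR_vector_matrix_assoc[symmetric] vector_scaleR_matrix_ac)
  then show ?thesis by (rule bounded_bilinear.continuous_on) (intro continuous_intros)+
qed

lemma borel_measurable_vector_matrix:
  fixes A :: "'t \<Rightarrow> real^'n^'m"
  assumes "p \<in> borel_measurable M" "A \<in> borel_measurable M"
  shows "(\<lambda>t. p t v* A t) \<in> borel_measurable M"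
  using assms continuous_on_vector_matrix by (rule borel_measurable_continuous_Pair)

lemma gradient_eqI: 
  fixes F :: "'a::euclidean_space \<Rightarrow> real"
  assumes "GDERIV F x :> d" shows "gradient F x = d"
  unfolding gradient_def
proof (rule the_equality)
  show "GDERIV F x :> d" by fact
  fix e assume "GDERIV F x :> e"
  then have "(\<lambda>h. h \<bullet> e) = (\<lambda>h. h \<bullet> d)" using assms unfolding gderiv_def by (rule has_derivative_unique)
  then have "h \<bullet> e = h \<bullet> d" for h by meson
  then show "e = d" by (metis inner_commute vector_eq_ldot)
qed

lemma GDERIV_gradient:
  fixes F :: "'a::euclidean_space \<Rightarrow> real"
  assumes "F differentiable (at x)" shows "GDERIV F x :> gradient F x"
proof -
  obtain D where D: "(F has_derivative D) (at x)" using assms by (auto simp: differentiable_def)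
  then have bl: "bounded_linear D" by (rule has_derivative_bounded_linear)
  then have lin: "linear D" by (rule bounded_linear.linear)
  have "D h = h \<bullet> (adjoint D 1)" for h using adjoint_works[OF lin, of h 1] by simp
  then have "D = (\<lambda>h. h \<bullet> adjoint D 1)" by auto
  then have "GDERIV F x :> adjoint D 1" using D unfolding gderiv_def by simp
  then show ?thesis using gradient_eqI by metis
qed

text \<open>The derivative is compared only with its value at the base point \<open>x\<close>. The
  ball of radius \<open>r\<close> is convex, so the segment to \<open>y\<close> stays inside it, and
  its points are no farther from \<open>x\<close> than \<open>y\<close>.\<close>

lemma taylor_quadratic:
  fixes F :: "'a::euclidean_space \<Rightarrow> 'b::real_normed_vector"
  assumes F: "\<And>z. (F has_derivative F' z) (at z)"
    and lip: "\<And>z h. norm z \<le> r \<Longrightarrow> norm (F' z h - F' x h) \<le> L * norm (z - x) * norm h"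
    and xy: "norm x \<le> r" "norm y \<le> r" and L: "0 \<le> L"
  shows "norm (F y - F x - F' x (y - x)) \<le> L * norm (y - x) ^ 2"
proof -
  let ?S = "closed_segment x y"
  have "norm (F y - F x - F' x (y - x)) \<le> norm (y - x) * (L * norm (y - x))"
  proof (rule differentiable_bound_linearization[where S="?S" and f'=F'])
    show "x + s *\<^sub>R (y - x) \<in> ?S" if "s \<in> {0..1}" for s
      using that unfolding in_segment by (intro exI[of _ s]) (auto simp: algebra_simps)
    show "(F has_derivative F' z) (at z within ?S)" for z
      by (rule has_derivative_at_withinI[OF F])
    fix z assume z: "z \<in> ?S"
    have "?S \<subseteq> cball 0 r" using xy by (intro closed_segment_subset) auto
    then have "norm z \<le> r" using z by auto
    moreover have "norm (z - x) \<le> norm (y - x)"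
      using dist_in_closed_segment[OF z] by (simp add: dist_norm norm_minus_commute)
    ultimately have "norm (F' z h - F' x h) \<le> L * norm (y - x) * norm h" for h
      using lip[of z h] L by (meson mult_left_mono mult_right_mono norm_ge_zero order_trans)
    then show "onorm (F' z - F' x) \<le> L * norm (y - x)" by (intro onorm_le) simp
  qed auto
  then show ?thesis by (simp add: power2_eq_square mult_ac)
qed

text \<open>Serves to join a backward continuation before \<open>\<Theta>\<close> with a modified
  solution after it. On \<open>{\<Theta>..t}\<close> the spliced derivative and \<open>q\<close> can
  disagree only at the point \<open>\<Theta>\<close>.\<close>

lemma primitive_splice:
  fixes x y :: "real \<Rightarrow> 'a::euclidean_space"
  assumes x: "primitive x p" and y: "primitive y q" and \<Theta>: "0 \<le> \<Theta>" "x \<Theta> = y \<Theta>"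
  shows "primitive (\<lambda>t. if t \<le> \<Theta> then x t else y t) (\<lambda>t. if t \<le> \<Theta> then p t else q t)"
proof -
  let ?h = "\<lambda>t. if t \<le> \<Theta> then p t else q t"
  have pq: "loc_int p" "loc_int q" using x y primitive_loc_int by auto
  have "{t \<in> space (lebesgue_on {0..}). t \<le> \<Theta>} = {0..\<Theta>}" by auto
  then have m: "{t \<in> space (lebesgue_on {0..}). t \<le> \<Theta>} \<in> sets (lebesgue_on {0..})"
    by (simp add: sets_restrict_space_iff)
  have li: "loc_int ?h"
  proof (rule loc_int_dominated)
    show "?h \<in> borel_measurable (lebesgue_on {0..})"
      using loc_int_measurable[OF pq(1)] loc_int_measurable[OF pq(2)] m by (rule measurable_If)
    show "loc_int (\<lambda>t. norm (p t) + norm (q t))" using pq by (intro loc_int_add loc_int_norm)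
  qed auto
  have i1: "integral {0..t} ?h = integral {0..t} p" if "t \<le> \<Theta>" for t
    using that by (intro Henstock_Kurzweil_Integration.integral_cong) auto
  have i2: "integral {\<Theta>..t} ?h = integral {\<Theta>..t} q" for t
    by (rule integral_spike[of "{\<Theta>}"]) auto
  have "(if t \<le> \<Theta> then x t else y t) = (if 0 \<le> \<Theta> then x 0 else y 0) + integral {0..t} ?h" if t: "0 \<le> t" for t
  proof (cases "t \<le> \<Theta>")
    case True
    then show ?thesis using i1[OF True] primitive_eq[OF x t] \<Theta> by simp
  next
    case False
    have "integral {0..t} ?h = integral {0..\<Theta>} p + integral {\<Theta>..t} q"
      using integral_diff_half_line[OF li \<Theta>(1), of t] False i1[of \<Theta>] i2[of t] by (simp add: algebra_simps)
    also have "\<dots> = (x \<Theta> - x 0) + (y t - y \<Theta>)"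
      using primitive_diff[OF x _ \<Theta>(1)] primitive_diff[OF y \<Theta>(1), of t] False by simp
    finally show ?thesis using False \<Theta> by simp
  qed
  then show ?thesis using li unfolding primitive_def by blast
qed

section \<open>Common bounds for the data of the control system\<close>

locale control_system =
  fixes U :: "real \<Rightarrow> 'u::euclidean_space set"
    and f :: "real \<Rightarrow> real^'m \<Rightarrow> 'u \<Rightarrow> real^'m"
    and g :: "real \<Rightarrow> real^'m \<Rightarrow> 'u \<Rightarrow> real"
  assumes cu: "cond_u U" and cf: "cond_f U f" and cg: "cond_g U f g" and cd: "cond_d U f g"
begin

definition fx where "fx t x u = jacobian (\<lambda>y. f t y u) (at x)"
definition gx where "gx t x u = gradient (\<lambda>y. g t y u) x"

text \<open>A common \<open>l\<close> for \<open>f\<close>, \<open>g\<close> and both derivatives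
  makes its sublevel sets useful: where \<open>l t \<le> \<kappa>\<close>, all these data are
  bounded at once. Needles are placed in such sets.\<close>

definition bounds :: "(real \<Rightarrow> real) \<Rightarrow> (real \<Rightarrow> real) \<Rightarrow> bool" where
  "bounds \<rho> l \<longleftrightarrow> loc_int l \<and> (\<forall>t\<ge>0. 0 \<le> l t) \<and>
     loc_bound U f \<rho> l \<and> loc_bound U g \<rho> l \<and> loc_bound U fx \<rho> l \<and> loc_bound U gx \<rho> l"

lemma regularity:
  "caratheodory U f" "caratheodory U g" "caratheodory U fx" "caratheodory U gx"
  "locally_lipschitz U f" "locally_lipschitz U g" "locally_lipschitz U fx" "locally_lipschitz U gx"
  "measurable_majorant U f" "measurable_majorant U g" "measurable_majorant U fx" "measurable_majorant U gx"
proof -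
  have fx: "fx = (\<lambda>t x u. jacobian (\<lambda>y. f t y u) (at x))" and gx: "gx = (\<lambda>t x u. gradient (\<lambda>y. g t y u) x)"
    by (intro ext, simp add: fx_def gx_def)+
  note cf[unfolded cond_f_def] cg[unfolded cond_g_def] cd[unfolded cond_d_def Let_def, folded fx gx]
  then show "caratheodory U f" "caratheodory U g" "caratheodory U fx" "caratheodory U gx"
    "locally_lipschitz U f" "locally_lipschitz U g" "locally_lipschitz U fx" "locally_lipschitz U gx"
    "measurable_majorant U f" "measurable_majorant U g" "measurable_majorant U fx" "measurable_majorant U gx"
    by simp_all
qed

lemma bounds_exists: assumes "continuous_on {0..} \<rho>" obtains l where "bounds \<rho> l"
proof -
  obtain l1 where 1: "loc_int l1" "\<forall>t\<ge>0. 0 \<le> l1 t" "loc_bound U f \<rho> l1"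
    using loc_bound_exists[OF cu regularity(5,9) assms] by blast
  obtain l2 where 2: "loc_int l2" "\<forall>t\<ge>0. 0 \<le> l2 t" "loc_bound U g \<rho> l2"
    using loc_bound_exists[OF cu regularity(6,10) assms] by blast
  obtain l3 where 3: "loc_int l3" "\<forall>t\<ge>0. 0 \<le> l3 t" "loc_bound U fx \<rho> l3"
    using loc_bound_exists[OF cu regularity(7,11) assms] by blast
  obtain l4 where 4: "loc_int l4" "\<forall>t\<ge>0. 0 \<le> l4 t" "loc_bound U gx \<rho> l4"
    using loc_bound_exists[OF cu regularity(8,12) assms] by blast
  let ?l = "\<lambda>t. l1 t + l2 t + l3 t + l4 t"
  have "bounds \<rho> ?l" unfolding bounds_def
  proof (intro conjI)
    show "loc_int ?l" using 1 2 3 4 by (intro loc_int_add)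
    show "\<forall>t\<ge>0. 0 \<le> ?l t" using 1 2 3 4 by simp
    show "loc_bound U f \<rho> ?l" by (rule loc_bound_mono[OF 1(3)]) (use 1 2 3 4 in force)
    show "loc_bound U g \<rho> ?l" by (rule loc_bound_mono[OF 2(3)]) (use 1 2 3 4 in force)
    show "loc_bound U fx \<rho> ?l" by (rule loc_bound_mono[OF 3(3)]) (use 1 2 3 4 in force)
    show "loc_bound U gx \<rho> ?l" by (rule loc_bound_mono[OF 4(3)]) (use 1 2 3 4 in force)
  qed
  then show thesis by (rule that)
qed

lemma boundsD:
  assumes "bounds \<rho> l"
  shows "loc_int l" "0 \<le> t \<Longrightarrow> 0 \<le> l t"
    and "0 \<le> t \<Longrightarrow> u \<in> U t \<Longrightarrow> norm x \<le> \<rho> t \<Longrightarrow> norm (f t x u) \<le> l t"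
    and "0 \<le> t \<Longrightarrow> u \<in> U t \<Longrightarrow> norm x \<le> \<rho> t \<Longrightarrow> \<bar>g t x u\<bar> \<le> l t"
    and "0 \<le> t \<Longrightarrow> u \<in> U t \<Longrightarrow> norm x \<le> \<rho> t \<Longrightarrow> norm (fx t x u) \<le> l t"
    and "0 \<le> t \<Longrightarrow> u \<in> U t \<Longrightarrow> norm x \<le> \<rho> t \<Longrightarrow> norm (gx t x u) \<le> l t"
    and "0 \<le> t \<Longrightarrow> u \<in> U t \<Longrightarrow> norm x \<le> \<rho> t \<Longrightarrow> norm y \<le> \<rho> t \<Longrightarrow> norm (f t x u - f t y u) \<le> l t * norm (x - y)"
    and "0 \<le> t \<Longrightarrow> u \<in> U t \<Longrightarrow> norm x \<le> \<rho> t \<Longrightarrow> norm y \<le> \<rho> t \<Longrightarrow> \<bar>g t x u - g t y u\<bar> \<le> l t * norm (x - y)"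
    and "0 \<le> t \<Longrightarrow> u \<in> U t \<Longrightarrow> norm x \<le> \<rho> t \<Longrightarrow> norm y \<le> \<rho> t \<Longrightarrow> norm (fx t x u - fx t y u) \<le> l t * norm (x - y)"
    and "0 \<le> t \<Longrightarrow> u \<in> U t \<Longrightarrow> norm x \<le> \<rho> t \<Longrightarrow> norm y \<le> \<rho> t \<Longrightarrow> norm (gx t x u - gx t y u) \<le> l t * norm (x - y)"
proof -
  have b: "loc_bound U f \<rho> l" "loc_bound U g \<rho> l" "loc_bound U fx \<rho> l" "loc_bound U gx \<rho> l"
    using assms unfolding bounds_def by simp_all
  show "loc_int l" "0 \<le> t \<Longrightarrow> 0 \<le> l t" using assms unfolding bounds_def by simp_all
  assume *: "0 \<le> t" "u \<in> U t" "norm x \<le> \<rho> t"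
  note 1 = loc_boundD(1)[OF b(1) *] loc_boundD(1)[OF b(2) *, unfolded real_norm_def]
    loc_boundD(1)[OF b(3) *] loc_boundD(1)[OF b(4) *]
  show "norm (f t x u) \<le> l t" "\<bar>g t x u\<bar> \<le> l t" "norm (fx t x u) \<le> l t" "norm (gx t x u) \<le> l t" by (rule 1)+
  assume y: "norm y \<le> \<rho> t"
  note 2 = loc_boundD(2)[OF b(1) * y] loc_boundD(2)[OF b(2) * y, unfolded real_norm_def]
    loc_boundD(2)[OF b(3) * y] loc_boundD(2)[OF b(4) * y]
  show "norm (f t x u - f t y u) \<le> l t * norm (x - y)" "\<bar>g t x u - g t y u\<bar> \<le> l t * norm (x - y)"
    "norm (fx t x u - fx t y u) \<le> l t * norm (x - y)" "norm (gx t x u - gx t y u) \<le> l t * norm (x - y)"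
    by (rule 2)+
qed

lemma has_derivative_f: "0 \<le> t \<Longrightarrow> ((\<lambda>y. f t y u) has_derivative (\<lambda>h. fx t x u *v h)) (at x)"
  using cd unfolding cond_d_def fx_def by (simp add: jacobian_works[symmetric])

lemma has_derivative_g: "0 \<le> t \<Longrightarrow> ((\<lambda>y. g t y u) has_derivative (\<lambda>h. h \<bullet> gx t x u)) (at x)"
  using cd GDERIV_gradient unfolding cond_d_def gx_def gderiv_def by blast

lemma Ham_x_eq:
  assumes "0 \<le> t" shows "Ham_x f g x t u lam p = p v* fx t x u + lam *\<^sub>R gx t x u"
  unfolding Ham_x_def
proof (rule gradient_eqI)
  have "((\<lambda>y. p \<bullet> f t y u + lam * g t y u) has_derivative
      (\<lambda>h. p \<bullet> (fx t x u *v h) + lam * (h \<bullet> gx t x u))) (at x)"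
    by (intro has_derivative_add has_derivative_inner_right has_derivative_mult_right
        has_derivative_f has_derivative_g assms)
  moreover have "(\<lambda>h. p \<bullet> (fx t x u *v h) + lam * (h \<bullet> gx t x u)) = (\<lambda>h. h \<bullet> (p v* fx t x u + lam *\<^sub>R gx t x u))"
    by (simp add: fun_eq_iff inner_add_right dot_lmul_matrix[symmetric] inner_commute)
  ultimately show "GDERIV (\<lambda>y. Ham f g y t u lam p) x :> p v* fx t x u + lam *\<^sub>R gx t x u"
    unfolding Ham_def gderiv_def by simp
qed

lemma taylor_f:
  assumes b: "bounds \<rho> l" and t: "0 \<le> t" "u \<in> U t" "norm x \<le> \<rho> t" "norm y \<le> \<rho> t"
  shows "norm (f t y u - f t x u - fx t x u *v (y - x)) \<le> l t * norm (y - x) ^ 2"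
proof (rule taylor_quadratic[OF has_derivative_f[OF t(1)] _ t(3,4) boundsD(2)[OF b t(1)]])
  fix z h :: "real^'m" assume z: "norm z \<le> \<rho> t"
  have "norm (fx t z u *v h - fx t x u *v h) = norm ((fx t z u - fx t x u) *v h)"
    by (simp add: matrix_vector_mult_diff_rdistrib)
  also have "\<dots> \<le> norm (fx t z u - fx t x u) * norm h" by (rule norm_matrix_vector_le)
  also have "\<dots> \<le> l t * norm (z - x) * norm h"
    using boundsD(9)[OF b t(1,2) z t(3)] by (intro mult_right_mono) auto
  finally show "norm (fx t z u *v h - fx t x u *v h) \<le> l t * norm (z - x) * norm h" .
qed

lemma taylor_g:
  assumes b: "bounds \<rho> l" and t: "0 \<le> t" "u \<in> U t" "norm x \<le> \<rho> t" "norm y \<le> \<rho> t"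
  shows "\<bar>g t y u - g t x u - gx t x u \<bullet> (y - x)\<bar> \<le> l t * norm (y - x) ^ 2"
proof -
  have "norm (g t y u - g t x u - (y - x) \<bullet> gx t x u) \<le> l t * norm (y - x) ^ 2"
  proof (rule taylor_quadratic[OF has_derivative_g[OF t(1)] _ t(3,4) boundsD(2)[OF b t(1)]])
    fix z h :: "real^'m" assume z: "norm z \<le> \<rho> t"
    have "norm (h \<bullet> gx t z u - h \<bullet> gx t x u) \<le> norm (gx t z u - gx t x u) * norm h"
      using Cauchy_Schwarz_ineq2[of h "gx t z u - gx t x u"] by (simp add: inner_diff_right mult.commute)
    also have "\<dots> \<le> l t * norm (z - x) * norm h"
      using boundsD(10)[OF b t(1,2) z t(3)] by (intro mult_right_mono) auto
    finally show "norm (h \<bullet> gx t z u - h \<bullet> gx t x u) \<le> l t * norm (z - x) * norm h" .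
  qed
  then show ?thesis by (simp add: inner_commute)
qed

end

section \<open>Trajectories and adjoint functions\<close>

lemma indicator_half_line:
  fixes D :: "real set"
  assumes D: "D \<in> lmeasurable"
  shows "loc_int (indicator D :: real \<Rightarrow> real)"
    and "integral {0..T} (indicator D :: real \<Rightarrow> real) \<le> measure lebesgue D"
proof -
  have hi: "((indicator D :: real \<Rightarrow> real) has_integral measure lebesgue D) UNIV"
    using D lmeasurable_iff_has_integral by blast
  have int: "(indicator D :: real \<Rightarrow> real) absolutely_integrable_on UNIV"
    using hi by (intro nonnegative_absolutely_integrable_1) auto
  show li: "loc_int (indicator D :: real \<Rightarrow> real)"
    unfolding loc_int_def by (intro allI) (rule set_integrable_subset[OF int], auto)
  have "integral {0..T} (indicator D :: real \<Rightarrow> real) \<le> integral UNIV (indicator D :: real \<Rightarrow> real)"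
    using hi loc_int_integrable[OF li] by (intro integral_subset_le) auto
  then show "integral {0..T} (indicator D :: real \<Rightarrow> real) \<le> measure lebesgue D" using hi by (simp add: integral_unique)
qed

lemma integral_indicator_half_line:
  fixes D :: "real set"
  assumes D: "D \<in> lmeasurable" "D \<subseteq> {0..T}"
  shows "integral {0..T} (indicator D :: real \<Rightarrow> real) = measure lebesgue D"
proof -
  have "((\<lambda>t. if t \<in> {0..T} then indicator D t else (0::real)) has_integral measure lebesgue D) UNIV"
  proof (rule has_integral_eq[rotated])
    show "((indicator D :: real \<Rightarrow> real) has_integral measure lebesgue D) UNIV"
      using D lmeasurable_iff_has_integral by blast
    show "indicator D t = (if t \<in> {0..T} then indicator D t else (0::real))" for t
      using D(2) by (auto simp: indicator_def)
  qed
  then have "((indicator D :: real \<Rightarrow> real) has_integral measure lebesgue D) {0..T}"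
    by (simp only: has_integral_restrict_UNIV)
  then show ?thesis by (rule integral_unique)
qed

context control_system
begin

lemma controlsD: "u \<in> controls U \<Longrightarrow> 0 \<le> t \<Longrightarrow> u t \<in> U t" by (simp add: controls_def)

lemma loc_int_compose:
  fixes a :: "real \<Rightarrow> 'e::euclidean_space \<Rightarrow> 'u \<Rightarrow> 'd::euclidean_space"
  assumes a: "caratheodory U a" "locally_lipschitz U a" "measurable_majorant U a"
    and u: "u \<in> controls U" and x: "continuous_on {0..} x"
  shows "loc_int (\<lambda>t. a t (x t) (u t))"
proof -
  have "continuous_on {0..} (\<lambda>t. norm (x t))" using x by (intro continuous_intros)
  then obtain l where l: "loc_int l" "loc_bound U a (\<lambda>t. norm (x t)) l"
    using loc_bound_exists[OF cu a(2,3)] by blast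
  show ?thesis
    by (rule loc_int_dominated[OF caratheodory_measurable[OF a(1) u x] l(1)])
       (rule loc_boundD(1)[OF l(2)], use controlsD[OF u] in auto)
qed

lemmas loc_int_f = loc_int_compose[OF regularity(1,5,9)]
lemmas loc_int_g = loc_int_compose[OF regularity(2,6,10)]

text \<open>A fixed choice of the growth majorant, so that the bound \<open>\<rho>\<^sub>0\<close>
  on all trajectories can be a definition.\<close>

definition growth :: "real \<Rightarrow> real" where
  "growth = (SOME M. integrable_on_compacts M \<and> (\<forall>x. \<forall>(t, u)\<in>Gr U. norm (f t x u) \<le> M t * (1 + norm x)))"

lemma growth:
  "loc_int growth" "0 \<le> t \<Longrightarrow> 0 \<le> growth t"
  "0 \<le> t \<Longrightarrow> u \<in> U t \<Longrightarrow> norm (f t x u) \<le> growth t * (1 + norm x)"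
proof -
  have "\<exists>M. integrable_on_compacts M \<and> (\<forall>x. \<forall>(t, u)\<in>Gr U. norm (f t x u) \<le> M t * (1 + norm x))"
    using cf by (auto simp: cond_f_def extendability_def)
  then have "integrable_on_compacts growth \<and> (\<forall>x. \<forall>(t, u)\<in>Gr U. norm (f t x u) \<le> growth t * (1 + norm x))"
    unfolding growth_def by (rule someI_ex)
  then have *: "integrable_on_compacts growth" "\<forall>x. \<forall>(t, u)\<in>Gr U. norm (f t x u) \<le> growth t * (1 + norm x)" by auto
  show "loc_int growth" "0 \<le> t \<Longrightarrow> 0 \<le> growth t" using integrable_on_compactsD[OF *(1)] by auto
  show "0 \<le> t \<Longrightarrow> u \<in> U t \<Longrightarrow> norm (f t x u) \<le> growth t * (1 + norm x)"
    using *(2) by (auto simp: Gr_def)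
qed

lemma state_lipschitz:
  assumes u: "u \<in> controls U" and \<rho>: "continuous_on {0..} \<rho>"
  shows "\<exists>l. loc_int l \<and> (\<forall>t\<ge>0. 0 \<le> l t) \<and>
      (\<forall>t x y. 0 \<le> t \<longrightarrow> norm x \<le> \<rho> t \<longrightarrow> norm y \<le> \<rho> t \<longrightarrow> norm (f t x (u t) - f t y (u t)) \<le> l t * norm (x - y))"
proof -
  obtain l where l: "bounds \<rho> l" using bounds_exists[OF \<rho>] .
  show ?thesis using boundsD(1,2)[OF l] boundsD(7)[OF l _ controlsD[OF u]] by (intro exI[of _ l]) auto
qed

lemma state_exists:
  assumes u: "u \<in> controls U" and \<tau>: "0 \<le> \<tau>"
  obtains x where "primitive x (\<lambda>t. f t (x t) (u t))" "x \<tau> = \<xi>"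
proof -
  have m: "(\<lambda>t. f t (x t) (u t)) \<in> borel_measurable (lebesgue_on {0..})" if "continuous_on {0..} x" for x
    by (rule caratheodory_measurable[OF regularity(1) u that])
  have gr: "norm (f t x (u t)) \<le> growth t * (1 + norm x)" if "0 \<le> t" for t x
    by (rule growth(3)[OF that controlsD[OF u that]])
  show thesis
    by (rule ivp_exists[where F="\<lambda>t x. f t x (u t)", OF m state_lipschitz[OF u] growth(1,2) gr \<tau> that])
qed

lemma state_unique:
  assumes u: "u \<in> controls U" and "primitive x (\<lambda>t. f t (x t) (u t))" "primitive y (\<lambda>t. f t (y t) (u t))"
    and "0 \<le> s" "x s = y s" "0 \<le> t"
  shows "x t = y t"
  by (rule ivp_unique[where F="\<lambda>t x. f t x (u t)", OF state_lipschitz[OF u] assms(2-6)])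

text \<open>The initial value problem determines the solution on the half line only; restriction to
  \<open>{0..}\<close> fixes the remaining values, so that \<open>THE\<close> has a unique
  candidate.\<close>

lemma traj:
  assumes u: "u \<in> controls U"
  shows "primitive (traj f u) (\<lambda>t. f t (traj f u t) (u t))" "traj f u 0 = 0"
proof -
  let ?P = "\<lambda>x. x \<in> extensional {0..} \<and> x \<in> C_loc \<and> has_ae_derivative x (\<lambda>t. f t (x t) (u t)) \<and> x 0 = 0"
  obtain x where x: "primitive x (\<lambda>t. f t (x t) (u t))" "x 0 = 0" using state_exists[OF u, of 0 0] by auto
  define y where "y = restrict x {0..}"
  have yx: "y t = x t" if "0 \<le> t" for t using that by (simp add: y_def)
  have y: "primitive y (\<lambda>t. f t (y t) (u t))"
    using x(1) by (rule primitive_cong[THEN iffD1, rotated 2]) (simp_all add: yx)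
  have P: "?P y"
    using y primitive_continuous[OF y] has_ae_derivative_iff_primitive[OF primitive_loc_int[OF y]] x(2)
    by (auto simp: C_loc_def y_def)
  have uniq: "z = y" if z: "?P z" for z
  proof -
    have "loc_int (\<lambda>t. f t (z t) (u t))" using z u by (intro loc_int_f) (auto simp: C_loc_def)
    then have "primitive z (\<lambda>t. f t (z t) (u t))" using z has_ae_derivative_iff_primitive by blast
    then have "z t = y t" if "0 \<le> t" for t using state_unique[OF u _ y, of z 0 t] z P that by simp
    then show ?thesis using z P by (intro extensionalityI[of _ "{0..}"]) auto
  qed
  have "traj f u = y" unfolding traj_def by (rule the_equality[of ?P, OF P uniq])
  then show "primitive (traj f u) (\<lambda>t. f t (traj f u t) (u t))" "traj f u 0 = 0" using y P by simp_all
qed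

text \<open>The Gronwall bound of \<open>state_bound\<close> on \<open>{0..t}\<close> for initial
  state 0. It is the same for every control.\<close>

definition \<rho>\<^sub>0 :: "real \<Rightarrow> real" where
  "\<rho>\<^sub>0 t = 2 * integral {0..t} growth * exp (2 * integral {0..t} growth)"

lemma continuous_growth_integral: "continuous_on {0..} (\<lambda>t. integral {0..t} growth)"
  using primitive_continuous[OF primitive_integral[OF growth(1), of 0]] by simp

lemma continuous_\<rho>\<^sub>0: "continuous_on {0..} \<rho>\<^sub>0"
  unfolding \<rho>\<^sub>0_def[abs_def] using continuous_growth_integral by (intro continuous_intros)

lemma state_bound:
  assumes u: "u \<in> controls U" and x: "primitive x (\<lambda>t. f t (x t) (u t))"
    and st: "s \<in> {0..T}" "t \<in> {0..T}"
  shows "norm (x t) \<le> 2 * (norm (x s) + integral {0..T} growth) * exp (2 * integral {0..T} growth)"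
proof -
  have z: "primitive (\<lambda>t. 0::real^'m) (\<lambda>t. 0)" by (simp add: primitive_def loc_int_const)
  have "norm (x t - 0) \<le> 2 * (norm (x s - 0) + integral {0..T} growth) * exp (2 * integral {0..T} growth)"
  proof (rule primitive_comparison[OF x z growth(1,2) growth(1,2)])
    show "norm (f s (x s) (u s) - 0) \<le> growth s * norm (x s - 0) + growth s" if "s \<in> {0..T}" for s
      using growth(3)[OF _ controlsD[OF u], of s "x s"] that by (simp add: algebra_simps)
  qed (use st in auto)
  then show ?thesis by simp
qed

lemma traj_bound:
  assumes u: "u \<in> controls U" and t: "0 \<le> t" shows "norm (traj f u t) \<le> \<rho>\<^sub>0 t"
  using state_bound[OF u traj(1)[OF u], of 0 t t] t traj(2)[OF u] by (simp add: \<rho>\<^sub>0_def)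

text \<open>On \<open>D\<close> both velocities are at most \<open>\<kappa>\<close> in norm, so the
  defect in the comparison is \<open>2 * \<kappa>\<close> times the indicator of \<open>D\<close>.
  The distance is therefore linear in the measure of \<open>D\<close>.\<close>

lemma traj_diff:
  assumes b: "bounds \<rho>\<^sub>0 l" and u: "u \<in> controls U" and v: "v \<in> controls U"
    and D: "D \<in> lmeasurable" "\<And>t. t \<in> D \<Longrightarrow> 0 \<le> t \<and> l t \<le> \<kappa>" and \<kappa>: "0 \<le> \<kappa>"
    and off: "\<And>t. 0 \<le> t \<Longrightarrow> t \<notin> D \<Longrightarrow> v t = u t" and t: "t \<in> {0..T}"
  shows "norm (traj f v t - traj f u t) \<le> 4 * \<kappa> * measure lebesgue D * exp (2 * integral {0..T} l)"
proof -
  have di: "loc_int (\<lambda>t. 2 * \<kappa> * indicator D t)" using loc_int_scaleR[OF indicator_half_line(1)[OF D(1)], of "2 * \<kappa>"] by simp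
  have "norm (traj f v t - traj f u t) \<le>
    2 * (norm (traj f v 0 - traj f u 0) + integral {0..T} (\<lambda>t. 2 * \<kappa> * indicator D t)) * exp (2 * integral {0..T} l)"
  proof (rule primitive_comparison[OF traj(1)[OF v] traj(1)[OF u] boundsD(1,2)[OF b] di])
    show "0 \<le> 2 * \<kappa> * indicator D t" for t using \<kappa> by simp
    fix s assume s: "s \<in> {0..T}"
    let ?x = "traj f u s" and ?y = "traj f v s"
    have s0: "0 \<le> s" "v s \<in> U s" "u s \<in> U s" "norm ?x \<le> \<rho>\<^sub>0 s" "norm ?y \<le> \<rho>\<^sub>0 s"
      using s traj_bound[OF u, of s] traj_bound[OF v, of s] controlsD[OF u, of s] controlsD[OF v, of s] by simp_all
    have "norm (f s ?y (v s) - f s ?x (u s)) \<le> norm (f s ?y (v s) - f s ?x (v s)) + norm (f s ?x (v s) - f s ?x (u s))"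
      using norm_triangle_ineq[of "f s ?y (v s) - f s ?x (v s)" "f s ?x (v s) - f s ?x (u s)"] by simp
    moreover have "norm (f s ?y (v s) - f s ?x (v s)) \<le> l s * norm (?y - ?x)"
      using boundsD(7)[OF b] s0 by blast
    moreover have "norm (f s ?x (v s) - f s ?x (u s)) \<le> 2 * \<kappa> * indicator D s"
    proof (cases "s \<in> D")
      case True
      have "norm (f s ?x (v s)) \<le> l s" "norm (f s ?x (u s)) \<le> l s" using boundsD(3)[OF b] s0 by auto
      then show ?thesis using True D(2)[OF True] norm_triangle_ineq4[of "f s ?x (v s)" "f s ?x (u s)"] by simp
    qed (use off s in simp)
    ultimately show "norm (f s ?y (v s) - f s ?x (u s)) \<le> l s * norm (?y - ?x) + 2 * \<kappa> * indicator D s" by linarith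
  qed (use t in auto)
  also have "\<dots> = 2 * (2 * \<kappa> * integral {0..T} (indicator D)) * exp (2 * integral {0..T} l)"
    by (simp add: traj(2)[OF u] traj(2)[OF v] integral_mult_right)
  also have "\<dots> \<le> 2 * (2 * \<kappa> * measure lebesgue D) * exp (2 * integral {0..T} l)"
    using indicator_half_line(2)[OF D(1), of T] \<kappa> by (intro mult_right_mono mult_left_mono) auto
  finally show ?thesis by simp
qed

section \<open>The adjoint equation\<close>

definition adj :: "(real \<Rightarrow> real^'m) \<Rightarrow> (real \<Rightarrow> 'u) \<Rightarrow> real \<Rightarrow> (real \<Rightarrow> real^'m) \<Rightarrow> real \<Rightarrow> real^'m" where
  "adj x u lam \<psi> t = - (\<psi> t v* fx t (x t) (u t) + lam *\<^sub>R gx t (x t) (u t))"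

text \<open>The equation is affine in \<open>\<psi>\<close>, hence globally Lipschitz, and is solved
  in both directions from \<open>\<tau>\<close>.\<close>

lemma adjoint_exists:
  assumes u: "u \<in> controls U" and x: "continuous_on {0..} x" and \<tau>: "0 \<le> \<tau>"
  obtains \<psi> where "primitive \<psi> (adj x u lam \<psi>)" "\<psi> \<tau> = \<zeta>"
proof -
  have "continuous_on {0..} (\<lambda>t. norm (x t))" using x by (intro continuous_intros)
  then obtain l where l: "bounds (\<lambda>t. norm (x t)) l" by (rule bounds_exists)
  note lD = boundsD[OF l]
  have A: "norm (fx t (x t) (u t)) \<le> l t" "norm (gx t (x t) (u t)) \<le> l t" if "0 \<le> t" for t
    by (rule lD(5,6)[OF that controlsD[OF u that] order_refl])+
  let ?F = "\<lambda>t p. - (p v* fx t (x t) (u t) + lam *\<^sub>R gx t (x t) (u t))"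
  show thesis
  proof (rule ivp_exists_lipschitz[of ?F "\<lambda>t. (1 + \<bar>lam\<bar>) * l t" \<tau> \<zeta>])
    show "(\<lambda>t. ?F t (p t)) \<in> borel_measurable (lebesgue_on {0..})" if p: "continuous_on {0..} p" for p
      by (intro borel_measurable_uminus borel_measurable_add borel_measurable_scaleR borel_measurable_vector_matrix
          continuous_on_measurable_half_line p caratheodory_measurable[OF regularity(3) u x]
          caratheodory_measurable[OF regularity(4) u x]) simp
    show "loc_int (\<lambda>t. (1 + \<bar>lam\<bar>) * l t)" using loc_int_scaleR[OF lD(1), of "1 + \<bar>lam\<bar>"] by simp
    show "0 \<le> (1 + \<bar>lam\<bar>) * l t" if "0 \<le> t" for t using lD(2)[OF that] by simp
    show "norm (?F t p - ?F t q) \<le> (1 + \<bar>lam\<bar>) * l t * norm (p - q)" if t: "0 \<le> t" for t p q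
    proof -
      have "norm (?F t p - ?F t q) = norm ((p - q) v* fx t (x t) (u t))"
        using norm_minus_commute[of "p v* fx t (x t) (u t)"] by (simp add: vector_matrix_mult_diff_distrib)
      also have "\<dots> \<le> norm (fx t (x t) (u t)) * norm (p - q)" by (rule norm_vector_matrix_le)
      also have "\<dots> \<le> (1 + \<bar>lam\<bar>) * l t * norm (p - q)"
        using A(1)[OF t] lD(2)[OF t] by (intro mult_right_mono) (auto simp: algebra_simps add_increasing2)
      finally show ?thesis .
    qed
    show "norm (?F t 0) \<le> (1 + \<bar>lam\<bar>) * l t" if t: "0 \<le> t" for t
      using mult_mono[OF _ A(2)[OF t], of "\<bar>lam\<bar>" "1 + \<bar>lam\<bar>"] by simp
    show thesis if "primitive \<psi> (\<lambda>t. ?F t (\<psi> t))" "\<psi> \<tau> = \<zeta>" for \<psi>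
      using that by (intro \<open>\<And>\<psi>. primitive \<psi> (adj x u lam \<psi>) \<Longrightarrow> \<psi> \<tau> = \<zeta> \<Longrightarrow> thesis\<close>[of \<psi>]) (auto simp: adj_def[abs_def])
  qed (use \<tau> in auto)
qed

lemma state_adjoint_solutionI:
  assumes x: "primitive x (\<lambda>t. f t (x t) (u t))" and \<psi>: "primitive \<psi> (adj x u lam \<psi>)"
  shows "state_adjoint_solution f g u x \<psi> lam"
proof -
  have \<psi>': "primitive \<psi> (\<lambda>t. - Ham_x f g (x t) t (u t) lam (\<psi> t))"
    using \<psi> primitive_cong[of "adj x u lam \<psi>" "\<lambda>t. - Ham_x f g (x t) t (u t) lam (\<psi> t)" \<psi> \<psi>] by (simp add: Ham_x_eq adj_def)
  show ?thesis unfolding state_adjoint_solution_def C_loc_def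
    using primitive_continuous[OF x] primitive_continuous[OF \<psi>]
      has_ae_derivative_iff_primitive[OF primitive_loc_int[OF x]] x
      has_ae_derivative_iff_primitive[OF primitive_loc_int[OF \<psi>']] \<psi>' by simp
qed

text \<open>The equations differ for three reasons: the states (by at most \<open>r\<close>), the
  controls (on \<open>D\<close> only) and the multipliers. One estimate serves for needles, for the
  backward continuation with \<open>D\<close> empty, and for dependence on initial values with
  \<open>D\<close> empty and \<open>r = 0\<close>.\<close>

lemma adjoint_diff:
  assumes b: "bounds \<rho> l" and u: "u \<in> controls U" and v: "v \<in> controls U"
    and D: "D \<in> lmeasurable" "\<And>t. t \<in> D \<Longrightarrow> 0 \<le> t \<and> l t \<le> \<kappa>" and \<kappa>: "0 \<le> \<kappa>"
    and off: "\<And>t. 0 \<le> t \<Longrightarrow> t \<notin> D \<Longrightarrow> v t = u t"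
    and xy: "\<And>t. t \<in> {0..T} \<Longrightarrow> norm (x t) \<le> \<rho> t" "\<And>t. t \<in> {0..T} \<Longrightarrow> norm (y t) \<le> \<rho> t"
      "\<And>t. t \<in> {0..T} \<Longrightarrow> norm (y t - x t) \<le> r" and r: "0 \<le> r"
    and \<psi>: "primitive \<psi> (adj x u lam \<psi>)" and \<phi>: "primitive \<phi> (adj y v lam' \<phi>)"
    and K: "\<And>t. t \<in> {0..T} \<Longrightarrow> norm (\<psi> t) \<le> K" and lam: "\<bar>lam\<bar> \<le> 1"
    and st: "s \<in> {0..T}" "t \<in> {0..T}"
  shows "norm (\<phi> t - \<psi> t) \<le> 2 * (norm (\<phi> s - \<psi> s) + ((K + 1) * (r * integral {0..T} l + 2 * \<kappa> * measure lebesgue D)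
     + \<bar>lam' - lam\<bar> * integral {0..T} l)) * exp (2 * integral {0..T} l)"
proof -
  note bD = boundsD[OF b]
  have K0: "0 \<le> K" using K[OF st(1)] norm_ge_zero order_trans by blast
  define d where "d = (\<lambda>t. (K + 1) * (r * l t + 2 * \<kappa> * indicator D t) + \<bar>lam' - lam\<bar> * l t)"
  have i1: "loc_int (\<lambda>t. r * l t)" "loc_int (\<lambda>t. \<bar>lam' - lam\<bar> * l t)" "loc_int (\<lambda>t. 2 * \<kappa> * indicator D t)"
    using loc_int_scaleR[OF bD(1)] loc_int_scaleR[OF indicator_half_line(1)[OF D(1)], of "2 * \<kappa>"] by auto
  have i2: "loc_int (\<lambda>t. (K + 1) * (r * l t + 2 * \<kappa> * indicator D t))"
    using loc_int_scaleR[OF loc_int_add[OF i1(1,3)], of "K + 1"] by simp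
  have di: "loc_int d" unfolding d_def using i2 i1(2) by (rule loc_int_add)
  have "norm (\<phi> t - \<psi> t) \<le> 2 * (norm (\<phi> s - \<psi> s) + integral {0..T} d) * exp (2 * integral {0..T} l)"
  proof (rule primitive_comparison[OF \<phi> \<psi> bD(1,2) di _ _ st])
    show "0 \<le> d t" if "0 \<le> t" for t unfolding d_def using bD(2)[OF that] r \<kappa> K0 by simp
    fix t assume t: "t \<in> {0..T}"
    have t0: "0 \<le> t" "v t \<in> U t" "u t \<in> U t" using t controlsD[OF u, of t] controlsD[OF v, of t] by simp_all
    let ?A = "fx t (x t) (u t)" and ?B = "fx t (y t) (v t)" and ?a = "gx t (x t) (u t)" and ?b = "gx t (y t) (v t)"
    \<comment> \<open>Bounds the change of either coefficient: by \<open>r * l t\<close> where the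
      controls agree, by twice the majorant on \<open>D\<close>.\<close>
    define e where "e = r * l t + 2 * \<kappa> * indicator D t"
    have diff: "norm (?B - ?A) \<le> e \<and> norm (?b - ?a) \<le> e"
    proof (cases "t \<in> D")
      case True
      have "norm ?A \<le> l t" "norm ?B \<le> l t" "norm ?a \<le> l t" "norm ?b \<le> l t"
        using bD(5,6) t0 xy(1,2)[OF t] by auto
      then have "norm (?B - ?A) \<le> 2 * l t" "norm (?b - ?a) \<le> 2 * l t"
        using norm_triangle_ineq4[of ?B ?A] norm_triangle_ineq4[of ?b ?a] by auto
      moreover have "0 \<le> r * l t" using r bD(2)[OF t0(1)] by simp
      ultimately show ?thesis using D(2)[OF True] True by (auto simp: e_def)
    next
      case False
      then have vu: "v t = u t" using off t by simp
      have "norm (?B - ?A) \<le> l t * norm (y t - x t)" "norm (?b - ?a) \<le> l t * norm (y t - x t)"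
        unfolding vu using bD(9,10)[OF t0(1,3) xy(2,1)[OF t]] by auto
      moreover have "l t * norm (y t - x t) \<le> l t * r" using xy(3)[OF t] bD(2)[OF t0(1)] by (intro mult_left_mono) auto
      ultimately show ?thesis using False by (auto simp: e_def mult.commute)
    qed
    \<comment> \<open>The new matrix acts on \<open>\<phi> t - \<psi> t\<close> and the change of
      matrix on \<open>\<psi> t\<close>, so an a priori bound is needed for \<open>\<psi>\<close>
      alone.\<close>
    have "adj y v lam' \<phi> t - adj x u lam \<psi> t =
       - ((\<phi> t - \<psi> t) v* ?B + \<psi> t v* (?B - ?A) + (lam' - lam) *\<^sub>R ?b + lam *\<^sub>R (?b - ?a))"
      unfolding adj_def by (simp add: vector_matrix_mult_diff_distrib vector_matrix_mult_diff_rdistrib algebra_simps)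
    then have "norm (adj y v lam' \<phi> t - adj x u lam \<psi> t) =
       norm ((\<phi> t - \<psi> t) v* ?B + \<psi> t v* (?B - ?A) + (lam' - lam) *\<^sub>R ?b + lam *\<^sub>R (?b - ?a))"
      by (simp only: norm_minus_cancel)
    also have "\<dots> \<le> norm ((\<phi> t - \<psi> t) v* ?B) + norm (\<psi> t v* (?B - ?A)) + norm ((lam' - lam) *\<^sub>R ?b) + norm (lam *\<^sub>R (?b - ?a))"
      by (intro norm_triangle_le add_mono order_refl)
    also have "\<dots> \<le> l t * norm (\<phi> t - \<psi> t) + e * K + \<bar>lam' - lam\<bar> * l t + 1 * e"
    proof (intro add_mono)
      show "norm ((\<phi> t - \<psi> t) v* ?B) \<le> l t * norm (\<phi> t - \<psi> t)"
        using norm_vector_matrix_le[of "\<phi> t - \<psi> t" ?B] bD(5)[OF t0(1,2) xy(2)[OF t]]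
        by (meson mult_right_mono norm_ge_zero order_trans)
      have "norm (\<psi> t v* (?B - ?A)) \<le> norm (?B - ?A) * norm (\<psi> t)" by (rule norm_vector_matrix_le)
      also have "\<dots> \<le> e * K" using diff K[OF t] by (intro mult_mono) (auto intro: order_trans[OF norm_ge_zero])
      finally show "norm (\<psi> t v* (?B - ?A)) \<le> e * K" .
      show "norm ((lam' - lam) *\<^sub>R ?b) \<le> \<bar>lam' - lam\<bar> * l t"
        using bD(6)[OF t0(1,2) xy(2)[OF t]] by (simp add: mult_left_mono)
      have "\<bar>lam\<bar> * norm (?b - ?a) \<le> 1 * e" using lam diff by (intro mult_mono) auto
      then show "norm (lam *\<^sub>R (?b - ?a)) \<le> 1 * e" by simp
    qed
    also have "\<dots> = l t * norm (\<phi> t - \<psi> t) + d t" by (simp add: d_def e_def algebra_simps)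
    finally show "norm (adj y v lam' \<phi> t - adj x u lam \<psi> t) \<le> l t * norm (\<phi> t - \<psi> t) + d t" .
  qed
  also have "integral {0..T} d = (K + 1) * (r * integral {0..T} l + 2 * \<kappa> * integral {0..T} (indicator D)) + \<bar>lam' - lam\<bar> * integral {0..T} l"
    unfolding d_def using i1 i2 by (simp add: integral_add loc_int_integrable integral_mult_right)
  also have "2 * (norm (\<phi> s - \<psi> s) + \<dots>) * exp (2 * integral {0..T} l) \<le> 2 * (norm (\<phi> s - \<psi> s) + ((K + 1) * (r * integral {0..T} l + 2 * \<kappa> * measure lebesgue D)
     + \<bar>lam' - lam\<bar> * integral {0..T} l)) * exp (2 * integral {0..T} l)"
    using indicator_half_line(2)[OF D(1), of T] \<kappa> K0
    by (intro mult_right_mono mult_left_mono add_mono order_refl) auto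
  finally show ?thesis .
qed

end

section \<open>The cost functional\<close>

context control_system
begin

definition cost :: "real \<Rightarrow> (real \<Rightarrow> 'u) \<Rightarrow> real" where
  "cost T u = integral {0..T} (\<lambda>t. g t (traj f u t) (u t))"

lemma loc_int_cost: assumes u: "u \<in> controls U" shows "loc_int (\<lambda>t. g t (traj f u t) (u t))"
  by (rule loc_int_g[OF u primitive_continuous[OF traj(1)[OF u]]])

text \<open>The tails of the absolute integrals are bounded uniformly in the control. This makes the
  finite-horizon costs Cauchy and turns optimality for \<open>J\<close> into optimality for
  \<open>cost T\<close> up to an error that depends on \<open>T\<close> alone.\<close>

lemma cost_J:
  obtains \<omega> where "\<omega> \<in> Omega" "\<And>u T. u \<in> controls U \<Longrightarrow> 0 \<le> T \<Longrightarrow> \<bar>J f g u - cost T u\<bar> \<le> \<omega> T"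
proof -
  obtain \<omega> where \<omega>: "\<omega> \<in> Omega" and tail: "\<And>u T. u \<in> controls U \<Longrightarrow> 0 \<le> T \<Longrightarrow>
      \<exists>I. has_improper_integral T (\<lambda>t. \<bar>g t (traj f u t) (u t)\<bar>) I \<and> I \<le> \<omega> T"
    using cg unfolding cond_g_def by blast
  have \<omega>0: "(\<omega> \<longlongrightarrow> 0) at_top" using \<omega> by (simp add: Omega_def)
  have "\<bar>J f g u - cost T u\<bar> \<le> \<omega> T" if u: "u \<in> controls U" and T: "0 \<le> T" for u T
  proof -
    define h where "h = (\<lambda>t. g t (traj f u t) (u t))"
    have h: "loc_int h" unfolding h_def by (rule loc_int_cost[OF u])
    have ha: "loc_int (\<lambda>t. \<bar>h t\<bar>)" using loc_int_norm[OF h] by simp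
    have tl: "\<bar>integral {s..S} h\<bar> \<le> \<omega> s" if s: "0 \<le> s" "s \<le> S" for s S
    proof -
      obtain I where I: "has_improper_integral s (\<lambda>t. \<bar>h t\<bar>) I" "I \<le> \<omega> s"
        using tail[OF u s(1)] unfolding h_def by blast
      have eq: "set_lebesgue_integral lebesgue {s..S'} (\<lambda>t. \<bar>h t\<bar>) = integral {s..S'} (\<lambda>t. \<bar>h t\<bar>)" for S'
        by (rule set_lebesgue_integral_eq_integral(2)[OF loc_intD[OF ha s(1)]])
      have lim: "((\<lambda>S'. integral {s..S'} (\<lambda>t. \<bar>h t\<bar>)) \<longlongrightarrow> I) at_top"
        using I(1) unfolding has_improper_integral_def eq by blast
      have "\<forall>\<^sub>F S' in at_top. integral {s..S} (\<lambda>t. \<bar>h t\<bar>) \<le> integral {s..S'} (\<lambda>t. \<bar>h t\<bar>)"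
        using eventually_ge_at_top[of S]
        by eventually_elim (use s in \<open>intro integral_subset_half_line[OF ha], auto\<close>)
      then have "integral {s..S} (\<lambda>t. \<bar>h t\<bar>) \<le> I" by (rule tendsto_lowerbound[OF lim]) simp
      moreover have "\<bar>integral {s..S} h\<bar> \<le> integral {s..S} (\<lambda>t. \<bar>h t\<bar>)"
        using integral_norm_le[OF h ha s(1), of S] by simp
      ultimately show ?thesis using I(2) by linarith
    qed
    define a where "a = (\<lambda>n::nat. integral {0..real n} h)"
    have dist: "\<bar>integral {0..S} h - integral {0..s} h\<bar> \<le> \<omega> s" if "0 \<le> s" "s \<le> S" for s S
      using tl[OF that] integral_diff_half_line[OF h that] by simp
    have "Cauchy a"
    proof (rule CauchyI)
      fix e :: real assume e: "0 < e"
      have "\<forall>\<^sub>F t in at_top. \<omega> t < e / 2" using order_tendstoD(2)[OF \<omega>0, of "e/2"] e by simp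
      then obtain N where N: "\<And>t. N \<le> t \<Longrightarrow> \<omega> t < e / 2" by (auto simp: eventually_at_top_linorder)
      define M where "M = nat \<lceil>max N 0\<rceil>"
      have M: "N \<le> real M" unfolding M_def by linarith
      show "\<exists>M. \<forall>m\<ge>M. \<forall>n\<ge>M. norm (a m - a n) < e"
      proof (intro exI allI impI)
        fix m n assume "M \<le> m" "M \<le> n"
        then have "\<bar>a m - a M\<bar> < e / 2" "\<bar>a n - a M\<bar> < e / 2"
          using dist[of "real M" "real m"] dist[of "real M" "real n"] N[OF M] unfolding a_def by auto
        then show "norm (a m - a n) < e" unfolding real_norm_def by linarith
      qed
    qed
    then obtain Jl where Jl: "a \<longlonglongrightarrow> Jl" using Cauchy_convergent convergent_def by blast
    have near: "\<bar>Jl - integral {0..S} h\<bar> \<le> \<omega> S" if S: "0 \<le> S" for S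
    proof (rule tendsto_upperbound)
      show "(\<lambda>n. \<bar>a n - integral {0..S} h\<bar>) \<longlonglongrightarrow> \<bar>Jl - integral {0..S} h\<bar>"
        using Jl by (intro tendsto_intros)
      show "\<forall>\<^sub>F n in sequentially. \<bar>a n - integral {0..S} h\<bar> \<le> \<omega> S"
        using eventually_ge_at_top[of "nat \<lceil>S\<rceil>"]
      proof eventually_elim
        case (elim n)
        then have "S \<le> real n" by linarith
        then show ?case unfolding a_def by (rule dist[OF S])
      qed
    qed simp
    have "((\<lambda>S. integral {0..S} h - Jl) \<longlongrightarrow> 0) at_top"
    proof (rule tendsto_rabs_zero_cancel, rule tendsto_sandwich[OF _ _ tendsto_const \<omega>0])
      show "\<forall>\<^sub>F S in at_top. \<bar>integral {0..S} h - Jl\<bar> \<le> \<omega> S"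
        using eventually_ge_at_top[of 0] by eventually_elim (use near in \<open>simp add: abs_minus_commute\<close>)
    qed simp
    then have "((\<lambda>S. integral {0..S} h) \<longlongrightarrow> Jl) at_top" by (simp add: LIM_zero_iff)
    moreover have eq: "set_lebesgue_integral lebesgue {0..S} h = integral {0..S} h" for S
      by (rule set_lebesgue_integral_eq_integral(2)[OF loc_intD[OF h]]) simp
    ultimately have imp: "has_improper_integral 0 h Jl"
      unfolding has_improper_integral_def eq using loc_intD[OF h] by simp
    have "J f g u = Jl" unfolding J_def improper_integral_def h_def[symmetric]
    proof (rule the_equality[of "has_improper_integral 0 h", OF imp])
      fix I assume "has_improper_integral 0 h I"
      then show "I = Jl" using imp unfolding has_improper_integral_def
        by (meson tendsto_unique trivial_limit_at_top_linorder)
    qed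
    then show ?thesis using near[OF T] by (simp add: cost_def h_def)
  qed
  with \<omega> show thesis by (rule that)
qed

text \<open>Since \<open>\<psi> T = 0\<close> and the trajectories start together, the derivative of
  \<open>\<psi> \<bullet> (y - x)\<close> has integral 0; adding it cancels the terms linear in
  \<open>y - x\<close> off \<open>D\<close>. There remain the Hamiltonian gain on \<open>D\<close>
  and an error quadratic in its measure. \<open>C\<close> depends on \<open>l\<close>,
  \<open>\<kappa>\<close> and \<open>T\<close>, but not on the controls or on
  \<open>D\<close>.\<close>

lemma cost_gain:
  assumes b: "bounds \<rho>\<^sub>0 l" and \<kappa>: "0 \<le> \<kappa>" and T: "0 \<le> T"
  obtains C where "0 \<le> C" "\<And>u v D \<psi> c. \<lbrakk>u \<in> controls U; v \<in> controls U; D \<in> lmeasurable; D \<subseteq> {0..T};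
     \<And>t. t \<in> D \<Longrightarrow> l t \<le> \<kappa>; \<And>t. 0 \<le> t \<Longrightarrow> t \<notin> D \<Longrightarrow> v t = u t;
     primitive \<psi> (adj (traj f u) u 1 \<psi>); \<psi> T = 0;
     \<And>t. t \<in> D \<Longrightarrow> c \<le> Ham f g (traj f u t) t (v t) 1 (\<psi> t) - Ham f g (traj f u t) t (u t) 1 (\<psi> t)\<rbrakk>
     \<Longrightarrow> c * measure lebesgue D - C * measure lebesgue D ^ 2 \<le> cost T v - cost T u"
proof -
  note bD = boundsD[OF b]
  define I where "I = integral {0..T} l"
  define E where "E = exp (2 * I)"
  \<comment> \<open>Gronwall bound of the adjoint function, backward from its zero at
    \<open>T\<close>.\<close>
  define K where "K = 2 * I * E"
  \<comment> \<open>The trajectories are at most \<open>\<delta> = 4 * \<kappa> * \<mu> * E\<close>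
    apart, and the error \<open>(1 + K) * (I * \<delta> ^ 2 + 2 * \<kappa> * \<delta> *
    \<mu>)\<close> is then \<open>C * \<mu> ^ 2\<close>.\<close>
  define C where "C = (1 + K) * (I * (4 * \<kappa> * E) ^ 2 + 2 * \<kappa> * (4 * \<kappa> * E))"
  have I0: "0 \<le> I" unfolding I_def by (rule integral_nonneg_half_line[OF bD(1,2)]) auto
  have E0: "0 < E" by (simp add: E_def)
  have K0: "0 \<le> K" unfolding K_def using I0 E0 by simp
  have "0 \<le> C" unfolding C_def using I0 E0 K0 \<kappa> by simp
  moreover have "c * measure lebesgue D - C * measure lebesgue D ^ 2 \<le> cost T v - cost T u"
    if u: "u \<in> controls U" and v: "v \<in> controls U" and D: "D \<in> lmeasurable" "D \<subseteq> {0..T}"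
      and lD: "\<And>t. t \<in> D \<Longrightarrow> l t \<le> \<kappa>" and off: "\<And>t. 0 \<le> t \<Longrightarrow> t \<notin> D \<Longrightarrow> v t = u t"
      and \<psi>: "primitive \<psi> (adj (traj f u) u 1 \<psi>)" "\<psi> T = 0"
      and c: "\<And>t. t \<in> D \<Longrightarrow> c \<le> Ham f g (traj f u t) t (v t) 1 (\<psi> t) - Ham f g (traj f u t) t (u t) 1 (\<psi> t)"
    for u v D \<psi> c
  proof -
    define x where "x = traj f u"
    define y where "y = traj f v"
    define \<mu> where "\<mu> = measure lebesgue D"
    define \<delta> where "\<delta> = 4 * \<kappa> * \<mu> * E"
    have \<mu>0: "0 \<le> \<mu>" by (simp add: \<mu>_def)
    have \<delta>0: "0 \<le> \<delta>" unfolding \<delta>_def using \<kappa> \<mu>0 E0 by simp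
    have xp: "primitive x (\<lambda>t. f t (x t) (u t))" "x 0 = 0" unfolding x_def using traj[OF u] by auto
    have yp: "primitive y (\<lambda>t. f t (y t) (v t))" "y 0 = 0" unfolding y_def using traj[OF v] by auto
    note \<psi>x = \<psi>(1)[folded x_def]
    have xb: "norm (x t) \<le> \<rho>\<^sub>0 t" and yb: "norm (y t) \<le> \<rho>\<^sub>0 t" if "0 \<le> t" for t
      unfolding x_def y_def using traj_bound[OF u that] traj_bound[OF v that] by auto
    have z: "norm (y t - x t) \<le> \<delta>" if "t \<in> {0..T}" for t
      unfolding \<delta>_def E_def I_def \<mu>_def x_def y_def
      by (rule traj_diff[OF b u v D(1) _ \<kappa> off that]) (use D(2) lD in auto)
    have zp: "primitive (\<lambda>t. 0::real^'m) (\<lambda>t. 0)" by (simp add: primitive_def loc_int_const)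
    have K: "norm (\<psi> t) \<le> K" if t: "t \<in> {0..T}" for t
    proof -
      have "norm (\<psi> t - 0) \<le> 2 * (norm (\<psi> T - 0) + integral {0..T} l) * exp (2 * integral {0..T} l)"
      proof (rule primitive_comparison[OF \<psi>x zp bD(1,2) bD(1,2)])
        fix t assume "t \<in> {0..T}"
        then have t: "0 \<le> t" "u t \<in> U t" "norm (x t) \<le> \<rho>\<^sub>0 t" using controlsD[OF u] xb by auto
        have "norm (adj x u 1 \<psi> t) \<le> norm (\<psi> t v* fx t (x t) (u t)) + norm (gx t (x t) (u t))"
          unfolding adj_def norm_minus_cancel using norm_triangle_ineq by (metis scaleR_one)
        also have "norm (\<psi> t v* fx t (x t) (u t)) \<le> norm (fx t (x t) (u t)) * norm (\<psi> t)" by (rule norm_vector_matrix_le)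
        also have "\<dots> \<le> l t * norm (\<psi> t)" using bD(5)[OF t] by (intro mult_right_mono) auto
        finally show "norm (adj x u 1 \<psi> t - 0) \<le> l t * norm (\<psi> t - 0) + l t" using bD(6)[OF t] by simp
      qed (use t T in auto)
      then show ?thesis using \<psi>(2) by (simp add: K_def E_def I_def)
    qed
    define q where "q = (\<lambda>t. \<psi> t \<bullet> (f t (y t) (v t) - f t (x t) (u t)) + adj x u 1 \<psi> t \<bullet> (y t - x t))"
    have zprim: "primitive (\<lambda>t. y t - x t) (\<lambda>t. f t (y t) (v t) - f t (x t) (u t))"
    proof -
      have "y t - x t = (y 0 - x 0) + integral {0..t} (\<lambda>t. f t (y t) (v t) - f t (x t) (u t))" if t: "0 \<le> t" for t
        using primitive_eq[OF yp(1) t] primitive_eq[OF xp(1) t] loc_int_integrable[OF primitive_loc_int[OF yp(1)], of 0 t]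
          loc_int_integrable[OF primitive_loc_int[OF xp(1)], of 0 t]
        by (subst Henstock_Kurzweil_Integration.integral_diff) auto
      then show ?thesis unfolding primitive_def
        using loc_int_diff[OF primitive_loc_int[OF yp(1)] primitive_loc_int[OF xp(1)]] by blast
    qed
    have qp: "primitive (\<lambda>t. \<psi> t \<bullet> (y t - x t)) q"
      unfolding q_def by (rule primitive_inner[OF \<psi>x zprim])
    have qi: "loc_int q" using qp by (rule primitive_loc_int)
    have q0: "integral {0..T} q = 0"
      using primitive_diff[OF qp order_refl T] \<psi>(2) xp(2) yp(2) by simp
    have gv: "loc_int (\<lambda>t. g t (y t) (v t))" and gu: "loc_int (\<lambda>t. g t (x t) (u t))"
      unfolding x_def y_def using loc_int_cost u v by auto
    define H where "H = (\<lambda>t. g t (y t) (v t) - g t (x t) (u t) + q t)"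
    have Hi: "loc_int H" unfolding H_def by (intro loc_int_add loc_int_diff gv gu qi)
    have "cost T v - cost T u = integral {0..T} (\<lambda>t. g t (y t) (v t)) - integral {0..T} (\<lambda>t. g t (x t) (u t)) + integral {0..T} q"
      by (simp add: cost_def x_def y_def q0)
    also have "\<dots> = integral {0..T} H"
      unfolding H_def using gv gu qi
      by (simp add: Henstock_Kurzweil_Integration.integral_add Henstock_Kurzweil_Integration.integral_diff loc_int_integrable integrable_diff)
    finally have costH: "cost T v - cost T u = integral {0..T} H" .
    \<comment> \<open>Lower bound for the integrand: the gain less first-order errors on
      \<open>D\<close>, and everywhere a deduction for the Taylor remainders.\<close>
    define lo where "lo = (\<lambda>t. (c - 2 * (1 + K) * \<kappa> * \<delta>) * indicator D t - (1 + K) * \<delta> ^ 2 * l t)"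
    have loH: "lo t \<le> H t" if t: "t \<in> {0..T}" for t
    proof -
      have t0: "0 \<le> t" "v t \<in> U t" "u t \<in> U t" "norm (x t) \<le> \<rho>\<^sub>0 t" "norm (y t) \<le> \<rho>\<^sub>0 t"
        using t controlsD[OF u, of t] controlsD[OF v, of t] xb[of t] yb[of t] by simp_all
      let ?A = "fx t (x t) (u t)" and ?a = "gx t (x t) (u t)" and ?z = "y t - x t"
      have Hz: "H t = (g t (y t) (v t) - g t (x t) (u t) - ?a \<bullet> ?z) + \<psi> t \<bullet> (f t (y t) (v t) - f t (x t) (u t) - ?A *v ?z)"
        unfolding H_def q_def adj_def
        by (simp add: inner_diff_right inner_add_left dot_lmul_matrix algebra_simps)
      have l0: "0 \<le> l t" by (rule bD(2)[OF t0(1)])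
      have z2: "norm ?z ^ 2 \<le> \<delta> ^ 2" using z[OF t] by (intro power_mono) auto
      show ?thesis
      proof (cases "t \<in> D")
        case False
        then have vu: "v t = u t" using off t0 by simp
        have "l t * norm ?z ^ 2 \<le> l t * \<delta> ^ 2" using z2 l0 by (rule mult_left_mono)
        then have 1: "\<bar>g t (y t) (u t) - g t (x t) (u t) - ?a \<bullet> ?z\<bar> \<le> l t * \<delta> ^ 2"
          and 2: "norm (f t (y t) (u t) - f t (x t) (u t) - ?A *v ?z) \<le> l t * \<delta> ^ 2"
          using taylor_g[OF b t0(1,3,4,5)] taylor_f[OF b t0(1,3,4,5)] by linarith+
        have "\<bar>\<psi> t \<bullet> (f t (y t) (u t) - f t (x t) (u t) - ?A *v ?z)\<bar> \<le> norm (\<psi> t) * norm (f t (y t) (u t) - f t (x t) (u t) - ?A *v ?z)"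
          by (rule Cauchy_Schwarz_ineq2)
        also have "\<dots> \<le> K * (l t * \<delta> ^ 2)" using K[OF t] 2 by (intro mult_mono) (auto intro: order_trans[OF norm_ge_zero])
        finally have "- (l t * \<delta> ^ 2) - K * (l t * \<delta> ^ 2) \<le> H t" using 1 unfolding Hz vu by linarith
        then show ?thesis using False by (simp add: lo_def algebra_simps)
      next
        \<comment> \<open>The controls differ here, so only size and Lipschitz bounds apply. Errors
          linear in \<open>\<delta>\<close> are affordable because they are integrated over
          \<open>D\<close> alone.\<close>
        case True
        have lk: "l t \<le> \<kappa>" by (rule lD[OF True])
        have lz: "l t * norm ?z \<le> \<kappa> * \<delta>" using lk l0 z[OF t] by (intro mult_mono) auto
        have c': "c \<le> \<psi> t \<bullet> (f t (x t) (v t) - f t (x t) (u t)) + (g t (x t) (v t) - g t (x t) (u t))"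
          using c[OF True] unfolding x_def[symmetric] Ham_def by (simp add: inner_diff_right)
        have g1: "\<bar>g t (y t) (v t) - g t (x t) (v t)\<bar> \<le> \<kappa> * \<delta>" using bD(8)[OF t0(1,2,5,4)] lz by linarith
        have f1: "norm (f t (y t) (v t) - f t (x t) (v t)) \<le> \<kappa> * \<delta>" using bD(7)[OF t0(1,2,5,4)] lz by linarith
        have "\<bar>?a \<bullet> ?z\<bar> \<le> norm ?a * norm ?z" by (rule Cauchy_Schwarz_ineq2)
        also have "\<dots> \<le> l t * norm ?z" using bD(6)[OF t0(1,3,4)] by (intro mult_right_mono) auto
        finally have g2: "\<bar>?a \<bullet> ?z\<bar> \<le> \<kappa> * \<delta>" using lz by linarith
        have "norm (?A *v ?z) \<le> norm ?A * norm ?z" by (rule norm_matrix_vector_le)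
        also have "\<dots> \<le> l t * norm ?z" using bD(5)[OF t0(1,3,4)] by (intro mult_right_mono) auto
        finally have f2: "norm (?A *v ?z) \<le> \<kappa> * \<delta>" using lz by linarith
        have "\<bar>\<psi> t \<bullet> ((f t (y t) (v t) - f t (x t) (v t)) - ?A *v ?z)\<bar> \<le> norm (\<psi> t) * norm ((f t (y t) (v t) - f t (x t) (v t)) - ?A *v ?z)"
          by (rule Cauchy_Schwarz_ineq2)
        also have "\<dots> \<le> K * (\<kappa> * \<delta> + \<kappa> * \<delta>)"
          using K0 f1 f2 norm_triangle_ineq4[of "f t (y t) (v t) - f t (x t) (v t)" "?A *v ?z"]
          by (intro mult_mono[OF K[OF t]] norm_ge_zero) linarith+
        finally have \<psi>1: "\<bar>\<psi> t \<bullet> ((f t (y t) (v t) - f t (x t) (v t)) - ?A *v ?z)\<bar> \<le> 2 * K * (\<kappa> * \<delta>)"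
          by (simp add: mult_ac)
        have "H t = (\<psi> t \<bullet> (f t (x t) (v t) - f t (x t) (u t)) + (g t (x t) (v t) - g t (x t) (u t)))
          + (g t (y t) (v t) - g t (x t) (v t)) - ?a \<bullet> ?z + \<psi> t \<bullet> ((f t (y t) (v t) - f t (x t) (v t)) - ?A *v ?z)"
          unfolding Hz by (simp add: inner_diff_right)
        then have "c - \<kappa> * \<delta> - \<kappa> * \<delta> - 2 * K * (\<kappa> * \<delta>) \<le> H t" using c' g1 g2 \<psi>1 by linarith
        moreover have "0 \<le> (1 + K) * \<delta> ^ 2 * l t" using K0 l0 by simp
        ultimately show ?thesis using True by (simp add: lo_def algebra_simps)
      qed
    qed
    have ind: "loc_int (\<lambda>t. (c - 2 * (1 + K) * \<kappa> * \<delta>) * indicator D t)" "loc_int (\<lambda>t. (1 + K) * \<delta> ^ 2 * l t)"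
      using loc_int_scaleR[OF indicator_half_line(1)[OF D(1)]] loc_int_scaleR[OF bD(1)] by auto
    have loi: "loc_int lo" unfolding lo_def using ind by (rule loc_int_diff)
    have "integral {0..T} lo = (c - 2 * (1 + K) * \<kappa> * \<delta>) * integral {0..T} (indicator D) - (1 + K) * \<delta> ^ 2 * I"
      unfolding lo_def I_def using ind
      by (simp add: Henstock_Kurzweil_Integration.integral_diff loc_int_integrable integral_mult_right)
    also have "integral {0..T} (indicator D :: real \<Rightarrow> real) = \<mu>" unfolding \<mu>_def by (rule integral_indicator_half_line[OF D])
    also have "(c - 2 * (1 + K) * \<kappa> * \<delta>) * \<mu> - (1 + K) * \<delta> ^ 2 * I = c * \<mu> - C * \<mu> ^ 2"
      by (simp add: C_def \<delta>_def power2_eq_square algebra_simps)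
    finally have "c * \<mu> - C * \<mu> ^ 2 = integral {0..T} lo" by simp
    also have "\<dots> \<le> integral {0..T} H" by (rule integral_mono_half_line[OF loi Hi _ loH]) auto
    finally show ?thesis unfolding costH \<mu>_def .
  qed
  ultimately show thesis by (rule that) (assumption | blast)+
qed

end

section \<open>Needle variations\<close>

text \<open>The measure of \<open>B \<inter> {0..s}\<close> depends continuously on
  \<open>s\<close>, so the intermediate value theorem applies.\<close>

lemma lmeasurable_subset_of_measure:
  fixes B :: "real set"
  assumes B: "B \<in> lmeasurable" "B \<subseteq> {0..T}" and \<eta>: "0 \<le> \<eta>" "\<eta> \<le> measure lebesgue B"
  obtains B' where "B' \<in> lmeasurable" "B' \<subseteq> B" "measure lebesgue B' = \<eta>"
proof (cases "0 \<le> T")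
  case False
  then have "B = {}" using B by auto
  then show thesis using \<eta> by (intro that[of "{}"]) auto
next
  case True
  define m where "m = (\<lambda>s. measure lebesgue (B \<inter> {0..s}))"
  have Bm: "B \<inter> {0..s} \<in> lmeasurable" for s using B by (intro fmeasurable_Int_fmeasurable) auto
  have step: "0 \<le> m s' - m s \<and> m s' - m s \<le> s' - s" if "0 \<le> s" "s \<le> s'" for s s'
  proof -
    have "m s \<le> m s'" unfolding m_def using that by (intro measure_mono_fmeasurable fmeasurableD Bm) auto
    moreover have "m s' \<le> measure lebesgue ((B \<inter> {0..s}) \<union> {s..s'})"
      unfolding m_def by (intro measure_mono_fmeasurable fmeasurableD Bm fmeasurable.Un) auto
    moreover have "\<dots> \<le> m s + measure lebesgue {s..s'}"
      unfolding m_def by (intro measure_Un_le fmeasurableD Bm) auto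
    ultimately show ?thesis using that by simp
  qed
  have "continuous_on {0..T} m"
  proof (rule continuous_onI)
    fix s e :: real assume s: "s \<in> {0..T}" and e: "0 < e"
    have "dist (m s') (m s) \<le> e" if "s' \<in> {0..T}" "dist s' s < e" for s'
      using step[of s s'] step[of s' s] that s by (cases "s \<le> s'") (auto simp: dist_real_def)
    then show "\<exists>d>0. \<forall>s'\<in>{0..T}. dist s' s < d \<longrightarrow> dist (m s') (m s) \<le> e" using e by blast
  qed
  moreover have "m 0 \<le> \<eta>"
  proof -
    have "m 0 \<le> measure lebesgue {0::real}" unfolding m_def by (intro measure_mono_fmeasurable fmeasurableD Bm)
      (auto intro: negligible_imp_measurable)
    then show ?thesis using \<eta> by simp
  qed
  moreover have "\<eta> \<le> m T" using \<eta> B by (simp add: m_def Int_absorb2)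
  ultimately obtain s where "0 \<le> s" "s \<le> T" "m s = \<eta>" using IVT'[of m 0 \<eta> T] True by auto
  then show thesis by (intro that[of "B \<inter> {0..s}"] Bm) (auto simp: m_def)
qed

lemma primitive_scaleR:
  fixes x :: "real \<Rightarrow> 'a::euclidean_space"
  assumes "primitive x p" shows "primitive (\<lambda>t. c *\<^sub>R x t) (\<lambda>t. c *\<^sub>R p t)"
proof -
  have "c *\<^sub>R x t = c *\<^sub>R x 0 + integral {0..t} (\<lambda>t. c *\<^sub>R p t)" if "0 \<le> t" for t
    unfolding integral_cmul using primitive_eq[OF assms that] by (metis scaleR_right_distrib)
  then show ?thesis unfolding primitive_def using loc_int_scaleR[OF primitive_loc_int[OF assms]] by blast
qed

context control_system
begin

text \<open>Homogeneity of the adjoint equation in \<open>(lam, \<psi>)\<close>; with that of the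
  Hamiltonian it permits normalising at time 0.\<close>

lemma adj_scaleR: "adj x u (c * lam) (\<lambda>t. c *\<^sub>R \<psi> t) = (\<lambda>t. c *\<^sub>R adj x u lam \<psi> t)"
  by (simp add: adj_def fun_eq_iff scaleR_vector_matrix_assoc scaleR_diff_right)

lemma Ham_scaleR: "Ham f g x t u (c * lam) (c *\<^sub>R p) = c * Ham f g x t u lam p"
  by (simp add: Ham_def algebra_simps)

lemma Ham_close:
  assumes b: "bounds \<rho> l" and t: "0 \<le> t" "p \<in> U t" "norm y \<le> \<rho> t" "norm x \<le> \<rho> t" and lk: "l t \<le> \<kappa>"
    and r: "norm (y - x) \<le> r" and K: "norm \<psi> \<le> K" and lam: "\<bar>lam\<bar> \<le> 1"
  shows "\<bar>Ham f g y t p lam' \<phi> - Ham f g x t p lam \<psi>\<bar> \<le> \<kappa> * (norm (\<phi> - \<psi>) + K * r + \<bar>lam' - lam\<bar> + r)"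
proof -
  have l0: "0 \<le> l t" "0 \<le> \<kappa>" "0 \<le> r" "0 \<le> K" using boundsD(2)[OF b t(1)] lk r K norm_ge_zero order_trans by blast+
  have "l t * norm (y - x) \<le> \<kappa> * r" using lk r l0 by (intro mult_mono) auto
  then have d: "norm (f t y p - f t x p) \<le> \<kappa> * r" "\<bar>g t y p - g t x p\<bar> \<le> \<kappa> * r"
    using boundsD(7,8)[OF b t] by linarith+
  have s: "norm (f t y p) \<le> \<kappa>" "\<bar>g t y p\<bar> \<le> \<kappa>" using boundsD(3,4)[OF b t(1,2,3)] lk by linarith+
  have eq: "Ham f g y t p lam' \<phi> - Ham f g x t p lam \<psi> = (\<phi> - \<psi>) \<bullet> f t y p + \<psi> \<bullet> (f t y p - f t x p)
     + (lam' - lam) * g t y p + lam * (g t y p - g t x p)"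
    by (simp add: Ham_def inner_diff_left inner_diff_right algebra_simps)
  have 1: "\<bar>(\<phi> - \<psi>) \<bullet> f t y p\<bar> \<le> norm (\<phi> - \<psi>) * \<kappa>"
    using Cauchy_Schwarz_ineq2[of "\<phi> - \<psi>" "f t y p"] mult_left_mono[OF s(1) norm_ge_zero[of "\<phi> - \<psi>"]] by linarith
  have 2: "\<bar>\<psi> \<bullet> (f t y p - f t x p)\<bar> \<le> K * (\<kappa> * r)"
    using Cauchy_Schwarz_ineq2[of \<psi> "f t y p - f t x p"] mult_mono[OF K d(1) l0(4) norm_ge_zero] by linarith
  have 3: "\<bar>(lam' - lam) * g t y p\<bar> \<le> \<bar>lam' - lam\<bar> * \<kappa>" using s(2) by (simp add: abs_mult mult_left_mono)
  have 4: "\<bar>lam * (g t y p - g t x p)\<bar> \<le> 1 * (\<kappa> * r)" unfolding abs_mult using lam d(2) by (intro mult_mono) auto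
  have "\<bar>Ham f g y t p lam' \<phi> - Ham f g x t p lam \<psi>\<bar> \<le> norm (\<phi> - \<psi>) * \<kappa> + K * (\<kappa> * r) + \<bar>lam' - lam\<bar> * \<kappa> + 1 * (\<kappa> * r)"
    unfolding eq using 1 2 3 4 by linarith
  then show ?thesis by (simp add: algebra_simps)
qed

end

section \<open>The optimal pair and its limiting multipliers\<close>

locale stable_optimum = control_system U f g
  for U :: "real \<Rightarrow> 'u::euclidean_space set"
    and f :: "real \<Rightarrow> real^'m \<Rightarrow> 'u \<Rightarrow> real^'m"
    and g :: "real \<Rightarrow> real^'m \<Rightarrow> 'u \<Rightarrow> real" +
  fixes x\<^sub>0 :: "real \<Rightarrow> real^'m" and u\<^sub>0 :: "real \<Rightarrow> 'u" and \<tau> :: "nat \<Rightarrow> real"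
  assumes opt: "optimal_pair U f g x\<^sub>0 u\<^sub>0"
    and stable: "\<And>\<psi> lam. state_adjoint_solution f g u\<^sub>0 x\<^sub>0 \<psi> lam \<Longrightarrow> lam \<in> {0..1} \<Longrightarrow>
           lyapunov_stable_component (UNIV \<times> UNIV \<times> {0..1}) f g u\<^sub>0 x\<^sub>0 \<psi> lam"
    and \<tau>0: "\<And>n. 0 \<le> \<tau> n" and \<tau>lim: "filterlim \<tau> at_top sequentially"
begin

lemma u\<^sub>0: "u\<^sub>0 \<in> controls U" using opt by (simp add: optimal_pair_def)

lemma x\<^sub>0_traj: "0 \<le> t \<Longrightarrow> x\<^sub>0 t = traj f u\<^sub>0 t" using opt by (simp add: optimal_pair_def)

lemma x\<^sub>0: "primitive x\<^sub>0 (\<lambda>t. f t (x\<^sub>0 t) (u\<^sub>0 t))" "x\<^sub>0 0 = 0"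
proof -
  show "primitive x\<^sub>0 (\<lambda>t. f t (x\<^sub>0 t) (u\<^sub>0 t))"
    using traj(1)[OF u\<^sub>0] by (rule primitive_cong[THEN iffD1, rotated 2]) (simp_all add: x\<^sub>0_traj)
  show "x\<^sub>0 0 = 0" using traj(2)[OF u\<^sub>0] x\<^sub>0_traj[of 0] by simp
qed

lemma x\<^sub>0_bound: "0 \<le> t \<Longrightarrow> norm (x\<^sub>0 t) \<le> \<rho>\<^sub>0 t" using traj_bound[OF u\<^sub>0] x\<^sub>0_traj by simp

text \<open>Parametrising the adjoint functions along \<open>x\<^sub>0\<close> by initial value and
  multiplier turns the search for one of them into a search in a finite-dimensional space.\<close>

definition \<Psi> :: "real^'m \<Rightarrow> real \<Rightarrow> real \<Rightarrow> real^'m" where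
  "\<Psi> \<zeta> lam = (SOME \<psi>. primitive \<psi> (adj x\<^sub>0 u\<^sub>0 lam \<psi>) \<and> \<psi> 0 = \<zeta>)"

lemma \<Psi>: "primitive (\<Psi> \<zeta> lam) (adj x\<^sub>0 u\<^sub>0 lam (\<Psi> \<zeta> lam))" "\<Psi> \<zeta> lam 0 = \<zeta>"
proof -
  have "\<exists>\<psi>. primitive \<psi> (adj x\<^sub>0 u\<^sub>0 lam \<psi>) \<and> \<psi> 0 = \<zeta>"
    using adjoint_exists[OF u\<^sub>0 primitive_continuous[OF x\<^sub>0(1)] order_refl] by metis
  then have "primitive (\<Psi> \<zeta> lam) (adj x\<^sub>0 u\<^sub>0 lam (\<Psi> \<zeta> lam)) \<and> \<Psi> \<zeta> lam 0 = \<zeta>"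
    unfolding \<Psi>_def by (rule someI_ex)
  then show "primitive (\<Psi> \<zeta> lam) (adj x\<^sub>0 u\<^sub>0 lam (\<Psi> \<zeta> lam))" "\<Psi> \<zeta> lam 0 = \<zeta>" by auto
qed

lemma \<Psi>_solution: "state_adjoint_solution f g u\<^sub>0 x\<^sub>0 (\<Psi> \<zeta> lam) lam"
  by (rule state_adjoint_solutionI[OF x\<^sub>0(1) \<Psi>(1)])

lemma \<Psi>_stable:
  assumes "lam \<in> {0..1}" "\<epsilon> > 0"
  obtains \<delta> where "\<delta> > 0" "\<And>x \<phi> lam'. state_adjoint_solution f g u\<^sub>0 x \<phi> lam' \<Longrightarrow> lam' \<in> {0..1} \<Longrightarrow>
     dist (x 0, \<phi> 0, lam') (0, \<zeta>, lam) < \<delta> \<Longrightarrow> (\<forall>s\<ge>0. norm (\<phi> s - \<Psi> \<zeta> lam s) < \<epsilon>)"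
proof -
  have "lyapunov_stable_component (UNIV \<times> UNIV \<times> {0..1}) f g u\<^sub>0 x\<^sub>0 (\<Psi> \<zeta> lam) lam"
    by (rule stable[OF \<Psi>_solution assms(1)])
  then obtain \<delta> where \<delta>: "\<delta> > 0" "\<forall>x \<phi> lam'. state_adjoint_solution f g u\<^sub>0 x \<phi> lam' \<and> (x 0, \<phi> 0, lam') \<in> UNIV \<times> UNIV \<times> {0..1} \<and>
        dist (x 0, \<phi> 0, lam') (x\<^sub>0 0, \<Psi> \<zeta> lam 0, lam) < \<delta> \<longrightarrow> (\<forall>s\<ge>0. norm (\<phi> s - \<Psi> \<zeta> lam s) < \<epsilon>)"
    unfolding lyapunov_stable_component_def using assms(2) by blast
  show thesis
  proof (rule that[OF \<delta>(1)])
    fix x :: "real \<Rightarrow> real^'m" and \<phi> lam'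
    assume "state_adjoint_solution f g u\<^sub>0 x \<phi> lam'" "lam' \<in> {0..1}" "dist (x 0, \<phi> 0, lam') (0, \<zeta>, lam) < \<delta>"
    then show "\<forall>s\<ge>0. norm (\<phi> s - \<Psi> \<zeta> lam s) < \<epsilon>" using \<delta>(2)[rule_format, of x \<phi> lam'] x\<^sub>0(2) \<Psi>(2) by simp
  qed
qed

text \<open>The last clause expresses that the lower limit along \<open>\<tau>\<close> is 0.\<close>

definition multipliers :: "((real^'m) \<times> real) set" where
  "multipliers = {(\<zeta>, lam). lam \<in> {0..1} \<and> norm \<zeta> + lam = 1 \<and>
     (\<forall>\<epsilon>>0. \<forall>N. \<exists>n\<ge>N. norm (\<Psi> \<zeta> lam (\<tau> n)) < \<epsilon>)}"

text \<open>Closedness exchanges a limit of initial values with the lower limit in time. Stability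
  makes this legitimate: nearby initial values give adjoint functions that are close at all times
  \<open>s \<ge> 0\<close>, with no loss at late horizons.\<close>

lemma compact_multipliers: "compact multipliers"
proof -
  have "bounded multipliers"
    by (rule bounded_subset[OF bounded_Times[OF bounded_cball[of 0 1] bounded_closed_interval[of 0 1]]])
       (auto simp: multipliers_def)
  moreover have "closed multipliers"
    unfolding closed_sequential_limits
  proof (intro allI impI, elim conjE)
    fix m :: "nat \<Rightarrow> (real^'m) \<times> real" and p assume m: "\<forall>k. m k \<in> multipliers" and lim: "m \<longlonglongrightarrow> p"
    obtain \<zeta> lam where p: "p = (\<zeta>, lam)" by (cases p)
    have l1: "(\<lambda>k. fst (m k)) \<longlonglongrightarrow> \<zeta>" "(\<lambda>k. snd (m k)) \<longlonglongrightarrow> lam"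
      using tendsto_fst[OF lim] tendsto_snd[OF lim] p by auto
    have mk: "snd (m k) \<in> {0..1}" "norm (fst (m k)) + snd (m k) = 1"
      "\<And>\<epsilon> N. \<epsilon> > 0 \<Longrightarrow> \<exists>n\<ge>N. norm (\<Psi> (fst (m k)) (snd (m k)) (\<tau> n)) < \<epsilon>" for k
      using m[rule_format, of k] by (auto simp: multipliers_def case_prod_unfold)
    have lam: "lam \<in> {0..1}" by (rule closed_sequentially[OF _ mk(1) l1(2)]) simp
    have "(\<lambda>k. norm (fst (m k)) + snd (m k)) \<longlonglongrightarrow> norm \<zeta> + lam" using l1 by (intro tendsto_intros)
    then have nrm: "norm \<zeta> + lam = 1" using mk(2) by (simp add: LIMSEQ_const_iff)
    have "\<exists>n\<ge>N. norm (\<Psi> \<zeta> lam (\<tau> n)) < \<epsilon>" if \<epsilon>: "\<epsilon> > 0" for \<epsilon> N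
    proof -
      have "\<epsilon> / 2 > 0" using \<epsilon> by simp
      then obtain \<delta> where \<delta>: "\<delta> > 0" "\<And>x \<phi> lam'. state_adjoint_solution f g u\<^sub>0 x \<phi> lam' \<Longrightarrow> lam' \<in> {0..1} \<Longrightarrow>
         dist (x 0, \<phi> 0, lam') (0, \<zeta>, lam) < \<delta> \<Longrightarrow> (\<forall>s\<ge>0. norm (\<phi> s - \<Psi> \<zeta> lam s) < \<epsilon> / 2)"
        using \<Psi>_stable[OF lam] by blast
      have "\<forall>\<^sub>F k in sequentially. dist (m k) p < \<delta>" using lim \<delta>(1) by (rule tendstoD)
      then obtain k where k: "dist (m k) p < \<delta>" by (auto simp: eventually_sequentially)
      let ?\<phi> = "\<Psi> (fst (m k)) (snd (m k))"
      have "dist (x\<^sub>0 0, ?\<phi> 0, snd (m k)) (0, \<zeta>, lam) = dist (m k) p"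
        using p x\<^sub>0(2) \<Psi>(2) by (simp add: dist_prod_def prod_eq_iff case_prod_unfold)
      then have close: "norm (?\<phi> s - \<Psi> \<zeta> lam s) < \<epsilon> / 2" if "0 \<le> s" for s
        using \<delta>(2)[OF \<Psi>_solution mk(1)[of k]] k that by simp
      obtain n where n: "n \<ge> N" "norm (?\<phi> (\<tau> n)) < \<epsilon> / 2" using mk(3)[of "\<epsilon>/2" N k] \<epsilon> by auto
      have "norm (\<Psi> \<zeta> lam (\<tau> n)) \<le> norm (?\<phi> (\<tau> n)) + norm (?\<phi> (\<tau> n) - \<Psi> \<zeta> lam (\<tau> n))"
        using norm_triangle_sub[of "\<Psi> \<zeta> lam (\<tau> n)" "?\<phi> (\<tau> n)"] by (simp add: norm_minus_commute)
      also have "\<dots> < \<epsilon>" using n(2) close[OF \<tau>0[of n]] by linarith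
      finally show ?thesis using n(1) by blast
    qed
    then show "p \<in> multipliers" using lam nrm by (auto simp: multipliers_def p)
  qed
  ultimately show ?thesis by (simp add: compact_eq_bounded_closed)
qed

section \<open>Needle variations with a quadratic penalty\<close>

definition needle :: "(real \<Rightarrow> 'u) \<Rightarrow> real set \<Rightarrow> real \<Rightarrow> 'u" where
  "needle w E t = (if t \<in> E then w t else u\<^sub>0 t)"

lemma needle: "w \<in> controls U \<Longrightarrow> E \<in> sets lebesgue \<Longrightarrow> needle w E \<in> controls U"
  using controls_if[OF u\<^sub>0, of w E] by (simp add: needle_def[abs_def])

lemma needle_empty: "needle w {} = u\<^sub>0" by (simp add: needle_def fun_eq_iff)

text \<open>An almost maximiser of \<open>cost \<sigma> (needle w E) - (measure E)\<^sup>2\<close> over the measurable \<open>E \<subseteq> A\<close> cannot be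
  improved at first order by enlarging \<open>E\<close>. Only almost: no maximum has to exist, since the error of the
  first-order expansion is quadratic with a constant independent of \<open>E\<close>.\<close>

lemma almost_optimal_needle:
  assumes b: "bounds \<rho>\<^sub>0 l" and \<kappa>: "0 \<le> \<kappa>" and w: "w \<in> controls U"
    and A: "A \<in> lmeasurable" "A \<subseteq> {0..\<sigma>}" "\<And>t. t \<in> A \<Longrightarrow> l t \<le> \<kappa>" and \<sigma>: "0 \<le> \<sigma>" and e: "0 < e" "e \<le> 1"
    and \<omega>: "\<And>u. u \<in> controls U \<Longrightarrow> \<bar>J f g u - cost \<sigma> u\<bar> \<le> \<omega>"
  obtains E \<psi> lam where "E \<in> lmeasurable" "E \<subseteq> A" "measure lebesgue E ^ 2 \<le> 2 * \<omega> + e"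
    "primitive \<psi> (adj (traj f (needle w E)) (needle w E) lam \<psi>)" "\<psi> \<sigma> = 0" "lam \<in> {0..1}" "norm (\<psi> 0) + lam = 1"
    "\<And>B c. B \<in> lmeasurable \<Longrightarrow> B \<subseteq> A - E \<Longrightarrow> e \<le> measure lebesgue B \<Longrightarrow> 0 \<le> c \<Longrightarrow>
      (\<And>t. t \<in> B \<Longrightarrow> c \<le> Ham f g (traj f (needle w E) t) t (w t) lam (\<psi> t) - Ham f g (traj f (needle w E) t) t (u\<^sub>0 t) lam (\<psi> t)) \<Longrightarrow>
      c \<le> 2 * e + 2 * measure lebesgue E"
proof -
  let ?\<mu> = "measure lebesgue"
  obtain C where C: "0 \<le> C" and gain: "\<And>u v D \<psi> c. \<lbrakk>u \<in> controls U; v \<in> controls U; D \<in> lmeasurable; D \<subseteq> {0..\<sigma>};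
     \<And>t. t \<in> D \<Longrightarrow> l t \<le> \<kappa>; \<And>t. 0 \<le> t \<Longrightarrow> t \<notin> D \<Longrightarrow> v t = u t;
     primitive \<psi> (adj (traj f u) u 1 \<psi>); \<psi> \<sigma> = 0;
     \<And>t. t \<in> D \<Longrightarrow> c \<le> Ham f g (traj f u t) t (v t) 1 (\<psi> t) - Ham f g (traj f u t) t (u t) 1 (\<psi> t)\<rbrakk>
     \<Longrightarrow> c * ?\<mu> D - C * ?\<mu> D ^ 2 \<le> cost \<sigma> v - cost \<sigma> u"
    using cost_gain[OF b \<kappa> \<sigma>] by blast
  \<comment> \<open>The size of a test needle. \<open>C\<close> may grow with the horizon; this
    choice makes the quadratic error and the quadratic penalty, which are \<open>C * \<eta>\<close>
    and \<open>\<eta>\<close> per unit of needle size, add up to \<open>e\<close>.\<close>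
  define \<eta> where "\<eta> = e / (C + 1)"
  have \<eta>: "0 < \<eta>" "(C + 1) * \<eta> = e" "\<eta> \<le> e"
    using C e by (auto simp: \<eta>_def field_simps)
  define val where "val = (\<lambda>E. cost \<sigma> (needle w E) - ?\<mu> E ^ 2)"
  define S where "S = val ` {E \<in> lmeasurable. E \<subseteq> A}"
  \<comment> \<open>\<open>J\<close> is maximal at \<open>u\<^sub>0\<close>, and exchanging
    \<open>J\<close> for \<open>cost \<sigma>\<close> costs \<open>\<omega>\<close> on either
    side.\<close>
  have costle: "cost \<sigma> (needle w E) \<le> cost \<sigma> u\<^sub>0 + 2 * \<omega>" if "E \<in> lmeasurable" for E
  proof -
    have n: "needle w E \<in> controls U" using that by (intro needle w) auto
    have "J f g (needle w E) \<le> J f g u\<^sub>0" using opt n by (simp add: optimal_pair_def)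
    then show ?thesis using \<omega>[OF n] \<omega>[OF u\<^sub>0] by linarith
  qed
  have bdd: "bdd_above S"
  proof (rule bdd_aboveI)
    fix s assume "s \<in> S"
    then obtain E where "s = val E" "E \<in> lmeasurable" by (auto simp: S_def)
    then show "s \<le> cost \<sigma> u\<^sub>0 + 2 * \<omega>"
      using costle[of E] zero_le_power2[of "?\<mu> E"] unfolding val_def by linarith
  qed
  have "S \<noteq> {}" unfolding S_def by auto
  \<comment> \<open>The slack \<open>\<eta> * e\<close> is small relative to the needle size
    \<open>\<eta>\<close>: division by \<open>\<eta>\<close> leaves only \<open>e\<close>.\<close>
  then have "\<exists>s\<in>S. Sup S - \<eta> * e < s" using bdd \<eta>(1) e by (subst less_cSup_iff[symmetric]) auto
  then obtain E where E: "E \<in> lmeasurable" "E \<subseteq> A" "Sup S - \<eta> * e < val E" by (auto simp: S_def)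
  have best: "val E' \<le> val E + \<eta> * e" if "E' \<in> lmeasurable" "E' \<subseteq> A" for E'
    using cSup_upper[OF _ bdd, of "val E'"] that E(3) by (auto simp: S_def)
  have \<eta>e: "\<eta> * e \<le> e" using \<eta>(1,3) e by (simp add: mult_left_le_one_le)
  \<comment> \<open>Comparison with the empty needle set.\<close>
  have E2: "?\<mu> E ^ 2 \<le> 2 * \<omega> + e"
    using best[of "{}"] costle[OF E(1)] \<eta>e by (auto simp: val_def needle_empty)
  let ?u = "needle w E"
  have u: "?u \<in> controls U" using E by (intro needle w) auto
  obtain \<phi> where \<phi>: "primitive \<phi> (adj (traj f ?u) ?u 1 \<phi>)" "\<phi> \<sigma> = 0"
    using adjoint_exists[OF u primitive_continuous[OF traj(1)[OF u]] \<sigma>] by metis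
  \<comment> \<open>Scaling by \<open>1 / N\<close> turns the multiplier 1 into \<open>1 / N\<close>
    and the total \<open>norm (\<phi> 0) + 1\<close> into 1.\<close>
  define N where "N = 1 + norm (\<phi> 0)"
  have N: "1 \<le> N" by (simp add: N_def)
  define \<psi> where "\<psi> = (\<lambda>t. (1 / N) *\<^sub>R \<phi> t)"
  have \<psi>1: "primitive \<psi> (adj (traj f ?u) ?u (1 / N) \<psi>)"
    using primitive_scaleR[OF \<phi>(1), of "1/N"] adj_scaleR[of "traj f ?u" ?u "1/N" 1 \<phi>] by (simp add: \<psi>_def)
  have \<psi>2: "norm (\<psi> 0) + 1 / N = 1"
    using N by (simp add: \<psi>_def field_simps) (simp add: N_def)
  show thesis
  proof (rule that[OF E(1,2) E2 \<psi>1 _ _ \<psi>2])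
    show "\<psi> \<sigma> = 0" using \<phi>(2) by (simp add: \<psi>_def)
    show "1 / N \<in> {0..1}" using N by simp
    fix B c assume B: "B \<in> lmeasurable" "B \<subseteq> A - E" "e \<le> ?\<mu> B" and c: "0 \<le> c"
      and cB: "\<And>t. t \<in> B \<Longrightarrow> c \<le> Ham f g (traj f ?u t) t (w t) (1 / N) (\<psi> t) - Ham f g (traj f ?u t) t (u\<^sub>0 t) (1 / N) (\<psi> t)"
    obtain D where D: "D \<in> lmeasurable" "D \<subseteq> B" "?\<mu> D = \<eta>"
      using lmeasurable_subset_of_measure[OF B(1), of \<sigma> \<eta>] B(2,3) A(2) \<eta> by (metis Diff_subset less_imp_le order_trans)
    have dis: "D \<inter> E = {}" and DA: "D \<subseteq> A" using D(2) B(2) by auto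
    let ?v = "needle w (E \<union> D)"
    have v: "?v \<in> controls U" using E D by (intro needle w) auto
    have "c * ?\<mu> D - C * ?\<mu> D ^ 2 \<le> cost \<sigma> ?v - cost \<sigma> ?u"
    proof (rule gain[OF u v D(1) _ _ _ \<phi>])
      show "D \<subseteq> {0..\<sigma>}" using DA A(2) by auto
      show "l t \<le> \<kappa>" if "t \<in> D" for t using that DA A(3) by auto
      show "?v t = ?u t" if "t \<notin> D" for t using that by (simp add: needle_def)
      fix t assume t: "t \<in> D"
      then have "c \<le> Ham f g (traj f ?u t) t (w t) (1 / N) (\<psi> t) - Ham f g (traj f ?u t) t (u\<^sub>0 t) (1 / N) (\<psi> t)"
        using cB D(2) by auto
      also have "\<dots> = (1 / N) * (Ham f g (traj f ?u t) t (w t) 1 (\<phi> t) - Ham f g (traj f ?u t) t (u\<^sub>0 t) 1 (\<phi> t))"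
        using Ham_scaleR[of _ t _ "1/N" 1 "\<phi> t"] by (simp add: \<psi>_def right_diff_distrib)
      finally have "c * N \<le> Ham f g (traj f ?u t) t (w t) 1 (\<phi> t) - Ham f g (traj f ?u t) t (u\<^sub>0 t) 1 (\<phi> t)"
        using N by (simp add: field_simps)
      \<comment> \<open>As \<open>N \<ge> 1\<close> and \<open>c \<ge> 0\<close>, undoing the
        normalisation does not reduce the gain below \<open>c\<close>.\<close>
      moreover have "c \<le> c * N" using c N by (simp add: mult_left_mono[of 1 N c, simplified])
      moreover have "?v t = w t" "?u t = u\<^sub>0 t" using t dis by (auto simp: needle_def)
      ultimately show "c \<le> Ham f g (traj f ?u t) t (?v t) 1 (\<phi> t) - Ham f g (traj f ?u t) t (?u t) 1 (\<phi> t)" by simp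
    qed
    moreover have "cost \<sigma> ?v - ?\<mu> (E \<union> D) ^ 2 \<le> cost \<sigma> ?u - ?\<mu> E ^ 2 + \<eta> * e"
      using best[of "E \<union> D"] E D DA unfolding val_def by auto
    moreover have "?\<mu> (E \<union> D) = ?\<mu> E + \<eta>"
      using measure_Un3[OF E(1) D(1)] dis D(3) by (simp add: Int_commute)
    ultimately have "c * \<eta> - C * \<eta> ^ 2 \<le> (?\<mu> E + \<eta>) ^ 2 - ?\<mu> E ^ 2 + \<eta> * e" using D(3) by simp
    \<comment> \<open>Division by \<open>\<eta>\<close> leaves
      \<open>(C + 1) * \<eta> + e = 2 * e\<close> and the marginal penalty, twice the measure of
      \<open>E\<close>.\<close>
    then have "\<eta> * c \<le> \<eta> * ((C + 1) * \<eta> + 2 * ?\<mu> E + e)" by (simp add: power2_eq_square algebra_simps)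
    then show "c \<le> 2 * e + 2 * ?\<mu> E" using \<eta>(1,2) by simp
  qed
qed

end

context stable_optimum
begin

text \<open>The solution of the needle system is pulled back along the \<open>u\<^sub>0\<close>-system: on \<open>{\<Theta>..}\<close> the two
  systems coincide, so the spliced solution still vanishes at the horizon \<open>\<sigma>\<close>.\<close>

lemma pull_back:
  assumes \<Theta>: "0 \<le> \<Theta>" "\<Theta> < \<sigma>" and E: "E \<subseteq> {0..\<Theta>}" and w: "needle w E \<in> controls U"
    and x: "primitive x (\<lambda>t. f t (x t) (needle w E t))" and \<psi>: "primitive \<psi> (adj x (needle w E) lam \<psi>)" "\<psi> \<sigma> = 0"
    and xb: "primitive xb (\<lambda>t. f t (xb t) (u\<^sub>0 t))" "xb \<Theta> = x \<Theta>"
    and \<psi>b: "primitive \<psi>b (adj xb u\<^sub>0 lam \<psi>b)" "\<psi>b \<Theta> = \<psi> \<Theta>"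
  obtains xh \<psi>h where "state_adjoint_solution f g u\<^sub>0 xh \<psi>h lam" "xh 0 = xb 0" "\<psi>h 0 = \<psi>b 0" "\<psi>h \<sigma> = 0"
proof -
  define xh where "xh = (\<lambda>t. if t \<le> \<Theta> then xb t else x t)"
  define \<psi>h where "\<psi>h = (\<lambda>t. if t \<le> \<Theta> then \<psi>b t else \<psi> t)"
  have off: "needle w E t = u\<^sub>0 t" if "\<not> t \<le> \<Theta>" for t using that E by (auto simp: needle_def)
  have "primitive xh (\<lambda>t. if t \<le> \<Theta> then f t (xb t) (u\<^sub>0 t) else f t (x t) (needle w E t))"
    unfolding xh_def by (rule primitive_splice[OF xb(1) x \<Theta>(1) xb(2)])
  then have xh: "primitive xh (\<lambda>t. f t (xh t) (u\<^sub>0 t))"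
    by (rule primitive_cong[THEN iffD1, rotated 2]) (simp_all add: xh_def off)
  have "primitive \<psi>h (\<lambda>t. if t \<le> \<Theta> then adj xb u\<^sub>0 lam \<psi>b t else adj x (needle w E) lam \<psi> t)"
    unfolding \<psi>h_def by (rule primitive_splice[OF \<psi>b(1) \<psi>(1) \<Theta>(1) \<psi>b(2)])
  then have \<psi>h: "primitive \<psi>h (adj xh u\<^sub>0 lam \<psi>h)"
    by (rule primitive_cong[THEN iffD1, rotated 2]) (simp_all add: xh_def \<psi>h_def off adj_def)
  then show thesis using \<Theta> \<psi>(2)
    by (intro that[OF state_adjoint_solutionI[OF xh \<psi>h]]) (auto simp: xh_def \<psi>h_def)
qed

text \<open>On \<open>{0..\<Theta>}\<close> the modified states and adjoint functions converge
  uniformly along a subsequence, which carries the Hamiltonian inequality to the limit. Membership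
  in \<open>multipliers\<close> concerns the unbounded horizons, where no such convergence is
  available; it comes from stability.\<close>

lemma needle_multiplier:
  assumes b: "bounds \<rho>\<^sub>0 l" and \<kappa>: "0 \<le> \<kappa>" and w: "w \<in> controls U" and \<Theta>: "0 \<le> \<Theta>"
    and A: "A \<in> lmeasurable" "A \<subseteq> {0..\<Theta>}" "\<And>t. t \<in> A \<Longrightarrow> l t \<le> \<kappa>"
  obtains \<zeta> lam where "(\<zeta>, lam) \<in> multipliers"
    "\<And>B \<epsilon>. B \<in> lmeasurable \<Longrightarrow> B \<subseteq> A \<Longrightarrow> 0 < measure lebesgue B \<Longrightarrow> 0 < \<epsilon> \<Longrightarrow>
      \<exists>t\<in>B. Ham f g (x\<^sub>0 t) t (w t) lam (\<Psi> \<zeta> lam t) - Ham f g (x\<^sub>0 t) t (u\<^sub>0 t) lam (\<Psi> \<zeta> lam t) < \<epsilon>"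
proof -
  obtain \<omega> where \<omega>: "\<omega> \<in> Omega" "\<And>u T. u \<in> controls U \<Longrightarrow> 0 \<le> T \<Longrightarrow> \<bar>J f g u - cost T u\<bar> \<le> \<omega> T"
    using cost_J by blast
  have "\<forall>\<^sub>F n in sequentially. \<Theta> < \<tau> n" using \<tau>lim by (simp add: filterlim_at_top_dense)
  then obtain n0 where n0: "\<And>n. n0 \<le> n \<Longrightarrow> \<Theta> < \<tau> n" by (auto simp: eventually_sequentially)
  \<comment> \<open>Needles lie in \<open>{0..\<Theta>}\<close>, so the first horizons are discarded
    to have all others beyond \<open>\<Theta>\<close>; the shift by \<open>n0\<close> returns when a
    late index of \<open>\<tau>\<close> is exhibited.\<close>
  define \<sigma> where "\<sigma> = (\<lambda>n. \<tau> (n + n0))"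
  have \<sigma>: "\<Theta> < \<sigma> n" "0 \<le> \<sigma> n" for n using n0[of "n + n0"] \<tau>0 by (auto simp: \<sigma>_def)
  have \<sigma>lim: "filterlim \<sigma> at_top sequentially"
    unfolding \<sigma>_def by (rule filterlim_compose[OF \<tau>lim filterlim_add_const_nat_at_top])
  define e where "e = (\<lambda>n. 1 / (real n + 1))"
  have e: "0 < e n" "e n \<le> 1" for n by (auto simp: e_def)
  have elim0: "e \<longlonglongrightarrow> 0" unfolding e_def using LIMSEQ_inverse_real_of_nat by (simp add: inverse_eq_divide add.commute)
  define Q where "Q = (\<lambda>n (E, \<psi>, lam). E \<in> lmeasurable \<and> E \<subseteq> A \<and> measure lebesgue E ^ 2 \<le> 2 * \<omega> (\<sigma> n) + e n \<and>
    primitive \<psi> (adj (traj f (needle w E)) (needle w E) lam \<psi>) \<and> \<psi> (\<sigma> n) = 0 \<and> lam \<in> {0..1} \<and> norm (\<psi> 0) + lam = 1 \<and>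
    (\<forall>B c. B \<in> lmeasurable \<longrightarrow> B \<subseteq> A - E \<longrightarrow> e n \<le> measure lebesgue B \<longrightarrow> 0 \<le> c \<longrightarrow>
      (\<forall>t\<in>B. c \<le> Ham f g (traj f (needle w E) t) t (w t) lam (\<psi> t) - Ham f g (traj f (needle w E) t) t (u\<^sub>0 t) lam (\<psi> t)) \<longrightarrow>
      c \<le> 2 * e n + 2 * measure lebesgue E))"
  have "\<exists>z. Q n z" for n
  proof -
    have "A \<subseteq> {0..\<sigma> n}" using A(2) \<sigma>(1)[of n] by auto
    from almost_optimal_needle[OF b \<kappa> w A(1) this A(3) \<sigma>(2) e \<omega>(2)[OF _ \<sigma>(2)]]
    obtain E \<psi> lam where "E \<in> lmeasurable" "E \<subseteq> A" "measure lebesgue E ^ 2 \<le> 2 * \<omega> (\<sigma> n) + e n"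
      "primitive \<psi> (adj (traj f (needle w E)) (needle w E) lam \<psi>)" "\<psi> (\<sigma> n) = 0" "lam \<in> {0..1}" "norm (\<psi> 0) + lam = 1"
      "\<And>B c. B \<in> lmeasurable \<Longrightarrow> B \<subseteq> A - E \<Longrightarrow> e n \<le> measure lebesgue B \<Longrightarrow> 0 \<le> c \<Longrightarrow>
      (\<And>t. t \<in> B \<Longrightarrow> c \<le> Ham f g (traj f (needle w E) t) t (w t) lam (\<psi> t) - Ham f g (traj f (needle w E) t) t (u\<^sub>0 t) lam (\<psi> t)) \<Longrightarrow>
      c \<le> 2 * e n + 2 * measure lebesgue E" by metis
    then have "Q n (E, \<psi>, lam)" unfolding Q_def by simp
    then show ?thesis by blast
  qed
  then obtain Z where Z: "\<And>n. Q n (Z n)" by metis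
  define E where "E = (\<lambda>n. fst (Z n))"
  define \<psi> where "\<psi> = (\<lambda>n. fst (snd (Z n)))"
  define la where "la = (\<lambda>n. snd (snd (Z n)))"
  have "Q n (E n, \<psi> n, la n)" for n using Z[of n] by (simp add: E_def \<psi>_def la_def)
  then have E: "E n \<in> lmeasurable" "E n \<subseteq> A" and E2: "measure lebesgue (E n) ^ 2 \<le> 2 * \<omega> (\<sigma> n) + e n"
    and \<psi>: "primitive (\<psi> n) (adj (traj f (needle w (E n))) (needle w (E n)) (la n) (\<psi> n))" "\<psi> n (\<sigma> n) = 0"
    and la: "la n \<in> {0..1}" "norm (\<psi> n 0) + la n = 1"
    and ineq: "\<And>B c. B \<in> lmeasurable \<Longrightarrow> B \<subseteq> A - E n \<Longrightarrow> e n \<le> measure lebesgue B \<Longrightarrow> 0 \<le> c \<Longrightarrow>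
      \<forall>t\<in>B. c \<le> Ham f g (traj f (needle w (E n)) t) t (w t) (la n) (\<psi> n t) - Ham f g (traj f (needle w (E n)) t) t (u\<^sub>0 t) (la n) (\<psi> n t) \<Longrightarrow>
      c \<le> 2 * e n + 2 * measure lebesgue (E n)" for n
    unfolding Q_def by blast+
  define \<mu> where "\<mu> = (\<lambda>n. measure lebesgue (E n))"
  have \<mu>0: "0 \<le> \<mu> n" for n by (simp add: \<mu>_def)
  have \<omega>\<sigma>: "(\<lambda>n. \<omega> (\<sigma> n)) \<longlonglongrightarrow> 0" using \<omega>(1) filterlim_compose[OF _ \<sigma>lim] by (auto simp: Omega_def)
  have "(\<lambda>n. sqrt (2 * \<omega> (\<sigma> n) + e n)) \<longlonglongrightarrow> sqrt (2 * 0 + 0)" by (intro tendsto_intros \<omega>\<sigma> elim0)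
  then have "(\<lambda>n. sqrt (2 * \<omega> (\<sigma> n) + e n)) \<longlonglongrightarrow> 0" by simp
  then have \<mu>lim: "\<mu> \<longlonglongrightarrow> 0"
    by (rule tendsto_sandwich[OF _ _ tendsto_const, rotated 2])
       (auto simp: \<mu>_def intro!: always_eventually real_le_rsqrt E2)
  define xn where "xn = (\<lambda>n. traj f (needle w (E n)))"
  have un: "needle w (E n) \<in> controls U" for n using E(1) by (intro needle w) auto
  have offE: "needle w (E n) t = u\<^sub>0 t" if "t \<notin> E n" for n t using that by (simp add: needle_def)
  have ED: "0 \<le> t \<and> l t \<le> \<kappa>" if "t \<in> E n" for n t
  proof -
    have "t \<in> A" using that E(2) by blast
    then show ?thesis using subsetD[OF A(2)] A(3) by auto
  qed
  define I where "I = integral {0..\<Theta>} l"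
  have I0: "0 \<le> I" unfolding I_def by (rule integral_nonneg_half_line[OF boundsD(1,2)[OF b]]) auto
  define rn where "rn = (\<lambda>n. 4 * \<kappa> * \<mu> n * exp (2 * I))"
  have rn0: "0 \<le> rn n" for n using \<kappa> \<mu>0 by (simp add: rn_def)
  have X: "norm (xn n t - x\<^sub>0 t) \<le> rn n" if t: "t \<in> {0..\<Theta>}" for n t
    using traj_diff[OF b u\<^sub>0 un E(1) ED \<kappa> offE t, of n] t x\<^sub>0_traj[of t]
    by (simp add: xn_def rn_def \<mu>_def I_def)
  have \<psi>x: "primitive (\<psi> n) (adj (xn n) (needle w (E n)) (la n) (\<psi> n))" for n
    unfolding xn_def by (rule \<psi>(1))
  have xnb: "norm (xn n t) \<le> \<rho>\<^sub>0 t" if "0 \<le> t" for n t unfolding xn_def by (rule traj_bound[OF un that])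
  have comp: "compact (cball (0::real^'m) 1 \<times> {0..1::real})" by (intro compact_Times) auto
  have mem: "(\<psi> n 0, la n) \<in> cball 0 1 \<times> {0..1}" for n using la[of n] by simp
  obtain p r where p: "p \<in> cball (0::real^'m) 1 \<times> {0..1::real}" and r: "strict_mono r"
    and lim: "((\<lambda>n. (\<psi> n 0, la n)) \<circ> r) \<longlonglongrightarrow> p"
    by (rule seq_compactE[OF compact_imp_seq_compact[OF comp], of "\<lambda>n. (\<psi> n 0, la n)", OF allI, OF mem])
  obtain \<zeta> lam where p_eq: "p = (\<zeta>, lam)" by (cases p)
  have lam: "lam \<in> {0..1}" using p p_eq by simp
  then have lam1: "\<bar>lam\<bar> \<le> 1" by simp
  have l\<zeta>: "(\<lambda>k. \<psi> (r k) 0) \<longlonglongrightarrow> \<zeta>" and llam: "(\<lambda>k. la (r k)) \<longlonglongrightarrow> lam"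
    using tendsto_fst[OF lim] tendsto_snd[OF lim] by (simp_all add: p_eq o_def)
  have sub: "(\<lambda>k. s (r k)) \<longlonglongrightarrow> 0" if "s \<longlonglongrightarrow> 0" for s :: "nat \<Rightarrow> real"
    using LIMSEQ_subseq_LIMSEQ[OF that r] by (simp add: o_def)
  have l1: "(\<lambda>k. norm (\<psi> (r k) 0 - \<zeta>)) \<longlonglongrightarrow> 0" using l\<zeta> by (simp add: LIM_zero tendsto_norm_zero)
  have l2: "(\<lambda>k. \<bar>la (r k) - lam\<bar>) \<longlonglongrightarrow> 0" using llam by (simp add: LIM_zero tendsto_rabs_zero)
  have l\<mu>: "(\<lambda>k. \<mu> (r k)) \<longlonglongrightarrow> 0" by (rule sub[OF \<mu>lim])
  have "(\<lambda>k. rn (r k)) \<longlonglongrightarrow> 4 * \<kappa> * 0 * exp (2 * I)" unfolding rn_def by (intro tendsto_intros l\<mu>)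
  then have lr: "(\<lambda>k. rn (r k)) \<longlonglongrightarrow> 0" by simp
  have "continuous_on {0..\<Theta>} (\<Psi> \<zeta> lam)"
    using primitive_continuous[OF \<Psi>(1)] by (rule continuous_on_subset) auto
  then obtain K where K: "0 \<le> K" "\<And>t. t \<in> {0..\<Theta>} \<Longrightarrow> norm (\<Psi> \<zeta> lam t) \<le> K" by (metis continuous_bound)
  \<comment> \<open>The bound of \<open>adjoint_diff\<close> on \<open>{0..\<Theta>}\<close> between
    the modified adjoint functions and \<open>\<Psi> \<zeta> lam\<close>; each of its terms tends to
    0 along \<open>r\<close>.\<close>
  define d where "d = (\<lambda>n. 2 * (norm (\<psi> n 0 - \<zeta>) + ((K + 1) * (rn n * I + 2 * \<kappa> * \<mu> n) + \<bar>la n - lam\<bar> * I)) * exp (2 * I))"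
  have "(\<lambda>k. d (r k)) \<longlonglongrightarrow> 2 * (0 + ((K + 1) * (0 * I + 2 * \<kappa> * 0) + 0 * I)) * exp (2 * I)"
    unfolding d_def by (intro tendsto_intros l1 l2 l\<mu> lr)
  then have ld: "(\<lambda>k. d (r k)) \<longlonglongrightarrow> 0" by simp
  have P: "norm (\<psi> n t - \<Psi> \<zeta> lam t) \<le> d n" if t: "t \<in> {0..\<Theta>}" for n t
  proof -
    have s0: "0 \<in> {0..\<Theta>}" using \<Theta> by simp
    have "norm (\<psi> n t - \<Psi> \<zeta> lam t) \<le> 2 * (norm (\<psi> n 0 - \<Psi> \<zeta> lam 0) + ((K + 1) * (rn n * integral {0..\<Theta>} l + 2 * \<kappa> * measure lebesgue (E n))
     + \<bar>la n - lam\<bar> * integral {0..\<Theta>} l)) * exp (2 * integral {0..\<Theta>} l)"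
    proof (rule adjoint_diff[OF b u\<^sub>0 un E(1) ED \<kappa> offE _ _ X rn0 \<Psi>(1) \<psi>x K(2) lam1 s0 t])
      show "norm (x\<^sub>0 t) \<le> \<rho>\<^sub>0 t" if "t \<in> {0..\<Theta>}" for t using x\<^sub>0_bound that by simp
      show "norm (xn n t) \<le> \<rho>\<^sub>0 t" if "t \<in> {0..\<Theta>}" for t using xnb that by simp
    qed
    then show ?thesis by (simp add: d_def I_def \<mu>_def \<Psi>(2))
  qed
  have mult: "(\<zeta>, lam) \<in> multipliers"
  proof -
    have "(\<lambda>k. norm (\<psi> (r k) 0) + la (r k)) \<longlonglongrightarrow> norm \<zeta> + lam" by (intro tendsto_intros l\<zeta> llam)
    then have nrm: "norm \<zeta> + lam = 1" using la(2) by (simp add: LIMSEQ_const_iff)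
    have "\<exists>n\<ge>N. norm (\<Psi> \<zeta> lam (\<tau> n)) < \<epsilon>" if \<epsilon>: "0 < \<epsilon>" for \<epsilon> N
    proof -
      obtain \<delta> where \<delta>: "\<delta> > 0" "\<And>x \<phi> lam'. state_adjoint_solution f g u\<^sub>0 x \<phi> lam' \<Longrightarrow> lam' \<in> {0..1} \<Longrightarrow>
         dist (x 0, \<phi> 0, lam') (0, \<zeta>, lam) < \<delta> \<Longrightarrow> (\<forall>s\<ge>0. norm (\<phi> s - \<Psi> \<zeta> lam s) < \<epsilon>)"
        using \<Psi>_stable[OF lam \<epsilon>] by blast
      define G where "G = integral {0..\<Theta>} growth"
      \<comment> \<open>The backward continuation \<open>xb\<close> starts at
        \<open>\<Theta>\<close> within \<open>\<rho>\<^sub>0 \<Theta>\<close> but need not vanish at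
        0, so it may leave the tube of radius \<open>\<rho>\<^sub>0\<close>. \<open>R\<close> bounds
        it by \<open>state_bound\<close>, and a new majorant \<open>l1\<close> is taken on the
        larger tube.\<close>
      define R where "R = 2 * (\<rho>\<^sub>0 \<Theta> + G) * exp (2 * G)"
      have G0: "0 \<le> G" unfolding G_def by (rule integral_nonneg_half_line[OF growth(1,2)]) auto
      have \<rho>0: "0 \<le> \<rho>\<^sub>0 t" if "0 \<le> t" for t using x\<^sub>0_bound[OF that] norm_ge_zero order_trans by blast
      have R0: "0 \<le> R" unfolding R_def using G0 \<rho>0[OF \<Theta>] by simp
      have "continuous_on {0..} (\<lambda>t. R + \<rho>\<^sub>0 t)" by (intro continuous_intros continuous_\<rho>\<^sub>0)
      then obtain l1 where b1: "bounds (\<lambda>t. R + \<rho>\<^sub>0 t) l1" by (rule bounds_exists)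
      define I1 where "I1 = integral {0..\<Theta>} l1"
      \<comment> \<open>\<open>q1\<close> bounds the shift of the initial state caused by the
        continuation, \<open>q2\<close> the distance of the continued initial adjoint value from
        \<open>\<zeta>\<close>. Both tend to 0 along \<open>r\<close>.\<close>
      define q1 where "q1 = (\<lambda>n. 2 * rn n * exp (2 * I1))"
      have q10: "0 \<le> q1 n" for n using rn0 by (simp add: q1_def)
      define q2 where "q2 = (\<lambda>n. 2 * (d n + ((K + 1) * (q1 n * I1) + \<bar>la n - lam\<bar> * I1)) * exp (2 * I1))"
      have "(\<lambda>k. q1 (r k)) \<longlonglongrightarrow> 2 * 0 * exp (2 * I1)" unfolding q1_def by (intro tendsto_intros lr)
      then have lq1: "(\<lambda>k. q1 (r k)) \<longlonglongrightarrow> 0" by simp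
      have "(\<lambda>k. q2 (r k)) \<longlonglongrightarrow> 2 * (0 + ((K + 1) * (0 * I1) + 0 * I1)) * exp (2 * I1)"
        unfolding q2_def by (intro tendsto_intros l2 ld lq1)
      then have lq2: "(\<lambda>k. q2 (r k)) \<longlonglongrightarrow> 0" by simp
      have hat: "\<exists>xh \<psi>h. state_adjoint_solution f g u\<^sub>0 xh \<psi>h (la n) \<and> norm (xh 0) \<le> q1 n \<and> norm (\<psi>h 0 - \<zeta>) \<le> q2 n \<and> \<psi>h (\<sigma> n) = 0" for n
      proof -
        obtain xb where xb: "primitive xb (\<lambda>t. f t (xb t) (u\<^sub>0 t))" "xb \<Theta> = xn n \<Theta>" using state_exists[OF u\<^sub>0 \<Theta>] .
        obtain \<psi>b where \<psi>b: "primitive \<psi>b (adj xb u\<^sub>0 (la n) \<psi>b)" "\<psi>b \<Theta> = \<psi> n \<Theta>"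
          using adjoint_exists[OF u\<^sub>0 primitive_continuous[OF xb(1)] \<Theta>] .
        have \<Theta>in: "\<Theta> \<in> {0..\<Theta>}" "0 \<in> {0..\<Theta>}" using \<Theta> by auto
        have xbb: "norm (xb t) \<le> R + \<rho>\<^sub>0 t" if t: "t \<in> {0..\<Theta>}" for t
        proof -
          have "norm (xb t) \<le> 2 * (norm (xb \<Theta>) + G) * exp (2 * G)"
            unfolding G_def by (rule state_bound[OF u\<^sub>0 xb(1) \<Theta>in(1) t])
          also have "\<dots> \<le> R" unfolding R_def using xnb[OF \<Theta>, of n] G0 xb(2) by simp
          finally show ?thesis using \<rho>0[of t] t by simp
        qed
        have x0b: "norm (x\<^sub>0 t) \<le> R + \<rho>\<^sub>0 t" if "t \<in> {0..\<Theta>}" for t using x\<^sub>0_bound[of t] that R0 by simp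
        have close: "norm (xb t - x\<^sub>0 t) \<le> q1 n" if t: "t \<in> {0..\<Theta>}" for t
        proof -
          have "norm (xb t - x\<^sub>0 t) \<le> 2 * (norm (xb \<Theta> - x\<^sub>0 \<Theta>) + integral {0..\<Theta>} (\<lambda>t. 0)) * exp (2 * integral {0..\<Theta>} l1)"
          proof (rule primitive_comparison[OF xb(1) x\<^sub>0(1) boundsD(1,2)[OF b1] loc_int_const _ _ \<Theta>in(1) t])
            fix s assume s: "s \<in> {0..\<Theta>}"
            then show "norm (f s (xb s) (u\<^sub>0 s) - f s (x\<^sub>0 s) (u\<^sub>0 s)) \<le> l1 s * norm (xb s - x\<^sub>0 s) + 0"
              using boundsD(7)[OF b1 _ controlsD[OF u\<^sub>0] xbb[OF s] x0b[OF s]] by simp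
          qed simp_all
          also have "\<dots> = 2 * norm (xn n \<Theta> - x\<^sub>0 \<Theta>) * exp (2 * I1)" by (simp add: xb(2) I1_def)
          also have "\<dots> \<le> q1 n" unfolding q1_def using X[OF \<Theta>in(1), of n] by simp
          finally show ?thesis .
        qed
        have "norm (\<psi>b 0 - \<Psi> \<zeta> lam 0) \<le> 2 * (norm (\<psi>b \<Theta> - \<Psi> \<zeta> lam \<Theta>) + ((K + 1) * (q1 n * integral {0..\<Theta>} l1 + 2 * 0 * measure lebesgue ({}::real set))
            + \<bar>la n - lam\<bar> * integral {0..\<Theta>} l1)) * exp (2 * integral {0..\<Theta>} l1)"
        proof (rule adjoint_diff[OF b1 u\<^sub>0 u\<^sub>0])
          show "norm (x\<^sub>0 t) \<le> R + \<rho>\<^sub>0 t" if "t \<in> {0..\<Theta>}" for t by (rule x0b[OF that])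
          show "norm (xb t) \<le> R + \<rho>\<^sub>0 t" if "t \<in> {0..\<Theta>}" for t by (rule xbb[OF that])
          show "norm (xb t - x\<^sub>0 t) \<le> q1 n" if "t \<in> {0..\<Theta>}" for t by (rule close[OF that])
          show "norm (\<Psi> \<zeta> lam t) \<le> K" if "t \<in> {0..\<Theta>}" for t by (rule K(2)[OF that])
        qed (use \<Theta> in \<open>auto intro: \<Psi>(1) \<psi>b(1) q10 lam1\<close>)
        also have "\<dots> \<le> q2 n" unfolding q2_def I1_def using P[OF \<Theta>in(1), of n] \<psi>b(2) by simp
        finally have q2: "norm (\<psi>b 0 - \<zeta>) \<le> q2 n" by (simp add: \<Psi>(2))
        have q1: "norm (xb 0) \<le> q1 n" using close[OF \<Theta>in(2)] x\<^sub>0(2) by simp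
        have E\<Theta>: "E n \<subseteq> {0..\<Theta>}" using E(2) A(2) by blast
        obtain xh \<psi>h where "state_adjoint_solution f g u\<^sub>0 xh \<psi>h (la n)" "xh 0 = xb 0" "\<psi>h 0 = \<psi>b 0" "\<psi>h (\<sigma> n) = 0"
          using pull_back[OF \<Theta> \<sigma>(1) E\<Theta> un traj(1)[OF un] \<psi> xb(1) xb(2)[unfolded xn_def] \<psi>b] .
        then show ?thesis using q1 q2 by metis
      qed
      have "(\<lambda>k. q1 (r k) + q2 (r k) + \<bar>la (r k) - lam\<bar>) \<longlonglongrightarrow> 0 + 0 + 0" by (intro tendsto_intros lq1 lq2 l2)
      then have "\<forall>\<^sub>F k in sequentially. q1 (r k) + q2 (r k) + \<bar>la (r k) - lam\<bar> < \<delta>"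
        using \<delta>(1) by (simp add: order_tendstoD(2))
      then have "\<forall>\<^sub>F k in sequentially. q1 (r k) + q2 (r k) + \<bar>la (r k) - lam\<bar> < \<delta> \<and> N \<le> k"
        using eventually_ge_at_top by (rule eventually_conj)
      then obtain k where k: "q1 (r k) + q2 (r k) + \<bar>la (r k) - lam\<bar> < \<delta>" "N \<le> k" by (auto simp: eventually_sequentially)
      let ?n = "r k"
      obtain xh \<psi>h where h: "state_adjoint_solution f g u\<^sub>0 xh \<psi>h (la ?n)" "norm (xh 0) \<le> q1 ?n" "norm (\<psi>h 0 - \<zeta>) \<le> q2 ?n" "\<psi>h (\<sigma> ?n) = 0"
        using hat[of ?n] by blast
      have "dist (xh 0, \<psi>h 0, la ?n) (0, \<zeta>, lam) \<le> dist (xh 0) 0 + dist (\<psi>h 0, la ?n) (\<zeta>, lam)"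
        unfolding dist_Pair_Pair by (rule sqrt_sum_squares_le_sum) auto
      also have "dist (\<psi>h 0, la ?n) (\<zeta>, lam) \<le> dist (\<psi>h 0) \<zeta> + dist (la ?n) lam"
        unfolding dist_Pair_Pair by (rule sqrt_sum_squares_le_sum) auto
      finally have "dist (xh 0, \<psi>h 0, la ?n) (0, \<zeta>, lam) < \<delta>"
        using h(2,3) k(1) by (simp add: dist_norm dist_real_def)
      \<comment> \<open>The continued solution vanishes at \<open>\<sigma> ?n\<close>, so its
        distance from \<open>\<Psi> \<zeta> lam\<close> there is the norm of the latter.\<close>
      then have "norm (\<psi>h (\<sigma> ?n) - \<Psi> \<zeta> lam (\<sigma> ?n)) < \<epsilon>" using \<delta>(2)[OF h(1) la(1)] \<sigma>(2) by blast
      then have "norm (\<Psi> \<zeta> lam (\<tau> (?n + n0))) < \<epsilon>" using h(4) by (simp add: \<sigma>_def)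
      moreover have "N \<le> ?n + n0" using k(2) seq_suble[OF r, of k] by simp
      ultimately show ?thesis by blast
    qed
    then show ?thesis using lam nrm by (simp add: multipliers_def)
  qed
  show thesis
  proof (rule that[OF mult], rule ccontr)
    fix B \<epsilon> assume B: "B \<in> lmeasurable" "B \<subseteq> A" "0 < measure lebesgue B" and \<epsilon>: "(0::real) < \<epsilon>"
    let ?H = "\<lambda>p t. Ham f g (x\<^sub>0 t) t p lam (\<Psi> \<zeta> lam t)"
    assume "\<not> (\<exists>t\<in>B. ?H (w t) t - ?H (u\<^sub>0 t) t < \<epsilon>)"
    then have HB: "\<epsilon> \<le> ?H (w t) t - ?H (u\<^sub>0 t) t" if "t \<in> B" for t using that by (meson not_less)
    \<comment> \<open>Twice the error of \<open>Ham_close\<close>: once for \<open>w\<close>, once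
      for \<open>u\<^sub>0\<close>.\<close>
    define s where "s = (\<lambda>n. 2 * (\<kappa> * (d n + K * rn n + \<bar>la n - lam\<bar> + rn n)))"
    have "(\<lambda>k. s (r k)) \<longlonglongrightarrow> 2 * (\<kappa> * (0 + K * 0 + 0 + 0))" unfolding s_def by (intro tendsto_intros ld lr l2)
    then have "\<forall>\<^sub>F k in sequentially. s (r k) < \<epsilon> / 2" by (rule order_tendstoD(2)) (use \<epsilon> in simp)
    moreover have "(\<lambda>k. 2 * e (r k) + 2 * \<mu> (r k)) \<longlonglongrightarrow> 2 * 0 + 2 * 0" by (intro tendsto_intros sub[OF elim0] l\<mu>)
    then have "\<forall>\<^sub>F k in sequentially. 2 * e (r k) + 2 * \<mu> (r k) < \<epsilon> / 2" by (rule order_tendstoD(2)) (use \<epsilon> in simp)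
    moreover have "(\<lambda>k. e (r k) + \<mu> (r k)) \<longlonglongrightarrow> 0 + 0" by (intro tendsto_intros sub[OF elim0] l\<mu>)
    then have "\<forall>\<^sub>F k in sequentially. e (r k) + \<mu> (r k) < measure lebesgue B" by (rule order_tendstoD(2)) (use B(3) in simp)
    ultimately have "\<forall>\<^sub>F k in sequentially. s (r k) < \<epsilon> / 2 \<and> 2 * e (r k) + 2 * \<mu> (r k) < \<epsilon> / 2 \<and> e (r k) + \<mu> (r k) < measure lebesgue B"
      by eventually_elim simp
    then obtain n where n: "s n < \<epsilon> / 2" "2 * e n + 2 * \<mu> n < \<epsilon> / 2" "e n + \<mu> n < measure lebesgue B"
      by (auto simp: eventually_sequentially)
    \<comment> \<open>\<open>ineq\<close> speaks only of sets disjoint from \<open>E n\<close>; as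
      the measure of \<open>E n\<close> becomes small, enough of \<open>B\<close> remains.\<close>
    have "measure lebesgue B \<le> measure lebesgue ((B - E n) \<union> E n)"
      by (intro measure_mono_fmeasurable fmeasurableD fmeasurable.Un fmeasurable_Diff B(1) E(1)) auto
    also have "\<dots> \<le> measure lebesgue (B - E n) + \<mu> n"
      unfolding \<mu>_def by (intro measure_Un_le fmeasurableD fmeasurable_Diff B(1) E(1))
    finally have "e n \<le> measure lebesgue (B - E n)" using n(3) by simp
    moreover have "\<epsilon> / 2 \<le> Ham f g (xn n t) t (w t) (la n) (\<psi> n t) - Ham f g (xn n t) t (u\<^sub>0 t) (la n) (\<psi> n t)"
      if t: "t \<in> B - E n" for t
    proof -
      have t\<Theta>: "t \<in> {0..\<Theta>}" and lk: "l t \<le> \<kappa>" using t B(2) A(2,3) by auto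
      then have t0: "0 \<le> t" by simp
      have "\<bar>Ham f g (xn n t) t p (la n) (\<psi> n t) - ?H p t\<bar> \<le> \<kappa> * (d n + K * rn n + \<bar>la n - lam\<bar> + rn n)"
        if p: "p \<in> U t" for p
      proof -
        have "\<bar>Ham f g (xn n t) t p (la n) (\<psi> n t) - ?H p t\<bar> \<le> \<kappa> * (norm (\<psi> n t - \<Psi> \<zeta> lam t) + K * rn n + \<bar>la n - lam\<bar> + rn n)"
          by (rule Ham_close[OF b t0 p xnb[OF t0] x\<^sub>0_bound[OF t0] lk X[OF t\<Theta>] K(2)[OF t\<Theta>] lam1])
        also have "\<dots> \<le> \<kappa> * (d n + K * rn n + \<bar>la n - lam\<bar> + rn n)"
          using P[OF t\<Theta>, of n] \<kappa> by (intro mult_left_mono) auto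
        finally show ?thesis .
      qed
      from this[OF controlsD[OF w t0]] this[OF controlsD[OF u\<^sub>0 t0]] show ?thesis
        using HB[of t] t n(1) unfolding s_def by auto
    qed
    ultimately have "\<epsilon> / 2 \<le> 2 * e n + 2 * measure lebesgue (E n)"
      using B E(1) \<epsilon> unfolding xn_def by (intro ineq[of "B - E n" n "\<epsilon> / 2"] ballI fmeasurable_Diff fmeasurableD) auto
    then show False using n(2) by (simp add: \<mu>_def)
  qed
qed

end

section \<open>The maximum principle\<close>

text \<open>Induction: from the new set a piece is carved out whose measure is below that of every
  set obtained so far, so removing it from those leaves them positive measure.\<close>

lemma disjoint_positive_subsets:
  fixes S :: "'i \<Rightarrow> real set"
  assumes "finite F" "\<And>i. i \<in> F \<Longrightarrow> S i \<in> lmeasurable \<and> S i \<subseteq> {0..T} \<and> 0 < measure lebesgue (S i)"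
  shows "\<exists>S'. disjoint_family_on S' F \<and>
    (\<forall>i\<in>F. S' i \<in> lmeasurable \<and> S' i \<subseteq> S i \<and> 0 < measure lebesgue (S' i))"
  using assms
proof (induction F rule: finite_induct)
  case empty
  then show ?case by (auto simp: disjoint_family_on_def)
next
  case (insert j F)
  then obtain S' where S': "disjoint_family_on S' F"
    "\<And>i. i \<in> F \<Longrightarrow> S' i \<in> lmeasurable \<and> S' i \<subseteq> S i \<and> 0 < measure lebesgue (S' i)" by blast
  have Sj: "S j \<in> lmeasurable" "S j \<subseteq> {0..T}" "0 < measure lebesgue (S j)" using insert.prems by auto
  define V where "V = insert (measure lebesgue (S j)) ((\<lambda>i. measure lebesgue (S' i)) ` F)"
  have V: "finite V" "V \<noteq> {}" "\<And>v. v \<in> V \<Longrightarrow> 0 < v" using insert.hyps(1) S'(2) Sj(3) by (auto simp: V_def)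
  \<comment> \<open>Half of the minimum is strictly below every measure in \<open>V\<close>, and
    \<open>S j\<close> still contains a piece of this size.\<close>
  define \<eta> where "\<eta> = Min V / 2"
  have \<eta>0: "0 < \<eta>" using V(3)[OF Min_in[OF V(1,2)]] by (simp add: \<eta>_def)
  have \<eta>v: "\<eta> < v" if "v \<in> V" for v using Min_le[OF V(1) that] \<eta>0 by (simp add: \<eta>_def)
  have "\<eta> \<le> measure lebesgue (S j)" using \<eta>v[of "measure lebesgue (S j)"] by (simp add: V_def)
  then obtain C where C: "C \<in> lmeasurable" "C \<subseteq> S j" "measure lebesgue C = \<eta>"
    using lmeasurable_subset_of_measure[OF Sj(1,2), of \<eta>] \<eta>0 by (metis less_imp_le)
  define S'' where "S'' = (\<lambda>i. if i = j then C else S' i - C)"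
  have pos: "0 < measure lebesgue (S' i - C)" if i: "i \<in> F" for i
  proof -
    have m: "S' i \<in> lmeasurable" using S'(2)[OF i] by blast
    have "measure lebesgue (S' i) \<le> measure lebesgue ((S' i - C) \<union> C)"
      by (intro measure_mono_fmeasurable fmeasurableD fmeasurable.Un fmeasurable_Diff m C(1)) auto
    also have "\<dots> \<le> measure lebesgue (S' i - C) + \<eta>"
      unfolding C(3)[symmetric] by (intro measure_Un_le fmeasurableD fmeasurable_Diff m C(1))
    finally show ?thesis using \<eta>v[of "measure lebesgue (S' i)"] i by (simp add: V_def)
  qed
  have "disjoint_family_on S'' (insert j F)"
    using S'(1) insert.hyps(2) unfolding disjoint_family_on_def S''_def by auto
  moreover have "\<forall>i\<in>insert j F. S'' i \<in> lmeasurable \<and> S'' i \<subseteq> S i \<and> 0 < measure lebesgue (S'' i)"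
  proof
    fix i assume "i \<in> insert j F"
    then consider "i = j" | "i \<noteq> j" "i \<in> F" by auto
    then show "S'' i \<in> lmeasurable \<and> S'' i \<subseteq> S i \<and> 0 < measure lebesgue (S'' i)"
    proof cases
      case 1
      then show ?thesis using C \<eta>0 by (simp add: S''_def)
    next
      case 2
      then show ?thesis using S'(2)[OF 2(2)] pos[OF 2(2)] C(1) by (auto simp: S''_def intro: fmeasurable_Diff fmeasurableD)
    qed
  qed
  ultimately show ?case by blast
qed

lemma glue_controls:
  fixes S :: "'i \<Rightarrow> real set"
  assumes "finite F" "disjoint_family_on S F" "\<And>i. i \<in> F \<Longrightarrow> S i \<in> sets lebesgue"
    "\<And>i. i \<in> F \<Longrightarrow> V i \<in> controls U" and u: "u \<in> controls U"
  shows "\<exists>w\<in>controls U. \<forall>i\<in>F. \<forall>t\<in>S i. w t = V i t"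
  using assms(1-4)
proof (induction F rule: finite_induct)
  case empty
  then show ?case using u by auto
next
  case (insert j F)
  have "disjoint_family_on S F" using insert.prems(1) by (rule disjoint_family_on_mono[rotated]) auto
  then obtain w where w: "w \<in> controls U" "\<And>i t. i \<in> F \<Longrightarrow> t \<in> S i \<Longrightarrow> w t = V i t" using insert by (metis insertCI)
  let ?w = "\<lambda>t. if t \<in> S j then V j t else w t"
  have h1: "?w \<in> controls U" using insert.prems(2,3) w(1) by (intro controls_if) auto
  have h2: "\<forall>i\<in>insert j F. \<forall>t\<in>S i. ?w t = V i t"
  proof (intro ballI)
    fix i t assume i: "i \<in> insert j F" and t: "t \<in> S i"
    show "?w t = V i t"
    proof (cases "i = j")
      case False
      then have "S i \<inter> S j = {}" using insert.prems(1) i by (auto simp: disjoint_family_on_def)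
      then show ?thesis using False i t w(2) by auto
    qed (use t in auto)
  qed
  show ?case by (rule rev_bexI[OF h1]) (rule h2)
qed

context stable_optimum
begin

definition Hdiff :: "(real \<Rightarrow> 'u) \<Rightarrow> real^'m \<Rightarrow> real \<Rightarrow> real \<Rightarrow> real" where
  "Hdiff v \<zeta> lam t = Ham f g (x\<^sub>0 t) t (v t) lam (\<Psi> \<zeta> lam t) - Ham f g (x\<^sub>0 t) t (u\<^sub>0 t) lam (\<Psi> \<zeta> lam t)"

lemma Hdiff_measurable:
  assumes v: "v \<in> controls U" shows "Hdiff v \<zeta> lam \<in> borel_measurable (lebesgue_on {0..})"
proof -
  have [measurable]: "(\<lambda>t. f t (x\<^sub>0 t) (p t)) \<in> borel_measurable (lebesgue_on {0..})"
    "(\<lambda>t. g t (x\<^sub>0 t) (p t)) \<in> borel_measurable (lebesgue_on {0..})" if "p \<in> controls U" for p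
    using caratheodory_measurable[OF regularity(1) that primitive_continuous[OF x\<^sub>0(1)]]
      caratheodory_measurable[OF regularity(2) that primitive_continuous[OF x\<^sub>0(1)]] by auto
  note [measurable] = continuous_on_measurable_half_line[OF primitive_continuous[OF \<Psi>(1)]] v u\<^sub>0
  show ?thesis unfolding Hdiff_def[abs_def] Ham_def by measurable
qed

text \<open>The inequality then fails by a fixed margin on a bounded set of positive measure where
  \<open>l\<close> is bounded. There the dependence on \<open>(\<zeta>, lam)\<close> is uniform in
  \<open>t\<close>, so half of the margin survives for nearby initial data on the same set
  \<open>S\<close>.\<close>

lemma Hdiff_locally_positive:
  assumes b: "bounds \<rho>\<^sub>0 l" and v: "v \<in> controls U" and lam: "lam \<in> {0..1}"
    and bad: "\<not> (AE t in lebesgue_on {0..}. Hdiff v \<zeta> lam t \<le> 0)"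
  obtains S k c N where "S \<in> lmeasurable" "S \<subseteq> {0..real k}" "\<And>t. t \<in> S \<Longrightarrow> l t \<le> real k" "0 < measure lebesgue S"
    "0 < c" "open N" "(\<zeta>, lam) \<in> N" "\<And>\<zeta>' lam' t. (\<zeta>', lam') \<in> N \<Longrightarrow> t \<in> S \<Longrightarrow> c \<le> Hdiff v \<zeta>' lam' t"
proof -
  \<comment> \<open>One integer serves as time horizon, as bound for \<open>l\<close> and, up to the
    shift by 1, as inverse of the margin.\<close>
  define S where "S = (\<lambda>k::nat. {t\<in>{0..}. t \<le> real k \<and> l t \<le> real k \<and> 1 / real (Suc k) \<le> Hdiff v \<zeta> lam t})"
  have Sm: "S k \<in> lmeasurable" for k
  proof -
    note [measurable] = Hdiff_measurable[OF v, of \<zeta> lam] loc_int_measurable[OF boundsD(1)[OF b]]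
    have [measurable]: "(\<lambda>t. t) \<in> borel_measurable (lebesgue_on {0::real..})"
      by (intro continuous_on_measurable_half_line continuous_intros)
    have "{t \<in> space (lebesgue_on {0..}). t \<le> real k \<and> l t \<le> real k \<and> 1 / real (Suc k) \<le> Hdiff v \<zeta> lam t} \<in> sets (lebesgue_on {0..})"
      by measurable
    then have "S k \<in> sets lebesgue" unfolding S_def by (simp add: sets_restrict_space_iff)
    moreover have "S k \<subseteq> {0..real k}" by (auto simp: S_def)
    ultimately show ?thesis by (metis bounded_closed_interval bounded_set_imp_lmeasurable bounded_subset)
  qed
  have "\<exists>k. 0 < measure lebesgue (S k)"
  proof (rule ccontr)
    assume "\<not> (\<exists>k. 0 < measure lebesgue (S k))"
    then have "measure lebesgue (S k) = 0" for k using measure_nonneg[of lebesgue "S k"] by (metis less_eq_real_def)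
    then have "negligible (S k)" for k using Sm negligible_iff_measure by blast
    then have "negligible (\<Union>k. S k)" by (intro negligible_countable_Union) auto
    moreover have "{t\<in>{0..}. \<not> Hdiff v \<zeta> lam t \<le> 0} \<subseteq> (\<Union>k. S k)"
    proof
      fix t assume t: "t \<in> {t\<in>{0..}. \<not> Hdiff v \<zeta> lam t \<le> 0}"
      then obtain m where m: "1 / real (Suc m) < Hdiff v \<zeta> lam t" using nat_approx_posE[of "Hdiff v \<zeta> lam t"] by auto
      obtain k where k: "max (real m) (max t (l t)) \<le> real k" using real_arch_simple by blast
      then have "1 / real (Suc k) \<le> 1 / real (Suc m)" by (intro divide_left_mono) auto
      then have "t \<in> S k" using t m k by (auto simp: S_def)
      then show "t \<in> (\<Union>k. S k)" by blast
    qed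
    ultimately have "negligible {t\<in>{0..}. \<not> Hdiff v \<zeta> lam t \<le> 0}" by (rule negligible_subset)
    then show False using bad by (simp add: AE_lebesgue_on_iff_negligible)
  qed
  then obtain k where k: "0 < measure lebesgue (S k)" by blast
  define c where "c = 1 / real (Suc k) / 2"
  have c: "0 < c" and c2: "2 * c = 1 / real (Suc k)" by (simp_all add: c_def del: of_nat_Suc)
  define I where "I = integral {0..real k} l"
  \<comment> \<open>Twice the error of \<open>Ham_close\<close>, for \<open>v\<close> and for
    \<open>u\<^sub>0\<close>, with the difference of the adjoint functions estimated by
    \<open>adjoint_diff\<close>. It is continuous and vanishes at
    \<open>(\<zeta>, lam)\<close>.\<close>
  define h where "h = (\<lambda>m::(real^'m) \<times> real. 2 * (real k * (2 * (norm (fst m - \<zeta>) + \<bar>snd m - lam\<bar> * I) * exp (2 * I) + \<bar>snd m - lam\<bar>)))"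
  define N where "N = {m. h m < c}"
  have "open N" unfolding N_def h_def by (intro open_Collect_less continuous_intros)
  moreover have "(\<zeta>, lam) \<in> N" using c by (simp add: N_def h_def)
  moreover have "c \<le> Hdiff v \<zeta>' lam' t" if m: "(\<zeta>', lam') \<in> N" and t: "t \<in> S k" for \<zeta>' lam' t
  proof -
    have tk: "t \<in> {0..real k}" "0 \<in> {0..real k}" "0 \<le> t" and lk: "l t \<le> real k" and Hk: "2 * c \<le> Hdiff v \<zeta> lam t"
      using t c2 by (auto simp: S_def simp del: of_nat_Suc)
    have "continuous_on {0..real k} (\<Psi> \<zeta> lam)"
      using primitive_continuous[OF \<Psi>(1)] by (rule continuous_on_subset) auto
    then obtain K where K: "0 \<le> K" "\<And>t. t \<in> {0..real k} \<Longrightarrow> norm (\<Psi> \<zeta> lam t) \<le> K" by (metis continuous_bound)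
    have lam1: "\<bar>lam\<bar> \<le> 1" using lam by simp
    have xb: "norm (x\<^sub>0 t) \<le> \<rho>\<^sub>0 t" if "t \<in> {0..real k}" for t using that x\<^sub>0_bound by simp
    have "norm (\<Psi> \<zeta>' lam' t - \<Psi> \<zeta> lam t) \<le> 2 * (norm (\<Psi> \<zeta>' lam' 0 - \<Psi> \<zeta> lam 0) + ((K + 1) * (0 * integral {0..real k} l + 2 * 0 * measure lebesgue ({}::real set))
            + \<bar>lam' - lam\<bar> * integral {0..real k} l)) * exp (2 * integral {0..real k} l)"
    proof (rule adjoint_diff[OF b u\<^sub>0 u\<^sub>0])
      show "norm (x\<^sub>0 t) \<le> \<rho>\<^sub>0 t" if "t \<in> {0..real k}" for t by (rule xb[OF that])
      then show "norm (x\<^sub>0 t) \<le> \<rho>\<^sub>0 t" if "t \<in> {0..real k}" for t using that by blast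
      show "norm (\<Psi> \<zeta> lam t) \<le> K" if "t \<in> {0..real k}" for t by (rule K(2)[OF that])
    qed (use \<Psi>(1) tk lam1 in auto)
    then have d: "norm (\<Psi> \<zeta>' lam' t - \<Psi> \<zeta> lam t) \<le> 2 * (norm (\<zeta>' - \<zeta>) + \<bar>lam' - lam\<bar> * I) * exp (2 * I)"
      by (simp add: \<Psi>(2) I_def)
    have "\<bar>Ham f g (x\<^sub>0 t) t p lam' (\<Psi> \<zeta>' lam' t) - Ham f g (x\<^sub>0 t) t p lam (\<Psi> \<zeta> lam t)\<bar> \<le> h (\<zeta>', lam') / 2"
      if p: "p \<in> U t" for p
    proof -
      have "\<bar>Ham f g (x\<^sub>0 t) t p lam' (\<Psi> \<zeta>' lam' t) - Ham f g (x\<^sub>0 t) t p lam (\<Psi> \<zeta> lam t)\<bar>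
         \<le> real k * (norm (\<Psi> \<zeta>' lam' t - \<Psi> \<zeta> lam t) + K * 0 + \<bar>lam' - lam\<bar> + 0)"
        by (rule Ham_close[OF b tk(3) p xb[OF tk(1)] xb[OF tk(1)] lk _ K(2)[OF tk(1)] lam1]) simp
      also have "\<dots> \<le> real k * (2 * (norm (\<zeta>' - \<zeta>) + \<bar>lam' - lam\<bar> * I) * exp (2 * I) + \<bar>lam' - lam\<bar>)"
        using d by (intro mult_left_mono) auto
      finally show ?thesis by (simp add: h_def)
    qed
    from this[OF controlsD[OF v tk(3)]] this[OF controlsD[OF u\<^sub>0 tk(3)]] show ?thesis
      using m Hk unfolding N_def Hdiff_def mem_Collect_eq by linarith
  qed
  moreover have "S k \<subseteq> {0..real k}" "\<And>t. t \<in> S k \<Longrightarrow> l t \<le> real k" by (auto simp: S_def)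
  ultimately show thesis using Sm k c that by blast
qed

lemma multiplier_exists:
  assumes V: "\<And>j::nat. V j \<in> controls U"
  obtains \<zeta> lam where "(\<zeta>, lam) \<in> multipliers" "\<forall>j. AE t in lebesgue_on {0..}. Hdiff (V j) \<zeta> lam t \<le> 0"
proof (rule ccontr)
  note witness = that
  assume "\<not> thesis"
  then have none: "\<exists>j. \<not> (AE t in lebesgue_on {0..}. Hdiff (V j) \<zeta> lam t \<le> 0)" if "(\<zeta>, lam) \<in> multipliers" for \<zeta> lam
    using that witness by blast
  obtain l where b: "bounds \<rho>\<^sub>0 l" using bounds_exists[OF continuous_\<rho>\<^sub>0] .
  define Q where "Q = (\<lambda>m (j::nat, S, k::nat, c::real, N). S \<in> lmeasurable \<and> S \<subseteq> {0..real k} \<and> (\<forall>t\<in>S. l t \<le> real k) \<and>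
      0 < measure lebesgue S \<and> 0 < c \<and> open N \<and> m \<in> N \<and> (\<forall>\<zeta> lam t. (\<zeta>, lam) \<in> N \<longrightarrow> t \<in> S \<longrightarrow> c \<le> Hdiff (V j) \<zeta> lam t))"
  have "\<exists>z. Q m z" if "m \<in> multipliers" for m
  proof -
    obtain \<zeta> lam where m: "m = (\<zeta>, lam)" by (cases m)
    then obtain j where j: "\<not> (AE t in lebesgue_on {0..}. Hdiff (V j) \<zeta> lam t \<le> 0)" using none \<open>m \<in> multipliers\<close> by blast
    have lam: "lam \<in> {0..1}" using \<open>m \<in> multipliers\<close> by (simp add: m multipliers_def)
    obtain S k c N where "S \<in> lmeasurable" "S \<subseteq> {0..real k}" "\<And>t. t \<in> S \<Longrightarrow> l t \<le> real k" "0 < measure lebesgue S"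
      "0 < c" "open N" "(\<zeta>, lam) \<in> N" "\<And>\<zeta>' lam' t. (\<zeta>', lam') \<in> N \<Longrightarrow> t \<in> S \<Longrightarrow> c \<le> Hdiff (V j) \<zeta>' lam' t"
      using Hdiff_locally_positive[OF b V lam j] by blast
    then have "Q m (j, S, k, c, N)" unfolding Q_def m by simp
    then show ?thesis by blast
  qed
  then obtain Z where Z: "\<And>m. m \<in> multipliers \<Longrightarrow> Q m (Z m)" by metis
  define j where "j = (\<lambda>m. fst (Z m))"
  define S where "S = (\<lambda>m. fst (snd (Z m)))"
  define k where "k = (\<lambda>m. fst (snd (snd (Z m))))"
  define c where "c = (\<lambda>m. fst (snd (snd (snd (Z m)))))"
  define N where "N = (\<lambda>m. snd (snd (snd (snd (Z m)))))"
  have Q: "Q m (j m, S m, k m, c m, N m)" if "m \<in> multipliers" for m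
    using Z[OF that] by (simp add: j_def S_def k_def c_def N_def)
  have S: "S m \<in> lmeasurable" "S m \<subseteq> {0..real (k m)}" "\<And>t. t \<in> S m \<Longrightarrow> l t \<le> real (k m)" "0 < measure lebesgue (S m)"
    and c: "0 < c m" and N: "open (N m)" "m \<in> N m" "\<And>\<zeta> lam t. (\<zeta>, lam) \<in> N m \<Longrightarrow> t \<in> S m \<Longrightarrow> c m \<le> Hdiff (V (j m)) \<zeta> lam t"
    if "m \<in> multipliers" for m
    using Q[OF that] unfolding Q_def by auto
  have "multipliers \<subseteq> (\<Union>m\<in>multipliers. N m)" using N(2) by blast
  then obtain F where F: "F \<subseteq> multipliers" "finite F" "multipliers \<subseteq> (\<Union>m\<in>F. N m)"
    using compactE_image[OF compact_multipliers, of multipliers N] N(1) by metis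
  \<comment> \<open>Serves both as the end of an interval containing all needles and as the bound
    for \<open>l\<close> on them.\<close>
  define T where "T = (\<Sum>m\<in>F. real (k m))"
  have kT: "real (k m) \<le> T" if "m \<in> F" for m unfolding T_def using F(2) that by (intro member_le_sum) auto
  have T0: "0 \<le> T" unfolding T_def by (intro sum_nonneg) simp
  have "S m \<in> lmeasurable \<and> S m \<subseteq> {0..T} \<and> 0 < measure lebesgue (S m)" if "m \<in> F" for m
  proof -
    have m: "m \<in> multipliers" using F(1) that by blast
    have "{0..real (k m)} \<subseteq> {0..T}" using kT[OF that] by auto
    then show ?thesis using S(1,2,4)[OF m] by blast
  qed
  \<comment> \<open>The sets \<open>S m\<close> may overlap, while a single \<open>w\<close> has to
    realise every violation; hence the passage to disjoint subsets of positive measure.\<close>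
  then obtain S' where S': "disjoint_family_on S' F"
    "\<And>m. m \<in> F \<Longrightarrow> S' m \<in> lmeasurable \<and> S' m \<subseteq> S m \<and> 0 < measure lebesgue (S' m)"
    using disjoint_positive_subsets[OF F(2)] by metis
  obtain w where w: "w \<in> controls U" "\<And>m t. m \<in> F \<Longrightarrow> t \<in> S' m \<Longrightarrow> w t = V (j m) t"
    using glue_controls[OF F(2) S'(1), of "\<lambda>m. V (j m)" U u\<^sub>0] S'(2) V u\<^sub>0 by (metis fmeasurableD)
  define A where "A = (\<Union>m\<in>F. S' m)"
  have A: "A \<in> lmeasurable" unfolding A_def using F(2) S'(2) by (intro fmeasurable.finite_UN) auto
  have A': "t \<in> {0..T} \<and> l t \<le> T" if tA: "t \<in> A" for t
  proof -
    obtain m where m: "m \<in> F" "t \<in> S' m" using tA unfolding A_def by blast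
    then have mm: "m \<in> multipliers" "t \<in> S m" using F(1) S'(2)[OF m(1)] by blast+
    then have "t \<in> {0..real (k m)}" "l t \<le> real (k m)"
      using subsetD[OF S(2)[OF mm(1)] mm(2)] S(3)[OF mm] by auto
    then show ?thesis using kT[OF m(1)] by auto
  qed
  have AT: "A \<subseteq> {0..T}" "\<And>t. t \<in> A \<Longrightarrow> l t \<le> T" using A' by auto
  obtain \<zeta> lam where mult: "(\<zeta>, lam) \<in> multipliers"
    and small: "\<And>B \<epsilon>. B \<in> lmeasurable \<Longrightarrow> B \<subseteq> A \<Longrightarrow> 0 < measure lebesgue B \<Longrightarrow> 0 < \<epsilon> \<Longrightarrow>
      \<exists>t\<in>B. Ham f g (x\<^sub>0 t) t (w t) lam (\<Psi> \<zeta> lam t) - Ham f g (x\<^sub>0 t) t (u\<^sub>0 t) lam (\<Psi> \<zeta> lam t) < \<epsilon>"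
    using needle_multiplier[OF b T0 w(1) T0 A AT] by blast
  \<comment> \<open>The multiplier that belongs to \<open>w\<close> lies in some \<open>N m\<close>,
    where the violation by \<open>c m\<close> persists on all of \<open>S' m\<close>; yet
    \<open>small\<close> gives a point of \<open>S' m\<close> with a smaller gain.\<close>
  obtain m where m: "m \<in> F" "(\<zeta>, lam) \<in> N m" using mult F(3) by blast
  have mm: "m \<in> multipliers" using m F(1) by blast
  have "S' m \<subseteq> A" using m(1) by (auto simp: A_def)
  then obtain t where t: "t \<in> S' m" "Ham f g (x\<^sub>0 t) t (w t) lam (\<Psi> \<zeta> lam t) - Ham f g (x\<^sub>0 t) t (u\<^sub>0 t) lam (\<Psi> \<zeta> lam t) < c m"
    using small[of "S' m" "c m"] S'(2)[OF m(1)] c[OF mm] by blast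
  have "t \<in> S m" using t(1) S'(2)[OF m(1)] by blast
  then have "c m \<le> Hdiff (V (j m)) \<zeta> lam t" by (rule N(3)[OF mm m(2)])
  then show False using t(2) w(2)[OF m(1) t(1)] by (simp add: Hdiff_def)
qed

lemma maximum_principle:
  "\<exists>lam \<psi>. (x\<^sub>0, u\<^sub>0, lam, \<psi>) \<in> PMP U f g \<and> liminf (\<lambda>n. ereal (norm (\<psi> (\<tau> n)))) = 0"
proof -
  obtain V :: "nat \<Rightarrow> real \<Rightarrow> 'u" where V: "\<And>j. V j \<in> controls U"
    "\<And>t p e. 0 \<le> t \<Longrightarrow> p \<in> U t \<Longrightarrow> e > 0 \<Longrightarrow> \<exists>j. dist (V j t) p < e"
    using castaing_controls[OF cu u\<^sub>0] by blast
  obtain \<zeta> lam where mult: "(\<zeta>, lam) \<in> multipliers"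
    and ae: "\<forall>j. AE t in lebesgue_on {0..}. Hdiff (V j) \<zeta> lam t \<le> 0"
    by (rule multiplier_exists[where V=V, OF V(1)])
  have lam: "lam \<in> {0..1}" "norm \<zeta> + lam = 1"
    and near: "\<And>\<epsilon> N. \<epsilon> > 0 \<Longrightarrow> \<exists>n\<ge>N. norm (\<Psi> \<zeta> lam (\<tau> n)) < \<epsilon>" using mult by (auto simp: multipliers_def)
  let ?H = "\<lambda>t p. Ham f g (x\<^sub>0 t) t p lam (\<Psi> \<zeta> lam t)"
  \<comment> \<open>The inequality along the dense family extends to every \<open>p\<close> in
    \<open>U t\<close> by continuity of the Hamiltonian in the control.\<close>
  have max: "?H t p \<le> ?H t (u\<^sub>0 t)" if t: "0 \<le> t" and H: "\<forall>j. Hdiff (V j) \<zeta> lam t \<le> 0" and p: "p \<in> U t" for t p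
  proof -
    have cf': "continuous_on (U t) (\<lambda>q. a t (x\<^sub>0 t) q)" if "caratheodory U a" for a :: "real \<Rightarrow> real^'m \<Rightarrow> 'u \<Rightarrow> 'd::euclidean_space"
    proof -
      have "continuous_on (UNIV \<times> U t) (\<lambda>(y, u). a t y u)" using that t by (auto simp: caratheodory_def)
      then have "continuous_on (U t) ((\<lambda>(y, u). a t y u) \<circ> (\<lambda>q. (x\<^sub>0 t, q)))"
        by (intro continuous_on_compose continuous_intros) (auto elim: continuous_on_subset)
      then show ?thesis by (simp add: o_def)
    qed
    have Hc: "continuous_on (U t) (?H t)"
      unfolding Ham_def by (intro continuous_intros cf' regularity)
    have "\<exists>j. dist (V j t) p < 1 / real (Suc n)" for n by (rule V(2)[OF t p]) simp
    then obtain J where J: "\<And>n. dist (V (J n) t) p < 1 / real (Suc n)" by metis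
    have "(\<lambda>n. dist (V (J n) t) p) \<longlonglongrightarrow> 0"
    proof (rule tendsto_sandwich[OF _ _ tendsto_const])
      show "(\<lambda>n. 1 / real (Suc n)) \<longlonglongrightarrow> 0" using LIMSEQ_inverse_real_of_nat by (simp add: inverse_eq_divide)
    qed (use J in \<open>auto intro!: always_eventually less_imp_le\<close>)
    then have "(\<lambda>n. V (J n) t) \<longlonglongrightarrow> p" by (rule tendsto_dist_iff[THEN iffD2])
    then have lim: "(\<lambda>n. ?H t (V (J n) t)) \<longlonglongrightarrow> ?H t p"
      by (rule continuous_on_tendsto_compose[OF Hc _ p]) (use controlsD[OF V(1) t] in auto)
    have "?H t (V (J n) t) \<le> ?H t (u\<^sub>0 t)" for n using H by (simp add: Hdiff_def)
    then show ?thesis by (intro tendsto_upperbound[OF lim]) auto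
  qed
  \<comment> \<open>Countability of the family allows one exceptional null set for all its
    members.\<close>
  have "AE t in lebesgue_on {0..}. \<forall>j. Hdiff (V j) \<zeta> lam t \<le> 0" using ae by (simp add: AE_all_countable)
  moreover have "AE t in lebesgue_on {0..}. t \<in> space (lebesgue_on {0::real..})" by (rule AE_space)
  ultimately have "AE t in lebesgue_on {0..}. ?H t (u\<^sub>0 t) = (SUP p\<in>U t. ?H t p)"
  proof eventually_elim
    case (elim t)
    then have t: "0 \<le> t" by simp
    show ?case
    proof (rule cSup_eq_maximum[symmetric])
      show "?H t (u\<^sub>0 t) \<in> ?H t ` U t" using controlsD[OF u\<^sub>0 t] by blast
      show "y \<le> ?H t (u\<^sub>0 t)" if "y \<in> ?H t ` U t" for y using that max[OF t] elim by auto
    qed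
  qed
  then have "(x\<^sub>0, u\<^sub>0, lam, \<Psi> \<zeta> lam) \<in> PMP U f g"
    unfolding PMP_def using u\<^sub>0 lam \<Psi>_solution x\<^sub>0(2) \<Psi>(2) by simp
  moreover have "liminf (\<lambda>n. ereal (norm (\<Psi> \<zeta> lam (\<tau> n)))) = 0"
  proof (rule antisym)
    show "0 \<le> liminf (\<lambda>n. ereal (norm (\<Psi> \<zeta> lam (\<tau> n))))" by (rule Liminf_bounded) simp
    show "liminf (\<lambda>n. ereal (norm (\<Psi> \<zeta> lam (\<tau> n)))) \<le> 0"
    proof (rule ereal_le_epsilon2)
      fix \<epsilon> :: real assume \<epsilon>: "0 < \<epsilon>"
      have "(INF n\<in>{N..}. ereal (norm (\<Psi> \<zeta> lam (\<tau> n)))) \<le> 0 + ereal \<epsilon>" for N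
      proof -
        obtain n where "n \<ge> N" "norm (\<Psi> \<zeta> lam (\<tau> n)) < \<epsilon>" using near[OF \<epsilon>] by blast
        then show ?thesis by (intro INF_lower2[of n]) auto
      qed
      then show "liminf (\<lambda>n. ereal (norm (\<Psi> \<zeta> lam (\<tau> n)))) \<le> 0 + ereal \<epsilon>"
        unfolding liminf_SUP_INF by (intro SUP_least) simp
    qed
  qed
  ultimately show ?thesis by blast
qed

end

theorem corollary1:
  fixes U :: "real \<Rightarrow> 'u::euclidean_space set"
    and f :: "real \<Rightarrow> real^'m \<Rightarrow> 'u \<Rightarrow> real^'m"
    and g :: "real \<Rightarrow> real^'m \<Rightarrow> 'u \<Rightarrow> real"
    and x\<^sub>0 :: "real \<Rightarrow> real^'m"
    and u\<^sub>0 :: "real \<Rightarrow> 'u"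
    and G\<^sub>0 :: "((real^'m) \<times> (real^'m) \<times> real) set"
  assumes "cond_u U"
    and "cond_f U f"
    and "cond_g U f g"
    and "cond_d U f g"
    and "optimal_pair U f g x\<^sub>0 u\<^sub>0"
    and "G\<^sub>0 = UNIV \<times> UNIV \<times> {0..1}"
    and "\<And>\<psi>\<^sub>0 lam\<^sub>0. state_adjoint_solution f g u\<^sub>0 x\<^sub>0 \<psi>\<^sub>0 lam\<^sub>0 \<Longrightarrow> (x\<^sub>0 0, \<psi>\<^sub>0 0, lam\<^sub>0) \<in> G\<^sub>0 \<Longrightarrow>
           lyapunov_stable_component G\<^sub>0 f g u\<^sub>0 x\<^sub>0 \<psi>\<^sub>0 lam\<^sub>0"
  shows "\<forall>\<tau> :: nat \<Rightarrow> real. (\<forall>n. 0 \<le> \<tau> n) \<and> incseq \<tau> \<and> filterlim \<tau> at_top sequentially \<longrightarrow>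
           (\<exists>lam \<psi>. (x\<^sub>0, u\<^sub>0, lam, \<psi>) \<in> PMP U f g \<and>
              liminf (\<lambda>n. ereal (norm (\<psi> (\<tau> n)))) = 0)"
proof (intro allI impI)
  fix \<tau> :: "nat \<Rightarrow> real" assume \<tau>: "(\<forall>n. 0 \<le> \<tau> n) \<and> incseq \<tau> \<and> filterlim \<tau> at_top sequentially"
  interpret stable_optimum U f g x\<^sub>0 u\<^sub>0 \<tau>
  proof
    show "cond_u U" "cond_f U f" "cond_g U f g" "cond_d U f g" "optimal_pair U f g x\<^sub>0 u\<^sub>0" by (fact assms)+
    show "lyapunov_stable_component (UNIV \<times> UNIV \<times> {0..1}) f g u\<^sub>0 x\<^sub>0 \<psi> lam"
      if "state_adjoint_solution f g u\<^sub>0 x\<^sub>0 \<psi> lam" "lam \<in> {0..1}" for \<psi> lam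
      using assms(7)[OF that(1)] that(2) unfolding assms(6) by simp
    show "0 \<le> \<tau> n" for n using \<tau> by blast
    show "filterlim \<tau> at_top sequentially" using \<tau> by blast
  qed
  show "\<exists>lam \<psi>. (x\<^sub>0, u\<^sub>0, lam, \<psi>) \<in> PMP U f g \<and>
      liminf (\<lambda>n. ereal (norm (\<psi> (\<tau> n)))) = 0"
    by (rule maximum_principle)
qed

end
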